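(* Let $\Gamma$ be a discrete countable LCA group, $(\mathcal{X},\mu)$ a $\sigma$-finite measure space, and $\sigma$ a quasi-$\Gamma$-invariant action of $\Gamma$ on $\mathcal{X}$ with the tiling property. Let $\ell\in\mathbb{N}$ and $\Psi=\{\psi_1,\dots,\psi_m\}\subseteq L^2(\mathcal{X})$. Then there exists $V^*\in\mathcal{C}_\ell$, i.e. a finitely generated $(\Gamma,\sigma)$-invariant space of length at most $\ell$, such that $$\sum_{j=1}^m\|\psi_j-P_{V^*}\psi_j\|^2\le\sum_{j=1}^m\|\psi_j-P_V\psi_j\|^2\qquad\text{for all } V\in\mathcal{C}_\ell .$$
   Context: Groups are written additively. A measurable action $\sigma:\Gamma\times\mathcal{X}\to\mathcal{X}$, $\sigma_\gamma(x)=\sigma(\gamma,x)$, satisfies: each $\sigma_\gamma$ is $\mu$-measurable, $\sigma_\gamma\circ\sigma_{\gamma'}=\sigma_{\gamma+\gamma'}$, and $\sigma_e=\mathrm{id}$. It is quasi-$\Gamma$-invariant if there is a measurable function $J_\sigma:\Gamma\times\mathcal{X}\to\mathbb{R}^+$ (the Jacobian) with $d\mu(\sigma_\gamma(x))=J_\sigma(\gamma,x)\,d\mu(x)$. It induces the unitary representation $\Pi$ of $\Gamma$ on $L^2(\mathcal{X})$, $\Pi_\gamma f(x)=J_\sigma(-\gamma,x)^{1/2}f(\sigma_{-\gamma}(x))$. It has the tiling property if there is a measurable set $C_\Gamma\subseteq\mathcal{X}$ with $\mu(\mathcal{X}\setminus\bigcup_{\gamma\in\Gamma}\sigma_\gamma(C_\Gamma))=0$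 and $\mu(\sigma_\gamma(C_\Gamma)\cap\sigma_{\gamma'}(C_\Gamma))=0$ for $\gamma\ne\gamma'$. A closed subspace $V\subseteq L^2(\mathcal{X})$ is $(\Gamma,\sigma)$-invariant if $\Pi_\gamma f\in V$ for all $f\in V$, $\gamma\in\Gamma$. It is finitely generated if $V=\overline{\mathrm{span}}\{\Pi_\gamma\varphi:\gamma\in\Gamma,\varphi\in\mathcal{A}\}$ for some finite set $\mathcal{A}\subseteq L^2(\mathcal{X})$; its length $\ell(V)$ is the minimum number of functions needed to generate it. $\mathcal{C}_\ell$ is the class of all finitely generated $(\Gamma,\sigma)$-invariant spaces $V\subseteq L^2(\mathcal{X})$ with $\ell(V)\le\ell$. $P_V$ denotes the orthogonal projection of $L^2(\mathcal{X})$ onto $V$. *)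

theory Defs
  imports "HOL-Analysis.Analysis"
begin

text \<open>
  \<open>L\<^sup>2(X)\<close> is handled through representatives: its elements are complex-valued square-integrable
  functions, and equality of classes is almost-everywhere equality.  A closed subspace is
  a set of representatives; being closed for the seminorm \<open>l2_norm\<close>, it is automatically
  saturated under almost-everywhere equality.
\<close>

definition L2 :: "'a measure \<Rightarrow> ('a \<Rightarrow> complex) set" where
  "L2 M = {f \<in> borel_measurable M. integrable M (\<lambda>x. (cmod (f x))\<^sup>2)}"

definition l2_inner :: "'a measure \<Rightarrow> ('a \<Rightarrow> complex) \<Rightarrow> ('a \<Rightarrow> complex) \<Rightarrow> complex" where
  "l2_inner M f g = (LINT x|M. f x * cnj (g x))"

definition l2_norm :: "'a measure \<Rightarrow> ('a \<Rightarrow> complex) \<Rightarrow> real" where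
  "l2_norm M f = sqrt (LINT x|M. (cmod (f x))\<^sup>2)"

definition l2_closure :: "'a measure \<Rightarrow> ('a \<Rightarrow> complex) set \<Rightarrow> ('a \<Rightarrow> complex) set" where
  "l2_closure M S = {f \<in> L2 M. \<forall>e>0. \<exists>g\<in>S. l2_norm M (\<lambda>x. f x - g x) < e}"

definition cspan_fun :: "('a \<Rightarrow> complex) set \<Rightarrow> ('a \<Rightarrow> complex) set" where
  "cspan_fun S = {(\<lambda>x. \<Sum>b\<in>T. c b * b x) | T c. finite T \<and> T \<subseteq> S}"

definition closed_l2_subspace :: "'a measure \<Rightarrow> ('a \<Rightarrow> complex) set \<Rightarrow> bool" where
  "closed_l2_subspace M V \<longleftrightarrow>
     V \<subseteq> L2 M \<and>
     (\<lambda>x. 0) \<in> V \<and>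
     (\<forall>f\<in>V. \<forall>g\<in>V. (\<lambda>x. f x + g x) \<in> V) \<and>
     (\<forall>c. \<forall>f\<in>V. (\<lambda>x. c * f x) \<in> V) \<and>
     l2_closure M V \<subseteq> V"

text \<open>
  For a closed subspace \<open>V\<close> and \<open>f \<in> L2 M\<close> the chosen function is a representative of the
  orthogonal projection of \<open>f\<close>, which is unique only up to almost-everywhere equality.
\<close>

definition l2_proj :: "'a measure \<Rightarrow> ('a \<Rightarrow> complex) set \<Rightarrow> ('a \<Rightarrow> complex) \<Rightarrow> ('a \<Rightarrow> complex)" where
  "l2_proj M V f = (SOME g. g \<in> V \<and> (\<forall>h\<in>V. l2_inner M (\<lambda>x. f x - g x) h = 0))"

text \<open>
  A countable discrete LCA group is a type of class \<open>{ab_group_add, countable}\<close>: the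
  topology is discrete and so carries no information, and the measurable structure on the group
  is \<open>count_space UNIV\<close>.
\<close>

definition measurable_action ::
    "'a measure \<Rightarrow> ('g::{ab_group_add, countable} \<Rightarrow> 'a \<Rightarrow> 'a) \<Rightarrow> bool" where
  "measurable_action M \<sigma> \<longleftrightarrow>
     (\<forall>\<gamma>. \<sigma> \<gamma> \<in> measurable M M) \<and>
     (\<forall>\<gamma> \<gamma>'. \<forall>x\<in>space M. \<sigma> \<gamma> (\<sigma> \<gamma>' x) = \<sigma> (\<gamma> + \<gamma>') x) \<and>
     (\<forall>x\<in>space M. \<sigma> 0 x = x)"

text \<open>
  The identity \<open>d\<mu>(\<sigma>\<^sub>\<gamma>(x)) = J(\<gamma>, x) d\<mu>(x)\<close>, in integrated form.  The images \<open>\<sigma> \<gamma> ` E\<close> are measurable,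
  as each \<open>\<sigma> \<gamma>\<close> is a bijection of \<open>space M\<close> with measurable inverse \<open>\<sigma> (- \<gamma>)\<close>.
\<close>

definition is_jacobian ::
    "'a measure \<Rightarrow> ('g::{ab_group_add, countable} \<Rightarrow> 'a \<Rightarrow> 'a) \<Rightarrow> ('g \<Rightarrow> 'a \<Rightarrow> real) \<Rightarrow> bool" where
  "is_jacobian M \<sigma> J \<longleftrightarrow>
     (\<lambda>(\<gamma>, x). J \<gamma> x) \<in> borel_measurable (count_space UNIV \<Otimes>\<^sub>M M) \<and>
     (\<forall>\<gamma>. \<forall>x\<in>space M. 0 < J \<gamma> x) \<and>
     (\<forall>\<gamma>. \<forall>E\<in>sets M. emeasure M (\<sigma> \<gamma> ` E) = (\<integral>\<^sup>+x\<in>E. ennreal (J \<gamma> x) \<partial>M))"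

text \<open>
  The Jacobian is an explicit argument because the representation \<open>l2_rep\<close> is written in terms
  of it; it is determined by the action up to null sets.
\<close>

definition quasi_invariant_action ::
    "'a measure \<Rightarrow> ('g::{ab_group_add, countable} \<Rightarrow> 'a \<Rightarrow> 'a) \<Rightarrow> ('g \<Rightarrow> 'a \<Rightarrow> real) \<Rightarrow> bool" where
  "quasi_invariant_action M \<sigma> J \<longleftrightarrow> measurable_action M \<sigma> \<and> is_jacobian M \<sigma> J"

definition tiling_property ::
    "'a measure \<Rightarrow> ('g::{ab_group_add, countable} \<Rightarrow> 'a \<Rightarrow> 'a) \<Rightarrow> bool" where
  "tiling_property M \<sigma> \<longleftrightarrow>
     (\<exists>C\<in>sets M.
        emeasure M (space M - (\<Union>\<gamma>. \<sigma> \<gamma> ` C)) = 0 \<and>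
        (\<forall>\<gamma> \<gamma>'. \<gamma> \<noteq> \<gamma>' \<longrightarrow> emeasure M (\<sigma> \<gamma> ` C \<inter> \<sigma> \<gamma>' ` C) = 0))"

definition l2_rep ::
    "('g::{ab_group_add, countable} \<Rightarrow> 'a \<Rightarrow> 'a) \<Rightarrow> ('g \<Rightarrow> 'a \<Rightarrow> real) \<Rightarrow> 'g
      \<Rightarrow> ('a \<Rightarrow> complex) \<Rightarrow> ('a \<Rightarrow> complex)" where
  "l2_rep \<sigma> J \<gamma> f = (\<lambda>x. complex_of_real (sqrt (J (- \<gamma>) x)) * f (\<sigma> (- \<gamma>) x))"

definition invariant_subspace ::
    "'a measure \<Rightarrow> ('g::{ab_group_add, countable} \<Rightarrow> 'a \<Rightarrow> 'a) \<Rightarrow> ('g \<Rightarrow> 'a \<Rightarrow> real)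
      \<Rightarrow> ('a \<Rightarrow> complex) set \<Rightarrow> bool" where
  "invariant_subspace M \<sigma> J V \<longleftrightarrow>
     closed_l2_subspace M V \<and> (\<forall>\<gamma>. \<forall>f\<in>V. l2_rep \<sigma> J \<gamma> f \<in> V)"

definition generated_space ::
    "'a measure \<Rightarrow> ('g::{ab_group_add, countable} \<Rightarrow> 'a \<Rightarrow> 'a) \<Rightarrow> ('g \<Rightarrow> 'a \<Rightarrow> real)
      \<Rightarrow> ('a \<Rightarrow> complex) set \<Rightarrow> ('a \<Rightarrow> complex) set" where
  "generated_space M \<sigma> J A = l2_closure M (cspan_fun {l2_rep \<sigma> J \<gamma> \<phi> | \<gamma> \<phi>. \<phi> \<in> A})"

definition finitely_generated ::
    "'a measure \<Rightarrow> ('g::{ab_group_add, countable} \<Rightarrow> 'a \<Rightarrow> 'a) \<Rightarrow> ('g \<Rightarrow> 'a \<Rightarrow> real)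
      \<Rightarrow> ('a \<Rightarrow> complex) set \<Rightarrow> bool" where
  "finitely_generated M \<sigma> J V \<longleftrightarrow>
     (\<exists>A. finite A \<and> A \<subseteq> L2 M \<and> V = generated_space M \<sigma> J A)"

text \<open>Meaningful only for finitely generated \<open>V\<close>.\<close>

definition space_length ::
    "'a measure \<Rightarrow> ('g::{ab_group_add, countable} \<Rightarrow> 'a \<Rightarrow> 'a) \<Rightarrow> ('g \<Rightarrow> 'a \<Rightarrow> real)
      \<Rightarrow> ('a \<Rightarrow> complex) set \<Rightarrow> nat" where
  "space_length M \<sigma> J V =
     (LEAST n. \<exists>A. finite A \<and> card A = n \<and> A \<subseteq> L2 M \<and> V = generated_space M \<sigma> J A)"

definition length_class ::
    "'a measure \<Rightarrow> ('g::{ab_group_add, countable} \<Rightarrow> 'a \<Rightarrow> 'a) \<Rightarrow> ('g \<Rightarrow> 'a \<Rightarrow> real)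
      \<Rightarrow> nat \<Rightarrow> ('a \<Rightarrow> complex) set set" where
  "length_class M \<sigma> J l =
     {V. invariant_subspace M \<sigma> J V \<and> finitely_generated M \<sigma> J V \<and> space_length M \<sigma> J V \<le> l}"

end

theory Submission imports Defs "HOL-Probability.Probability" "HOL-Library.Real_Mod" begin

text \<open>
  The Zak transform along the tile turns \<open>L\<^sup>2(X)\<close> into functions \<open>F(w, x)\<close>, where \<open>w\<close> runs over a
  probability space carrying an orthonormal family of characters of the group (a model of the dual
  group with its Haar measure), and it turns \<open>\<Pi>\<^sub>\<gamma>\<close> into multiplication by the character \<open>\<gamma>\<close> at \<open>w\<close>.
  A closed invariant subspace is then stable under multiplication by every bounded function of \<open>w\<close>,
  so the problem decouples over the fibres \<open>w\<close>: approximate the vectors \<open>\<psi>\<^sub>j(w, \<cdot>)\<close> from a space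
  spanned by \<open>l\<close> vectors.  In a fibre nothing is lost by restricting to vectors of the form
  \<open>\<Sum>\<^sub>i c\<^sub>i\<^sub>j \<Sum>\<^sub>k a\<^sub>i\<^sub>k \<psi>\<^sub>k\<close> with all coefficients in the unit disc.  The error is continuous on this
  compact set of coefficients, hence has a minimiser, which can be chosen measurably in \<open>w\<close>;
  the functions \<open>\<Sum>\<^sub>k a\<^sub>i\<^sub>k \<psi>\<^sub>k\<close> generate the optimal space.
\<close>

section \<open>Square-integrable functions\<close>

text \<open>In a single fibre the best rank-\<open>l\<close> approximation is given by eigenvectors
  of a Gramian, but these would have to be selected measurably; minimising over a compact set of
  coefficients takes their place. Compactness comes from the compression step: a competitor has
  fibre coefficients that may be unbounded and carry no measurability, and deflation replaces them,
  one fibre at a time and without raising the error, by coefficients in the unit disc applied to the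
  data. The minimiser is merely a bounded measurable function of \<open>w\<close>, whereas
  invariance provides multiplication by characters only. A monotone-class argument bridges this gap.
  It requires the characters to generate the sigma-algebra of \<open>P\<close>, which is why
  \<open>exists_haar_characters\<close> cuts the product sigma-algebra down. Of the dual group, only
  multiplicativity, mean zero of the nontrivial characters and this generation property matter.
  Independent coordinates, one for each step of an enumeration of the group, supply them.\<close>

lemma norm_add_sq_le: "(norm (a + b :: 'b::real_normed_vector))\<^sup>2 \<le> 2 * (norm a)\<^sup>2 + 2 * (norm b)\<^sup>2"
proof -
  have "(norm (a + b))\<^sup>2 \<le> (norm a + norm b)\<^sup>2"
    by (intro power_mono norm_triangle_ineq norm_ge_zero)
  also have "\<dots> \<le> 2 * (norm a)\<^sup>2 + 2 * (norm b)\<^sup>2"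
    using sum_squares_bound[of "norm a" "norm b"] by (simp add: power2_sum)
  finally show ?thesis .
qed

lemma borel_measurable_cnj [measurable (raw)]:
  "f \<in> borel_measurable M \<Longrightarrow> (\<lambda>x. cnj (f x)) \<in> borel_measurable M"
  by (rule measurable_compose[OF _ borel_measurable_continuous_onI]) (auto intro: continuous_intros)

abbreviation l2_dist :: "'a measure \<Rightarrow> ('a \<Rightarrow> complex) \<Rightarrow> ('a \<Rightarrow> complex) \<Rightarrow> real" where
  "l2_dist M f g \<equiv> l2_norm M (\<lambda>x. f x - g x)"

abbreviation nn_sq :: "'a measure \<Rightarrow> ('a \<Rightarrow> complex) \<Rightarrow> ennreal" where
  "nn_sq M f \<equiv> \<integral>\<^sup>+x. ennreal ((cmod (f x))\<^sup>2) \<partial>M"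

lemma L2_measurable: "f \<in> L2 M \<Longrightarrow> f \<in> borel_measurable M"
  by (simp add: L2_def)

lemma L2_integrable: "f \<in> L2 M \<Longrightarrow> integrable M (\<lambda>x. (cmod (f x))\<^sup>2)"
  by (simp add: L2_def)

lemma l2_norm_nonneg [simp]: "0 \<le> l2_norm M f"
  by (simp add: l2_norm_def)

lemma l2_norm_sq: "(l2_norm M f)\<^sup>2 = (LINT x|M. (cmod (f x))\<^sup>2)"
  by (simp add: l2_norm_def)

lemma l2_norm_nn:
  assumes "f \<in> L2 M"
  shows "ennreal ((l2_norm M f)\<^sup>2) = nn_sq M f"
  unfolding l2_norm_sq using L2_integrable[OF assms] by (subst nn_integral_eq_integral) auto

lemma L2_nnI:
  assumes [measurable]: "f \<in> borel_measurable M"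
    and "nn_sq M f < \<infinity>"
  shows "f \<in> L2 M"
  using assms by (simp add: L2_def integrable_iff_bounded)

lemma L2_bound:
  assumes g: "g \<in> L2 M" and [measurable]: "f \<in> borel_measurable M"
    and "AE x in M. cmod (f x) \<le> B * cmod (g x)"
  shows "f \<in> L2 M"
proof -
  have "integrable M (\<lambda>x. B\<^sup>2 * (cmod (g x))\<^sup>2)"
    using L2_integrable[OF g] by simp
  then have "integrable M (\<lambda>x. (cmod (f x))\<^sup>2)"
  proof (rule Bochner_Integration.integrable_bound)
    show "AE x in M. norm ((cmod (f x))\<^sup>2) \<le> norm (B\<^sup>2 * (cmod (g x))\<^sup>2)"
      using assms(3)
    proof eventually_elim
      case (elim x)
      then have "(cmod (f x))\<^sup>2 \<le> (B * cmod (g x))\<^sup>2" by (intro power_mono) auto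
      then show ?case by (simp add: power_mult_distrib)
    qed
  qed simp
  then show ?thesis by (simp add: L2_def)
qed

lemma L2_zero [simp]: "(\<lambda>x. 0) \<in> L2 M"
  by (simp add: L2_def)

lemma L2_scale: "f \<in> L2 M \<Longrightarrow> (\<lambda>x. c * f x) \<in> L2 M"
  by (rule L2_bound[where B = "cmod c" and g = f]) (auto simp: norm_mult L2_def)

lemma L2_add:
  assumes "f \<in> L2 M" "g \<in> L2 M"
  shows "(\<lambda>x. f x + g x) \<in> L2 M"
proof -
  note [measurable] = assms[THEN L2_measurable]
  have "integrable M (\<lambda>x. 2 * (cmod (f x))\<^sup>2 + 2 * (cmod (g x))\<^sup>2)"
    using assms[THEN L2_integrable] by simp
  then have "integrable M (\<lambda>x. (cmod (f x + g x))\<^sup>2)"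
    by (rule Bochner_Integration.integrable_bound) (auto simp: norm_add_sq_le)
  then show ?thesis by (simp add: L2_def)
qed

lemma L2_diff:
  assumes "f \<in> L2 M" "g \<in> L2 M"
  shows "(\<lambda>x. f x - g x) \<in> L2 M"
  using L2_add[OF assms(1) L2_scale[OF assms(2), of "-1"]] by simp

lemma L2_sum: "(\<And>i. i \<in> I \<Longrightarrow> f i \<in> L2 M) \<Longrightarrow> (\<lambda>x. \<Sum>i\<in>I. f i x) \<in> L2 M"
  by (induction I rule: infinite_finite_induct) (auto intro: L2_add)

lemma L2_inner_integrable:
  assumes "f \<in> L2 M" "g \<in> L2 M"
  shows "integrable M (\<lambda>x. f x * cnj (g x))"
proof -
  note [measurable] = assms[THEN L2_measurable]
  have "integrable M (\<lambda>x. (cmod (f x))\<^sup>2 + (cmod (g x))\<^sup>2)"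
    using assms by (auto dest: L2_integrable)
  then show ?thesis
  proof (rule Bochner_Integration.integrable_bound)
    show "AE x in M. norm (f x * cnj (g x)) \<le> norm ((cmod (f x))\<^sup>2 + (cmod (g x))\<^sup>2)"
    proof (rule AE_I2)
      fix x
      show "norm (f x * cnj (g x)) \<le> norm ((cmod (f x))\<^sup>2 + (cmod (g x))\<^sup>2)"
        using sum_squares_bound[of "cmod (f x)" "cmod (g x)"]
          mult_nonneg_nonneg[of "cmod (f x)" "cmod (g x)"]
        unfolding norm_mult complex_mod_cnj real_norm_def by linarith
    qed
  qed simp
qed

lemma l2_norm_cong_AE:
  assumes "AE x in M. f x = g x" "f \<in> borel_measurable M" "g \<in> borel_measurable M"
  shows "l2_norm M f = l2_norm M g"
proof -
  note [measurable] = assms(2,3)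
  have "(LINT x|M. (cmod (f x))\<^sup>2) = (LINT x|M. (cmod (g x))\<^sup>2)"
    by (rule integral_cong_AE) (use assms(1) in auto)
  then show ?thesis by (simp add: l2_norm_def)
qed

lemma l2_norm_eq_0_iff:
  assumes "f \<in> L2 M"
  shows "l2_norm M f = 0 \<longleftrightarrow> (AE x in M. f x = 0)"
  unfolding l2_norm_def
  using integral_nonneg_eq_0_iff_AE[OF L2_integrable[OF assms]] by simp

lemma l2_norm_zero [simp]: "l2_norm M (\<lambda>x. 0) = 0"
  by (simp add: l2_norm_def)

lemma l2_norm_scale: "l2_norm M (\<lambda>x. c * f x) = cmod c * l2_norm M f"
  by (simp add: l2_norm_def norm_mult power_mult_distrib real_sqrt_mult)

lemma l2_norm_minus_commute: "l2_dist M f g = l2_dist M g f"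
  by (simp add: l2_norm_def norm_minus_commute)

text \<open>With a and b the two norms, the weighted bound 2|f||g| \<le> (b/a)|f|^2 + (a/b)|g|^2
  integrates to exactly (a + b)^2, which replaces Cauchy-Schwarz. The weights need both norms to be
  nonzero, hence the case split.\<close>

lemma l2_norm_add_le:
  assumes f: "f \<in> L2 M" and g: "g \<in> L2 M"
  shows "l2_norm M (\<lambda>x. f x + g x) \<le> l2_norm M f + l2_norm M g"
proof (cases "l2_norm M f = 0 \<or> l2_norm M g = 0")
  case True
  note [measurable] = L2_measurable[OF f] L2_measurable[OF g]
  from True show ?thesis
  proof
    assume z: "l2_norm M f = 0"
    then have "AE x in M. f x = 0" using l2_norm_eq_0_iff[OF f] by simp
    then have "AE x in M. f x + g x = g x" by eventually_elim simp
    then have "l2_norm M (\<lambda>x. f x + g x) = l2_norm M g"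
      by (rule l2_norm_cong_AE) auto
    then show ?thesis using z by simp
  next
    assume z: "l2_norm M g = 0"
    then have "AE x in M. g x = 0" using l2_norm_eq_0_iff[OF g] by simp
    then have "AE x in M. f x + g x = f x" by eventually_elim simp
    then have "l2_norm M (\<lambda>x. f x + g x) = l2_norm M f"
      by (rule l2_norm_cong_AE) auto
    then show ?thesis using z by simp
  qed
next
  case False
  define a b where "a = l2_norm M f" and "b = l2_norm M g"
  have a: "a > 0" and b: "b > 0" using False by (auto simp: a_def b_def less_le)
  have pt: "(cmod (f x + g x))\<^sup>2 \<le> (1 + b / a) * (cmod (f x))\<^sup>2 + (1 + a / b) * (cmod (g x))\<^sup>2" for x
  proof -
    have "(cmod (f x + g x))\<^sup>2 \<le> (cmod (f x) + cmod (g x))\<^sup>2"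
      by (intro power_mono norm_triangle_ineq norm_ge_zero)
    also have "\<dots> \<le> (1 + b / a) * (cmod (f x))\<^sup>2 + (1 + a / b) * (cmod (g x))\<^sup>2"
    proof -
      have "0 \<le> (b * cmod (f x) - a * cmod (g x))\<^sup>2 / (a * b)" using a b by simp
      also have "\<dots> = (b / a) * (cmod (f x))\<^sup>2 + (a / b) * (cmod (g x))\<^sup>2 - 2 * cmod (f x) * cmod (g x)"
        using a b by (simp add: field_simps power2_eq_square)
      finally show ?thesis by (simp add: power2_sum algebra_simps)
    qed
    finally show ?thesis .
  qed
  have "(l2_norm M (\<lambda>x. f x + g x))\<^sup>2
      \<le> (LINT x|M. (1 + b / a) * (cmod (f x))\<^sup>2 + (1 + a / b) * (cmod (g x))\<^sup>2)"
    unfolding l2_norm_sq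
    by (intro integral_mono pt) (use L2_integrable[OF f] L2_integrable[OF g] L2_integrable[OF L2_add[OF f g]] in simp_all)
  also have "\<dots> = (1 + b / a) * a\<^sup>2 + (1 + a / b) * b\<^sup>2"
    using L2_integrable[OF f] L2_integrable[OF g] unfolding a_def b_def l2_norm_sq
    by (subst Bochner_Integration.integral_add) simp_all
  also have "\<dots> = (a + b)\<^sup>2" using a b by (simp add: field_simps power2_eq_square)
  finally have "(l2_norm M (\<lambda>x. f x + g x))\<^sup>2 \<le> (a + b)\<^sup>2" .
  then show ?thesis unfolding a_def[symmetric] b_def[symmetric]
    by (rule power2_le_imp_le) (use a b in simp)
qed

lemma l2_norm_triangle:
  assumes "f \<in> L2 M" "g \<in> L2 M" "h \<in> L2 M"
  shows "l2_dist M f h \<le> l2_dist M f g + l2_dist M g h"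
  using l2_norm_add_le[OF L2_diff[OF assms(1,2)] L2_diff[OF assms(2,3)]] by simp

lemma l2_norm_diff_abs:
  assumes "f \<in> L2 M" "g \<in> L2 M"
  shows "\<bar>l2_norm M f - l2_norm M g\<bar> \<le> l2_dist M f g"
  using l2_norm_add_le[OF L2_diff[OF assms] assms(2)]
    l2_norm_add_le[OF L2_diff[OF assms(2,1)] assms(1)]
    l2_norm_minus_commute[of M f g] by simp

text \<open>Riesz--Fischer: along a subsequence the squared increments decay like \<open>8\<^sup>-\<^sup>k\<close>, so the
  pointwise limit exists almost everywhere, and Fatou turns it into a norm limit.\<close>

lemma L2_complete:
  assumes f: "\<And>n. f n \<in> L2 M"
    and C: "\<And>e. e > 0 \<Longrightarrow> \<exists>N. \<forall>m\<ge>N. \<forall>n\<ge>N. l2_dist M (f m) (f n) < e"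
  shows "\<exists>g\<in>L2 M. (\<lambda>n. l2_dist M (f n) g) \<longlonglongrightarrow> 0"
proof -
  have fm [measurable]: "\<And>n. f n \<in> borel_measurable M"
    using f by (auto simp: L2_def)
  have "\<forall>k. \<exists>N. \<forall>m\<ge>N. \<forall>n\<ge>N. l2_dist M (f m) (f n) < sqrt ((1/8)^k)"
    using C by simp
  then obtain N where N: "\<And>k m n. m \<ge> N k \<Longrightarrow> n \<ge> N k \<Longrightarrow> l2_dist M (f m) (f n) < sqrt ((1/8)^k)"
    by metis
  \<comment> \<open>Summing the earlier \<open>N i\<close> makes \<open>r\<close> monotone while
    keeping \<open>r k\<close> above \<open>N k\<close>; the extra \<open>k\<close> makes it
    unbounded.\<close>
  define r where "r k = (\<Sum>i\<le>k. N i) + k" for k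
  have rN: "r k \<ge> N k" for k
    unfolding r_def by (simp add: member_le_sum trans_le_add1)
  have rs: "r k \<le> r (Suc k)" for k by (simp add: r_def)
  have rk: "r k \<ge> k" for k by (simp add: r_def)
  define d where "d k x = f (r (Suc k)) x - f (r k) x" for k x
  have dm [measurable]: "d k \<in> borel_measurable M" for k unfolding d_def by simp
  have dL: "d k \<in> L2 M" for k unfolding d_def by (intro L2_diff f)
  have dn: "(l2_norm M (d k))\<^sup>2 \<le> (1/8)^k" for k
  proof -
    have "l2_norm M (d k) < sqrt ((1/8)^k)"
      unfolding d_def using N[of k "r (Suc k)" "r k"] rN[of k] rs[of k] by simp
    then have "(l2_norm M (d k))\<^sup>2 \<le> (sqrt ((1/8)^k))\<^sup>2"
      by (intro power_mono) auto
    then show ?thesis by simp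
  qed
  \<comment> \<open>The weight \<open>4^k\<close> against \<open>(1/8)^k\<close> leaves the summable
    \<open>(1/2)^k\<close>. Where the weighted sum is finite, each increment is at most a constant
    times \<open>(1/2)^k\<close>, so the telescoping series converges.\<close>
  have "(\<integral>\<^sup>+x. (\<Sum>k. ennreal (4^k * (cmod (d k x))\<^sup>2)) \<partial>M) = (\<Sum>k. \<integral>\<^sup>+x. ennreal (4^k * (cmod (d k x))\<^sup>2) \<partial>M)"
    by (rule nn_integral_suminf) simp
  also have "\<dots> = (\<Sum>k. ennreal (4^k * (l2_norm M (d k))\<^sup>2))"
    by (intro suminf_cong) (simp add: ennreal_mult' nn_integral_cmult l2_norm_nn[OF dL])
  also have "\<dots> \<le> (\<Sum>k. ennreal ((1/2)^k))"
  proof (intro suminf_le ennreal_leI)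
    fix k
    have "4^k * (l2_norm M (d k))\<^sup>2 \<le> 4^k * (1/8)^k" by (intro mult_left_mono dn) simp
    also have "\<dots> = (1/2::real)^k" by (simp flip: power_mult_distrib)
    finally show "4^k * (l2_norm M (d k))\<^sup>2 \<le> (1/2)^k" .
  qed auto
  also have "\<dots> = ennreal (\<Sum>k. (1/2)^k)"
    by (rule suminf_ennreal2) (auto intro: summable_geometric)
  also have "\<dots> < \<infinity>" by simp
  finally have "AE x in M. (\<Sum>k. ennreal (4^k * (cmod (d k x))\<^sup>2)) \<noteq> \<infinity>"
    by (intro nn_integral_noteq_infinite) auto
  then have "AE x in M. convergent (\<lambda>k. f (r k) x)"
  proof eventually_elim
    case (elim x)
    define S where "S = (\<Sum>k. ennreal (4^k * (cmod (d k x))\<^sup>2))"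
    obtain B where B: "S = ennreal B" "B \<ge> 0" using elim unfolding S_def by (cases S) (auto simp: S_def)
    have "4^k * (cmod (d k x))\<^sup>2 \<le> B" for k
    proof -
      have "ennreal (4^k * (cmod (d k x))\<^sup>2) = (\<Sum>i\<in>{k}. ennreal (4^i * (cmod (d i x))\<^sup>2))" by simp
      also have "\<dots> \<le> S"
        unfolding S_def by (rule sum_le_suminf) auto
      finally show ?thesis using B by simp
    qed
    then have sq: "(2^k * cmod (d k x))\<^sup>2 \<le> (sqrt B)\<^sup>2" for k
    proof -
      have "(4::real)^k = (2^k)\<^sup>2" by (simp add: power2_eq_square flip: power_mult_distrib)
      then show ?thesis using B(2) \<open>\<And>k. 4^k * (cmod (d k x))\<^sup>2 \<le> B\<close>[of k] by (simp add: power_mult_distrib)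
    qed
    have "2^k * cmod (d k x) \<le> sqrt B" for k
      using B(2) by (intro power2_le_imp_le[OF sq]) simp
    then have bd: "norm (d k x) \<le> sqrt B * (1/2)^k" for k
      by (simp add: field_simps power_divide)
    have "summable (\<lambda>k. d k x)"
      by (rule summable_comparison_test'[OF _ bd]) (auto intro: summable_mult summable_geometric)
    then have "convergent (\<lambda>n. \<Sum>k<n. d k x)" by (simp add: summable_iff_convergent)
    then obtain L where "(\<lambda>n. \<Sum>k<n. d k x) \<longlonglongrightarrow> L" by (auto simp: convergent_def)
    moreover have "(\<Sum>k<n. d k x) = f (r n) x - f (r 0) x" for n
      unfolding d_def by (rule sum_lessThan_telescope)
    ultimately have "(\<lambda>n. f (r n) x - f (r 0) x) \<longlonglongrightarrow> L" by simp
    then have "(\<lambda>n. (f (r n) x - f (r 0) x) + f (r 0) x) \<longlonglongrightarrow> L + f (r 0) x"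
      by (intro tendsto_intros)
    then show ?case by (auto simp: convergent_def)
  qed
  then have conv: "AE x in M. (\<lambda>k. f (r k) x) \<longlonglongrightarrow> lim (\<lambda>k. f (r k) x)"
    by (simp add: convergent_LIMSEQ_iff)
  define g where "g x = lim (\<lambda>k. f (r k) x)" for x
  have gm [measurable]: "g \<in> borel_measurable M"
    unfolding g_def by (rule borel_measurable_lim_metric) simp
  have est: "nn_sq M (\<lambda>x. f n x - g x) \<le> ennreal (e\<^sup>2)"
    if e: "e > 0" and n: "\<And>m. m \<ge> n0 \<Longrightarrow> l2_dist M (f n) (f m) < e" for e n n0
  proof -
    have "nn_sq M (\<lambda>x. f n x - g x)
        = (\<integral>\<^sup>+x. liminf (\<lambda>k. ennreal ((cmod (f n x - f (r k) x))\<^sup>2)) \<partial>M)"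
    proof (rule nn_integral_cong_AE)
      show "AE x in M. ennreal ((cmod (f n x - g x))\<^sup>2) = liminf (\<lambda>k. ennreal ((cmod (f n x - f (r k) x))\<^sup>2))"
        using conv
      proof eventually_elim
        case (elim x)
        then have "(\<lambda>k. ennreal ((cmod (f n x - f (r k) x))\<^sup>2)) \<longlonglongrightarrow> ennreal ((cmod (f n x - g x))\<^sup>2)"
          unfolding g_def by (intro tendsto_intros)
        then show ?case by (rule lim_imp_Liminf[symmetric, OF sequentially_bot])
      qed
    qed
    also have "\<dots> \<le> liminf (\<lambda>k. \<integral>\<^sup>+x. ennreal ((cmod (f n x - f (r k) x))\<^sup>2) \<partial>M)"
      by (rule nn_integral_liminf) simp
    also have "\<dots> \<le> liminf (\<lambda>k::nat. ennreal (e\<^sup>2))"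
    proof (rule Liminf_mono)
      show "\<forall>\<^sub>F k in sequentially. nn_sq M (\<lambda>x. f n x - f (r k) x) \<le> ennreal (e\<^sup>2)"
      proof (rule eventually_sequentiallyI[of n0])
        fix k assume "k \<ge> n0"
        then have "r k \<ge> n0" using rk[of k] by simp
        from n[OF this] have "(l2_dist M (f n) (f (r k)))\<^sup>2 \<le> e\<^sup>2"
          using e by (intro power_mono) auto
        then show "nn_sq M (\<lambda>x. f n x - f (r k) x) \<le> ennreal (e\<^sup>2)"
          using l2_norm_nn[OF L2_diff[OF f f], of n "r k"] by (metis ennreal_leI)
      qed
    qed
    also have "\<dots> = ennreal (e\<^sup>2)" by (simp add: Liminf_const)
    finally show ?thesis .
  qed
  obtain N1 where N1: "\<And>m n. m \<ge> N1 \<Longrightarrow> n \<ge> N1 \<Longrightarrow> l2_dist M (f m) (f n) < 1"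
    using C[of 1] by auto
  have "(\<lambda>x. f N1 x - g x) \<in> L2 M"
  proof (rule L2_nnI)
    have "nn_sq M (\<lambda>x. f N1 x - g x) \<le> ennreal (1\<^sup>2)"
      by (rule est[of 1 N1 N1]) (use N1 in auto)
    then show "nn_sq M (\<lambda>x. f N1 x - g x) < \<infinity>"
      by (rule le_less_trans) simp
  qed simp
  from L2_diff[OF f[of N1] this] have g: "g \<in> L2 M" by simp
  have "(\<lambda>n. l2_dist M (f n) g) \<longlonglongrightarrow> 0"
  proof (rule LIMSEQ_I)
    fix e :: real assume e: "e > 0"
    obtain N2 where N2: "\<And>m n. m \<ge> N2 \<Longrightarrow> n \<ge> N2 \<Longrightarrow> l2_dist M (f m) (f n) < e / 2"
      using C[of "e/2"] e by auto
    have "norm (l2_dist M (f n) g - 0) < e" if "n \<ge> N2" for n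
    proof -
      have "ennreal ((l2_dist M (f n) g)\<^sup>2) \<le> ennreal ((e/2)\<^sup>2)"
        unfolding l2_norm_nn[OF L2_diff[OF f g]]
        by (rule est[of "e/2" N2]) (use that e N2 in auto)
      then have "(l2_dist M (f n) g)\<^sup>2 \<le> (e/2)\<^sup>2" by simp
      then have "l2_dist M (f n) g \<le> e / 2" by (rule power2_le_imp_le) (use e in simp)
      then show ?thesis using e by simp
    qed
    then show "\<exists>no. \<forall>n\<ge>no. norm (l2_dist M (f n) g - 0) < e" by blast
  qed
  with g show ?thesis by blast
qed

section \<open>Closed subspaces and orthogonal projection\<close>

lemma parallelogram_cmod: "(cmod (a - b))\<^sup>2 = 2 * (cmod a)\<^sup>2 + 2 * (cmod b)\<^sup>2 - 4 * (cmod ((a + b) / 2))\<^sup>2"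
  unfolding cmod_power2 by (simp add: power2_eq_square field_simps)

lemma l2_parallelogram:
  assumes f: "f \<in> L2 M" and g: "g \<in> L2 M"
  shows "(l2_dist M f g)\<^sup>2
    = 2 * (l2_norm M f)\<^sup>2 + 2 * (l2_norm M g)\<^sup>2 - 4 * (l2_norm M (\<lambda>x. (f x + g x) / 2))\<^sup>2"
proof -
  have h: "(\<lambda>x. (f x + g x) / 2) \<in> L2 M"
    using L2_scale[OF L2_add[OF f g], of "1/2"] by simp
  show ?thesis
    using L2_integrable[OF f] L2_integrable[OF g] L2_integrable[OF h]
    unfolding l2_norm_sq parallelogram_cmod by simp
qed

text \<open>Used in two ways: as the first variation of the distance when a minimiser is shown to be
  orthogonal, and with \<open>c = 1\<close> as Pythagoras.\<close>

lemma l2_norm_diff_scale_sq: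
  assumes f: "f \<in> L2 M" and g: "g \<in> L2 M"
  shows "(l2_norm M (\<lambda>x. f x - c * g x))\<^sup>2
    = (l2_norm M f)\<^sup>2 - 2 * Re (cnj c * l2_inner M f g) + (cmod c)\<^sup>2 * (l2_norm M g)\<^sup>2"
proof -
  have pt: "(cmod (a - c * b))\<^sup>2 = (cmod a)\<^sup>2 - 2 * Re (cnj c * (a * cnj b)) + (cmod c)\<^sup>2 * (cmod b)\<^sup>2" for a b
    unfolding cmod_power2 by (simp add: power2_eq_square algebra_simps)
  define r where "r x = Re (cnj c * (f x * cnj (g x)))" for x
  have "Re (cnj c * l2_inner M f g) = (LINT x|M. r x)"
    unfolding l2_inner_def r_def
    using L2_inner_integrable[OF f g] by (subst integral_Re) simp_all
  moreover have "integrable M r"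
    unfolding r_def
    using L2_inner_integrable[OF f g] by (intro integrable_Re integrable_mult_right) simp_all
  ultimately show ?thesis
    using L2_integrable[OF f] L2_integrable[OF g] unfolding l2_norm_sq pt r_def[symmetric]
    by simp
qed

lemma closed_l2_subspaceD:
  assumes "closed_l2_subspace M V"
  shows "V \<subseteq> L2 M" "(\<lambda>x. 0) \<in> V"
    "\<And>f g. f \<in> V \<Longrightarrow> g \<in> V \<Longrightarrow> (\<lambda>x. f x + g x) \<in> V"
    "\<And>c f. f \<in> V \<Longrightarrow> (\<lambda>x. c * f x) \<in> V"
    "\<And>f g. f \<in> V \<Longrightarrow> g \<in> V \<Longrightarrow> (\<lambda>x. f x - g x) \<in> V"
    "\<And>f g. (\<And>n. f n \<in> V) \<Longrightarrow> g \<in> L2 M \<Longrightarrow> (\<lambda>n. l2_dist M (f n) g) \<longlonglongrightarrow> 0 \<Longrightarrow> g \<in> V"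
proof -
  show "V \<subseteq> L2 M" "(\<lambda>x. 0) \<in> V"
    "\<And>f g. f \<in> V \<Longrightarrow> g \<in> V \<Longrightarrow> (\<lambda>x. f x + g x) \<in> V"
    "\<And>c f. f \<in> V \<Longrightarrow> (\<lambda>x. c * f x) \<in> V"
    using assms by (auto simp: closed_l2_subspace_def)
  show "(\<lambda>x. f x - g x) \<in> V" if "f \<in> V" "g \<in> V" for f g
  proof -
    have "(\<lambda>x. -1 * g x) \<in> V" using assms that by (simp only: closed_l2_subspace_def)
    then have "(\<lambda>x. f x + -1 * g x) \<in> V" using assms that by (simp only: closed_l2_subspace_def)
    then show ?thesis by simp
  qed
  show "g \<in> V" if f: "\<And>n. f n \<in> V" and g: "g \<in> L2 M"
    and l: "(\<lambda>n. l2_dist M (f n) g) \<longlonglongrightarrow> 0" for f :: "nat \<Rightarrow> 'a \<Rightarrow> complex" and g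
  proof -
    have "g \<in> l2_closure M V"
      unfolding l2_closure_def
    proof (safe intro!: g)
      fix e :: real assume "e > 0"
      with l have "\<forall>\<^sub>F n in sequentially. l2_dist M (f n) g < e"
        by (auto dest: order_tendstoD)
      then obtain n where "l2_dist M (f n) g < e"
        by (auto simp: eventually_sequentially)
      then show "\<exists>h\<in>V. l2_dist M g h < e"
        using f by (auto simp: l2_norm_minus_commute[of M g])
    qed
    then show ?thesis using assms by (auto simp: closed_l2_subspace_def)
  qed
qed

text \<open>Closedness applied to a constant sequence. It turns identities valid only almost
  everywhere, such as those for the representation, into membership.\<close>

lemma closed_l2_subspace_AE:
  assumes "closed_l2_subspace M V" "f \<in> V" "g \<in> borel_measurable M" "AE x in M. f x = g x"
  shows "g \<in> V"
proof -
  have fL: "f \<in> L2 M" using closed_l2_subspaceD(1)[OF assms(1)] assms(2) by auto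
  have g: "g \<in> L2 M"
    by (rule L2_bound[OF fL assms(3), where B = 1]) (use assms(4) in auto)
  have "l2_dist M f g = 0"
    by (subst l2_norm_eq_0_iff[OF L2_diff[OF fL g]]) (use assms(4) in auto)
  then show ?thesis
    by (intro closed_l2_subspaceD(6)[OF assms(1), of "\<lambda>_. f" g]) (use assms(2) g in auto)
qed

text \<open>Midpoints of a minimising sequence stay in V, so the parallelogram law makes the
  sequence Cauchy; its limit attains the distance, and a variation of the limit inside V gives
  orthogonality.\<close>

lemma l2_proj_exists:
  assumes V: "closed_l2_subspace M V" and f: "f \<in> L2 M"
  shows "\<exists>g\<in>V. \<forall>h\<in>V. l2_inner M (\<lambda>x. f x - g x) h = 0"
proof -
  note VD = closed_l2_subspaceD[OF V]
  have VL: "h \<in> V \<Longrightarrow> h \<in> L2 M" for h using VD(1) by auto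
  define D where "D = (\<lambda>h. (l2_dist M f h)\<^sup>2) ` V"
  define d where "d = Inf D"
  have D: "D \<noteq> {}" "bdd_below D"
    unfolding D_def using VD(2) by (auto intro!: bdd_belowI[of _ 0])
  have dle: "d \<le> (l2_dist M f h)\<^sup>2" if "h \<in> V" for h
    unfolding d_def by (rule cInf_lower) (use D that in \<open>auto simp: D_def\<close>)
  have "\<exists>h\<in>V. (l2_dist M f h)\<^sup>2 < d + 1 / real (Suc n)" for n
  proof -
    have "Inf D < d + 1 / real (Suc n)" by (simp add: d_def)
    then show ?thesis using cInf_lessD[OF D(1)] by (auto simp: D_def)
  qed
  then obtain h where hV: "\<And>n. h n \<in> V"
    and hn: "\<And>n. (l2_dist M f (h n))\<^sup>2 < d + 1 / real (Suc n)"
    by metis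
  have hh: "(l2_dist M (h m) (h n))\<^sup>2 \<le> 2 / real (Suc m) + 2 / real (Suc n)" for m n
  proof -
    have "(\<lambda>x. (1/2) * (h m x + h n x)) \<in> V" using VD(3,4) hV by blast
    then have "d \<le> (l2_norm M (\<lambda>x. f x - (1/2) * (h m x + h n x)))\<^sup>2" by (rule dle)
    also have "(\<lambda>x. f x - (1/2) * (h m x + h n x)) = (\<lambda>x. ((f x - h m x) + (f x - h n x)) / 2)"
      by (auto simp: field_simps)
    finally have "d \<le> (l2_norm M (\<lambda>x. ((f x - h m x) + (f x - h n x)) / 2))\<^sup>2" .
    moreover have "(l2_dist M (h m) (h n))\<^sup>2 = (l2_norm M (\<lambda>x. (f x - h m x) - (f x - h n x)))\<^sup>2"
      by (subst l2_norm_minus_commute) simp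
    moreover note l2_parallelogram[OF L2_diff[OF f VL[OF hV]] L2_diff[OF f VL[OF hV]], of m n]
    moreover note hn[of m] hn[of n]
    ultimately show ?thesis by simp
  qed
  have "\<exists>N. \<forall>m\<ge>N. \<forall>n\<ge>N. l2_dist M (h m) (h n) < e" if e: "e > 0" for e
  proof -
    obtain N where N: "inverse (real (Suc N)) < e\<^sup>2 / 4" using reals_Archimedean[of "e\<^sup>2/4"] e by auto
    have "l2_dist M (h m) (h n) < e" if mn: "m \<ge> N" "n \<ge> N" for m n
    proof -
      have b: "1 / real (Suc k) \<le> inverse (real (Suc N))" if "k \<ge> N" for k
        using that by (simp add: field_simps)
      have "(l2_dist M (h m) (h n))\<^sup>2 < e\<^sup>2"
        using hh[of m n] b[OF mn(1)] b[OF mn(2)] N by linarith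
      then show ?thesis using e by (simp add: power_less_imp_less_base)
    qed
    then show ?thesis by blast
  qed
  from L2_complete[OF VL[OF hV] this] obtain g where g: "g \<in> L2 M"
    and lim: "(\<lambda>n. l2_dist M (h n) g) \<longlonglongrightarrow> 0" by blast
  have gV: "g \<in> V" by (rule VD(6)[OF hV g lim])
  have gd: "(l2_dist M f g)\<^sup>2 \<le> d"
  proof (rule LIMSEQ_le)
    have "(\<lambda>n. l2_dist M f (h n)) \<longlonglongrightarrow> l2_dist M f g"
    proof (rule tendsto_iff[THEN iffD2, rule_format])
      fix e :: real assume "e > 0"
      with lim have "\<forall>\<^sub>F n in sequentially. l2_dist M (h n) g < e"
        by (auto dest: order_tendstoD)
      then show "\<forall>\<^sub>F n in sequentially. dist (l2_dist M f (h n)) (l2_dist M f g) < e"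
      proof eventually_elim
        case (elim n)
        then show ?case
          using l2_norm_diff_abs[OF L2_diff[OF f VL[OF hV]] L2_diff[OF f g], of n]
          by (simp add: dist_real_def l2_norm_minus_commute[of M g])
      qed
    qed
    then show "(\<lambda>n. (l2_dist M f (h n))\<^sup>2) \<longlonglongrightarrow> (l2_dist M f g)\<^sup>2"
      by (intro tendsto_intros)
    have "(\<lambda>n. d + 1 / real (Suc n)) \<longlonglongrightarrow> d + 0"
      using LIMSEQ_inverse_real_of_nat by (intro tendsto_intros) (simp add: inverse_eq_divide)
    then show "(\<lambda>n. d + 1 / real (Suc n)) \<longlonglongrightarrow> d" by simp
    show "\<exists>N. \<forall>n\<ge>N. (l2_dist M f (h n))\<^sup>2 \<le> d + 1 / real (Suc n)"
      using hn by (auto intro: less_imp_le)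
  qed
  have "l2_inner M (\<lambda>x. f x - g x) k = 0" if k: "k \<in> V" for k
  proof (rule ccontr)
    define z where "z = l2_inner M (\<lambda>x. f x - g x) k"
    define K where "K = (l2_norm M k)\<^sup>2"
    assume "l2_inner M (\<lambda>x. f x - g x) k \<noteq> 0"
    then have z: "(cmod z)\<^sup>2 > 0" by (simp add: z_def)
    have K: "K \<ge> 0" by (simp add: K_def)
    \<comment> \<open>With this step length \<open>t * K < 1\<close>, so the linear gain 2t|z|^2
      beats the quadratic loss t|z|^2 * tK, contradicting minimality.\<close>
    define t where "t = 1 / (K + 1)"
    have t: "t > 0" "t * K < 1" using K by (auto simp: t_def field_simps)
    have "(\<lambda>x. g x + (t * z) * k x) \<in> V" using VD(3,4) gV k by blast
    from order_trans[OF gd dle[OF this]]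
    have "(l2_dist M f g)\<^sup>2 \<le> (l2_norm M (\<lambda>x. (f x - g x) - (t * z) * k x))\<^sup>2"
      by (simp only: diff_diff_eq)
    also have "\<dots> = (l2_dist M f g)\<^sup>2 - 2 * Re (cnj (t * z) * z) + (cmod (t * z))\<^sup>2 * K"
      unfolding z_def K_def by (rule l2_norm_diff_scale_sq[OF L2_diff[OF f g] VL[OF k]])
    also have "Re (cnj (t * z) * z) = t * (cmod z)\<^sup>2"
      unfolding cmod_power2 by (simp add: power2_eq_square algebra_simps)
    also have "(cmod (t * z))\<^sup>2 * K = t * (cmod z)\<^sup>2 * (t * K)"
      using t by (simp add: norm_mult power_mult_distrib power2_eq_square)
    finally have "2 * (t * (cmod z)\<^sup>2) \<le> t * (cmod z)\<^sup>2 * (t * K)" by simp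
    moreover have "t * (cmod z)\<^sup>2 * (t * K) \<le> t * (cmod z)\<^sup>2 * 1"
      using t z by (intro mult_left_mono) auto
    moreover have "t * (cmod z)\<^sup>2 > 0" using t z by simp
    ultimately show False by linarith
  qed
  with gV show ?thesis by blast
qed

lemma l2_proj_mem:
  assumes "closed_l2_subspace M V" "f \<in> L2 M"
  shows "l2_proj M V f \<in> V"
  using someI_ex[of "\<lambda>g. g \<in> V \<and> (\<forall>h\<in>V. l2_inner M (\<lambda>x. f x - g x) h = 0)"] l2_proj_exists[OF assms]
  unfolding l2_proj_def by blast

lemma l2_proj_le:
  assumes V: "closed_l2_subspace M V" and f: "f \<in> L2 M" and h: "h \<in> V"
  shows "l2_dist M f (l2_proj M V f) \<le> l2_dist M f h"
proof -
  define g where "g = l2_proj M V f"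
  have gV: "g \<in> V" using l2_proj_mem[OF V f] by (simp add: g_def)
  note VD = closed_l2_subspaceD[OF V]
  have gL: "g \<in> L2 M" using VD(1) gV by auto
  have kV: "(\<lambda>x. h x - g x) \<in> V" using VD(5) gV h by blast
  have "l2_inner M (\<lambda>x. f x - g x) (\<lambda>x. h x - g x) = 0"
    using someI_ex[of "\<lambda>g. g \<in> V \<and> (\<forall>h\<in>V. l2_inner M (\<lambda>x. f x - g x) h = 0)"]
      l2_proj_exists[OF V f] kV
    unfolding g_def l2_proj_def by blast
  then have "(l2_norm M (\<lambda>x. (f x - g x) - 1 * (h x - g x)))\<^sup>2
      = (l2_dist M f g)\<^sup>2 + (l2_dist M h g)\<^sup>2"
    using kV VD(1) by (subst l2_norm_diff_scale_sq[OF L2_diff[OF f gL]]) auto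
  then have "(l2_dist M f g)\<^sup>2 \<le> (l2_dist M f h)\<^sup>2" by simp
  then show ?thesis unfolding g_def by (rule power2_le_imp_le) simp
qed

lemma l2_closure_superset:
  assumes "S \<subseteq> L2 M" shows "S \<subseteq> l2_closure M S"
proof
  fix f assume "f \<in> S"
  then show "f \<in> l2_closure M S"
    using assms by (auto simp: l2_closure_def intro!: bexI[of _ f])
qed

lemma closed_l2_subspace_closure:
  assumes SL: "S \<subseteq> L2 M" and z: "(\<lambda>x. 0) \<in> S"
    and add: "\<And>f g. f \<in> S \<Longrightarrow> g \<in> S \<Longrightarrow> (\<lambda>x. f x + g x) \<in> S"
    and scale: "\<And>c f. f \<in> S \<Longrightarrow> (\<lambda>x. c * f x) \<in> S"
  shows "closed_l2_subspace M (l2_closure M S)"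
  unfolding closed_l2_subspace_def
proof (intro conjI ballI allI)
  show "l2_closure M S \<subseteq> L2 M" by (auto simp: l2_closure_def)
  show "(\<lambda>x. 0) \<in> l2_closure M S" using l2_closure_superset[OF SL] z by blast
next
  fix f g assume f: "f \<in> l2_closure M S" and g: "g \<in> l2_closure M S"
  then have fg: "f \<in> L2 M" "g \<in> L2 M" by (auto simp: l2_closure_def)
  show "(\<lambda>x. f x + g x) \<in> l2_closure M S"
    unfolding l2_closure_def
  proof (safe intro!: L2_add fg)
    fix e :: real assume "e > 0"
    then obtain f' g' where f': "f' \<in> S" "l2_dist M f f' < e / 2"
      and g': "g' \<in> S" "l2_dist M g g' < e / 2"
      using f g unfolding l2_closure_def by (auto elim!: allE[of _ "e/2"])
    have "l2_norm M (\<lambda>x. (f x - f' x) + (g x - g' x)) < e"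
      using l2_norm_add_le[OF L2_diff[of f M f'] L2_diff[of g M g']] fg f' g' SL by fastforce
    then have "l2_norm M (\<lambda>x. f x + g x - (f' x + g' x)) < e" by (simp add: algebra_simps)
    then show "\<exists>h\<in>S. l2_norm M (\<lambda>x. f x + g x - h x) < e"
      using add[OF f'(1) g'(1)] by auto
  qed
next
  fix c f assume f: "f \<in> l2_closure M S"
  then have fL: "f \<in> L2 M" by (auto simp: l2_closure_def)
  show "(\<lambda>x. c * f x) \<in> l2_closure M S"
    unfolding l2_closure_def
  proof (safe intro!: L2_scale fL)
    fix e :: real assume e: "e > 0"
    then have "e / (cmod c + 1) > 0" by (simp add: add_nonneg_pos)
    then obtain f' where f': "f' \<in> S" "l2_dist M f f' < e / (cmod c + 1)"
      using f unfolding l2_closure_def by blast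
    have "l2_norm M (\<lambda>x. c * (f x - f' x)) = cmod c * l2_dist M f f'"
      by (rule l2_norm_scale)
    also have "\<dots> \<le> cmod c * (e / (cmod c + 1))" using f' by (intro mult_left_mono) auto
    also have "\<dots> < e"
    proof -
      have p: "cmod c + 1 > 0" by (simp add: add_nonneg_pos)
      show ?thesis using e pos_divide_less_eq[OF p, of "cmod c * e" e] by (simp add: algebra_simps)
    qed
    finally have "l2_norm M (\<lambda>x. c * f x - c * f' x) < e" by (simp add: algebra_simps)
    then show "\<exists>h\<in>S. l2_norm M (\<lambda>x. c * f x - h x) < e"
      using scale[OF f'(1)] by auto
  qed
next
  show "l2_closure M (l2_closure M S) \<subseteq> l2_closure M S"
  proof
    fix f assume f: "f \<in> l2_closure M (l2_closure M S)"
    then have fL: "f \<in> L2 M" by (auto simp: l2_closure_def)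
    show "f \<in> l2_closure M S"
      unfolding l2_closure_def
    proof (safe intro!: fL)
      fix e :: real assume "e > 0"
      then have e: "e / 2 > 0" by simp
      then obtain g where g: "g \<in> l2_closure M S" "l2_dist M f g < e / 2"
        using f unfolding l2_closure_def[of M "l2_closure M S"] by blast
      with e obtain h where h: "h \<in> S" "l2_dist M g h < e / 2"
        unfolding l2_closure_def by blast
      have "g \<in> L2 M" "h \<in> L2 M" using g h SL by (auto simp: l2_closure_def)
      from l2_norm_triangle[OF fL this] g h have "l2_dist M f h < e" by simp
      then show "\<exists>h\<in>S. l2_dist M f h < e" using h by blast
    qed
  qed
qed

section \<open>Finite linear spans\<close>

lemma cspan_fun_zero: "(\<lambda>x. 0) \<in> cspan_fun S"
  unfolding cspan_fun_def by (auto intro!: exI[of _ "{}"])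

lemma cspan_fun_superset: "b \<in> S \<Longrightarrow> b \<in> cspan_fun S"
  unfolding cspan_fun_def by (auto intro!: exI[of _ "{b}"] exI[of _ "\<lambda>_. 1"])

lemma cspan_fun_scale:
  assumes "f \<in> cspan_fun S" shows "(\<lambda>x. c * f x) \<in> cspan_fun S"
proof -
  obtain T a where T: "f = (\<lambda>x. \<Sum>b\<in>T. a b * b x)" "finite T" "T \<subseteq> S"
    using assms by (auto simp: cspan_fun_def)
  then have "(\<lambda>x. c * f x) = (\<lambda>x. \<Sum>b\<in>T. (c * a b) * b x)"
    by (simp add: sum_distrib_left mult.assoc)
  with T show ?thesis unfolding cspan_fun_def by (auto intro!: exI[of _ T] exI[of _ "\<lambda>b. c * a b"])
qed

lemma cspan_fun_add:
  assumes "f \<in> cspan_fun S" "g \<in> cspan_fun S"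
  shows "(\<lambda>x. f x + g x) \<in> cspan_fun S"
proof -
  obtain T a where T: "f = (\<lambda>x. \<Sum>b\<in>T. a b * b x)" "finite T" "T \<subseteq> S"
    using assms(1) by (auto simp: cspan_fun_def)
  obtain T' a' where T': "g = (\<lambda>x. \<Sum>b\<in>T'. a' b * b x)" "finite T'" "T' \<subseteq> S"
    using assms(2) by (auto simp: cspan_fun_def)
  \<comment> \<open>The supports \<open>T\<close> and \<open>T'\<close> may overlap, so both
    coefficient families are extended by 0 and added on the union.\<close>
  define c where "c b = (if b \<in> T then a b else 0) + (if b \<in> T' then a' b else 0)" for b
  have "f x + g x = (\<Sum>b\<in>T \<union> T'. c b * b x)" for x
  proof -
    have "(\<Sum>b\<in>T \<union> T'. c b * b x) = (\<Sum>b\<in>T \<union> T'. (if b \<in> T then a b * b x else 0)) + (\<Sum>b\<in>T \<union> T'. (if b \<in> T' then a' b * b x else 0))"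
      unfolding c_def sum.distrib[symmetric] by (intro sum.cong) (auto simp: algebra_simps)
    also have "(\<Sum>b\<in>T \<union> T'. (if b \<in> T then a b * b x else 0)) = (\<Sum>b\<in>T. a b * b x)"
      using T(2) T'(2) by (intro sum.mono_neutral_cong_right) auto
    also have "(\<Sum>b\<in>T \<union> T'. (if b \<in> T' then a' b * b x else 0)) = (\<Sum>b\<in>T'. a' b * b x)"
      using T(2) T'(2) by (intro sum.mono_neutral_cong_right) auto
    finally show ?thesis using T(1) T'(1) by simp
  qed
  then show ?thesis
    using T T' unfolding cspan_fun_def by (auto intro!: exI[of _ "T \<union> T'"] exI[of _ c])
qed

lemma cspan_fun_L2: "S \<subseteq> L2 M \<Longrightarrow> cspan_fun S \<subseteq> L2 M"
  unfolding cspan_fun_def by (force intro: L2_sum L2_scale)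

lemma cspan_fun_induct [consumes 1, case_names zero step]:
  assumes "f \<in> cspan_fun S"
    and "P (\<lambda>x. 0)"
    and "\<And>c b g. b \<in> S \<Longrightarrow> g \<in> cspan_fun S \<Longrightarrow> P g \<Longrightarrow> P (\<lambda>x. c * b x + g x)"
  shows "P f"
proof -
  obtain T a where T: "f = (\<lambda>x. \<Sum>b\<in>T. a b * b x)" "finite T" "T \<subseteq> S"
    using assms(1) by (auto simp: cspan_fun_def)
  from T(2,3) have "P (\<lambda>x. \<Sum>b\<in>T. a b * b x)"
  proof (induction T)
    case empty then show ?case using assms(2) by simp
  next
    case (insert b T)
    then have "(\<lambda>x. \<Sum>b\<in>T. a b * b x) \<in> cspan_fun S" by (auto simp: cspan_fun_def)
    with insert assms(3)[of b "\<lambda>x. \<Sum>b\<in>T. a b * b x" "a b"] show ?case by simp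
  qed
  with T show ?thesis by simp
qed

lemma closed_l2_subspace_cspan:
  "S \<subseteq> L2 M \<Longrightarrow> closed_l2_subspace M (l2_closure M (cspan_fun S))"
  by (intro closed_l2_subspace_closure cspan_fun_L2 cspan_fun_zero cspan_fun_add cspan_fun_scale)

section \<open>Haar-distributed random characters\<close>

text \<open>\<open>nat\<close> truncates negative integers to 0, so at most one of the two iterates
  is nontrivial.\<close>

definition zmul :: "int \<Rightarrow> 'g::ab_group_add \<Rightarrow> 'g" where
  "zmul k g = ((+) g ^^ nat k) 0 - ((+) g ^^ nat (- k)) 0"

lemma zmul_zero [simp]: "zmul 0 g = 0"
  by (simp add: zmul_def)

lemma zmul_plus_one: "zmul (k + 1) g = zmul k g + g"
proof (cases "k \<ge> 0")
  case True
  then have "nat (k + 1) = Suc (nat k)" by simp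
  then show ?thesis using True by (simp add: zmul_def)
next
  case False
  then have "nat (- k) = Suc (nat (- (k + 1)))" by simp
  then show ?thesis using False by (simp add: zmul_def)
qed

lemma zmul_minus_one: "zmul (k - 1) g = zmul k g - g"
  using zmul_plus_one[of "k - 1" g] by simp

lemma zmul_one [simp]: "zmul 1 g = g"
  using zmul_plus_one[of 0 g] by simp

lemma zmul_add: "zmul (k + l) g = zmul k g + zmul l g"
proof (induction l rule: int_induct[where k = 0])
  case (step1 i)
  then show ?case using zmul_plus_one[of "k + i" g] zmul_plus_one[of i g] by (simp add: algebra_simps)
next
  case (step2 i)
  then show ?case using zmul_minus_one[of "k + i" g] zmul_minus_one[of i g] by (simp add: add_diff_eq)
qed simp

lemma zmul_diff: "zmul (k - l) g = zmul k g - zmul l g"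
  using zmul_add[of "k - l" l g] by (simp add: algebra_simps)

lemma zmul_mult: "zmul (k * l) g = zmul k (zmul l g)"
proof (induction k rule: int_induct[where k = 0])
  case (step1 i)
  then show ?case by (simp add: distrib_right zmul_add zmul_plus_one)
next
  case (step2 i)
  then show ?case by (simp add: left_diff_distrib zmul_diff zmul_minus_one)
qed simp

section \<open>Extending a character from a subgroup by one element\<close>

definition add_subgroup :: "'g::ab_group_add set \<Rightarrow> bool" where
  "add_subgroup H \<longleftrightarrow> 0 \<in> H \<and> (\<forall>a\<in>H. \<forall>b\<in>H. a - b \<in> H)"

lemma add_subgroupD:
  assumes "add_subgroup H"
  shows "0 \<in> H" "\<And>a b. a \<in> H \<Longrightarrow> b \<in> H \<Longrightarrow> a - b \<in> H" "\<And>a b. a \<in> H \<Longrightarrow> b \<in> H \<Longrightarrow> a + b \<in> H"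
    "\<And>a k. a \<in> H \<Longrightarrow> zmul k a \<in> H"
proof -
  show *: "0 \<in> H" "\<And>a b. a \<in> H \<Longrightarrow> b \<in> H \<Longrightarrow> a - b \<in> H"
    using assms by (auto simp: add_subgroup_def)
  show **: "a + b \<in> H" if "a \<in> H" "b \<in> H" for a b
    using *(2)[OF that(1) *(2)[OF *(1) that(2)]] by simp
  show "zmul k a \<in> H" if "a \<in> H" for a k
    by (induction k rule: int_induct[where k = 0])
      (use * ** that in \<open>auto simp: zmul_plus_one zmul_minus_one\<close>)
qed

definition character_on :: "'g::ab_group_add set \<Rightarrow> ('g \<Rightarrow> complex) \<Rightarrow> bool" where
  "character_on H X \<longleftrightarrow> (\<forall>a\<in>H. cmod (X a) = 1) \<and> (\<forall>a\<in>H. \<forall>b\<in>H. X (a + b) = X a * X b)"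

lemma character_onD:
  assumes "character_on H X"
  shows "\<And>a. a \<in> H \<Longrightarrow> cmod (X a) = 1" "\<And>a. a \<in> H \<Longrightarrow> X a \<noteq> 0"
    "\<And>a b. a \<in> H \<Longrightarrow> b \<in> H \<Longrightarrow> X (a + b) = X a * X b"
  using assms by (auto simp: character_on_def dest!: bspec)

lemma character_on_zero:
  assumes "add_subgroup H" "character_on H X" shows "X 0 = 1"
  using character_onD(2,3)[OF assms(2), of 0] add_subgroupD(1)[OF assms(1)] by (metis add_0 mult_cancel_right1)

lemma character_on_diff:
  assumes "add_subgroup H" "character_on H X" "a \<in> H" "b \<in> H" shows "X (a - b) * X b = X a"
  using character_onD(3)[OF assms(2), of "a - b" b] add_subgroupD(2)[OF assms(1)] assms by simp

lemma character_on_zmul: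
  assumes H: "add_subgroup H" and X: "character_on H X" and a: "a \<in> H"
  shows "X (zmul k a) = X a powi k"
proof (induction k rule: int_induct[where k = 0])
  case base
  then show ?case using character_on_zero[OF H X] by simp
next
  case (step1 i)
  then show ?case
    using character_onD[OF X] add_subgroupD(4)[OF H a] a
    by (simp add: zmul_plus_one power_int_add)
next
  case (step2 i)
  have "X (zmul i a - a) * X a = X (zmul i a)"
    using character_on_diff[OF H X] add_subgroupD(4)[OF H a] a by blast
  then show ?case
    using step2 character_onD(2)[OF X a]
    by (simp add: zmul_minus_one power_int_diff field_simps)
qed

text \<open>The order of \<open>g\<close> modulo \<open>H\<close>, with the value \<open>0\<close> for infinite order.\<close>

definition rel_order :: "'g::ab_group_add set \<Rightarrow> 'g \<Rightarrow> nat" where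
  "rel_order H g = (if \<exists>k>0. zmul (int k) g \<in> H then LEAST k. k > 0 \<and> zmul (int k) g \<in> H else 0)"

lemma zmul_rel_order: 
  assumes H: "add_subgroup H" shows "zmul (int (rel_order H g)) g \<in> H"
  using LeastI_ex[of "\<lambda>k. k > 0 \<and> zmul (int k) g \<in> H"] add_subgroupD(1)[OF H]
  by (auto simp: rel_order_def)

text \<open>Division with remainder by the least positive multiple in \<open>H\<close>. Coding
  infinite order by 0 fits, since \<open>0 dvd k\<close> means \<open>k = 0\<close>.\<close>

lemma zmul_mem_iff:
  assumes H: "add_subgroup H" shows "zmul k g \<in> H \<longleftrightarrow> int (rel_order H g) dvd k"
proof
  define d where "d = rel_order H g"
  note HD = add_subgroupD[OF H]
  assume "int (rel_order H g) dvd k"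
  then obtain q where "k = q * int d" by (metis dvdE mult.commute d_def)
  then show "zmul k g \<in> H"
    using HD(4)[OF zmul_rel_order[OF H]] by (simp add: zmul_mult d_def)
next
  define d where "d = rel_order H g"
  note HD = add_subgroupD[OF H]
  assume k: "zmul k g \<in> H"
  show "int (rel_order H g) dvd k"
  proof (cases "\<exists>k>0. zmul (int k) g \<in> H")
    case False
    have "k = 0"
    proof (rule ccontr)
      assume "k \<noteq> 0"
      moreover have "zmul (\<bar>k\<bar>) g \<in> H"
        using k HD(2)[OF HD(1) k] zmul_diff[of 0 k g] by (auto simp: abs_if)
      ultimately show False using False by (auto dest!: spec[of _ "nat \<bar>k\<bar>"])
    qed
    then show ?thesis by simp
  next
    case True
    then have dL: "d = (LEAST k. k > 0 \<and> zmul (int k) g \<in> H)" by (simp add: d_def rel_order_def)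
    have d: "d > 0" "zmul (int d) g \<in> H"
      using LeastI_ex[OF True] by (auto simp: dL)
    define r where "r = k mod int d"
    have r: "0 \<le> r" "r < int d" using d by (auto simp: r_def)
    have "r = k - (k div int d) * int d" by (simp add: r_def minus_div_mult_eq_mod)
    then have "zmul r g = zmul k g - zmul (k div int d) (zmul (int d) g)"
      by (simp add: zmul_diff zmul_mult)
    then have "zmul r g \<in> H" using HD k d by simp
    then have "zmul (int (nat r)) g \<in> H" using r by simp
    then have "\<not> nat r > 0"
      using not_less_Least[of "nat r" "\<lambda>k. k > 0 \<and> zmul (int k) g \<in> H"] r by (auto simp: dL)
    then have "r = 0" using r by simp
    then show ?thesis by (auto simp: r_def d_def)
  qed
qed

definition adjoin :: "'g::ab_group_add set \<Rightarrow> 'g \<Rightarrow> 'g set" where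
  "adjoin H g = {a. \<exists>k. a - zmul k g \<in> H}"

text \<open>The exponent is determined only modulo \<open>rel_order H g\<close>;
  \<open>extend_char_eq\<close> shows that the extended character does not depend on the
  choice.\<close>

definition adjoin_exp :: "'g::ab_group_add set \<Rightarrow> 'g \<Rightarrow> 'g \<Rightarrow> int" where
  "adjoin_exp H g a = (SOME k. a - zmul k g \<in> H)"

definition extend_char ::
    "'g::ab_group_add set \<Rightarrow> 'g \<Rightarrow> ('g \<Rightarrow> complex) \<Rightarrow> complex \<Rightarrow> 'g \<Rightarrow> complex" where
  "extend_char H g X v a = X (a - zmul (adjoin_exp H g a) g) * v powi (adjoin_exp H g a)"

lemma adjoin_exp: "a \<in> adjoin H g \<Longrightarrow> a - zmul (adjoin_exp H g a) g \<in> H"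
  unfolding adjoin_def adjoin_exp_def using someI_ex by fast

lemma adjoin_superset: "a \<in> H \<Longrightarrow> a \<in> adjoin H g"
  by (auto simp: adjoin_def intro!: exI[of _ 0])

lemma adjoin_mem: "add_subgroup H \<Longrightarrow> g \<in> adjoin H g"
  by (auto simp: adjoin_def add_subgroup_def intro!: exI[of _ 1])

lemma add_subgroup_adjoin:
  assumes H: "add_subgroup H" shows "add_subgroup (adjoin H g)"
  unfolding add_subgroup_def
proof (intro conjI ballI)
  show "0 \<in> adjoin H g" using adjoin_superset add_subgroupD(1)[OF H] .
  fix a b assume "a \<in> adjoin H g" "b \<in> adjoin H g"
  then obtain k l where "a - zmul k g \<in> H" "b - zmul l g \<in> H" by (auto simp: adjoin_def)
  then have "a - b - zmul (k - l) g \<in> H"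
    using add_subgroupD(2)[OF H, of "a - zmul k g" "b - zmul l g"] by (simp add: zmul_diff algebra_simps)
  then show "a - b \<in> adjoin H g" by (auto simp: adjoin_def)
qed

context
  fixes H :: "'g::ab_group_add set" and g X v
  assumes H: "add_subgroup H" and X: "character_on H X"
    and v1: "cmod v = 1" and vd: "v ^ rel_order H g = X (zmul (int (rel_order H g)) g)"
begin

text \<open>Two admissible exponents differ by a multiple of the relative order d, and the condition
  that v^d equals X at d times g makes both give the same value. For infinite order the condition
  reads 1 = X 0, so every v on the unit circle is admissible.\<close>

lemma extend_char_eq:
  assumes k: "a - zmul k g \<in> H"
  shows "extend_char H g X v a = X (a - zmul k g) * v powi k"
proof -
  define l where "l = adjoin_exp H g a"
  define d where "d = rel_order H g"
  have v0: "v \<noteq> 0" using v1 by auto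
  have l: "a - zmul l g \<in> H" unfolding l_def using k by (intro adjoin_exp) (auto simp: adjoin_def)
  have kl: "zmul (k - l) g \<in> H"
    using add_subgroupD(2)[OF H l k] by (simp add: zmul_diff)
  then obtain q where q: "k - l = q * int d"
    using zmul_mem_iff[OF H] by (metis dvdE mult.commute d_def)
  have "X (zmul (k - l) g) = v powi (k - l)"
    unfolding q zmul_mult d_def
    by (subst character_on_zmul[OF H X zmul_rel_order[OF H]])
      (simp add: vd[symmetric] power_int_mult mult.commute[of q] power_int_of_nat)
  moreover have "X (a - zmul l g) = X (a - zmul k g) * X (zmul (k - l) g)"
    using character_onD(3)[OF X k kl] by (simp add: zmul_diff)
  ultimately show ?thesis
    using v0 by (simp add: extend_char_def l_def[symmetric] power_int_diff)
qed

lemma extend_char_agrees: "a \<in> H \<Longrightarrow> extend_char H g X v a = X a"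
  using extend_char_eq[of a 0] by simp

lemma character_on_extend_char: "character_on (adjoin H g) (extend_char H g X v)"
  unfolding character_on_def
proof (intro conjI ballI)
  fix a assume a: "a \<in> adjoin H g"
  show "cmod (extend_char H g X v a) = 1"
    using adjoin_exp[OF a] character_onD(1)[OF X] v1
    by (simp add: extend_char_def norm_mult norm_power_int)
  fix b assume b: "b \<in> adjoin H g"
  obtain k l where k: "a - zmul k g \<in> H" and l: "b - zmul l g \<in> H" using a b by (auto simp: adjoin_def)
  have e: "a + b - zmul (k + l) g = (a - zmul k g) + (b - zmul l g)" by (simp add: zmul_add)
  have "v \<noteq> 0" using v1 by auto
  moreover have "a + b - zmul (k + l) g \<in> H" unfolding e using add_subgroupD(3)[OF H k l] .
  ultimately show "extend_char H g X v (a + b) = extend_char H g X v a * extend_char H g X v b"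
    using character_onD(3)[OF X k l]
    by (simp add: extend_char_eq[OF k] extend_char_eq[OF l] extend_char_eq[of "a + b" "k + l"] e power_int_add)
qed

end

section \<open>Measurable roots and uniformly distributed roots of unity\<close>

lemma measurable_cis [measurable (raw)]:
  "f \<in> borel_measurable M \<Longrightarrow> (\<lambda>x. cis (f x)) \<in> borel_measurable M"
  by (rule measurable_compose[OF _ borel_measurable_continuous_onI]) (auto intro: continuous_intros)

lemma cis_div_power: "d > 0 \<Longrightarrow> cis (x / real d) ^ d = cis x"
  by (subst Complex.DeMoivre) simp

text \<open>The signed arccosine of the real part is an argument of a unit complex number; dividing
  it by d gives one Borel choice of a d-th root. Clamping the real part makes the arccosine
  continuous on the whole line.\<close>

definition circle_root :: "nat \<Rightarrow> complex \<Rightarrow> complex" where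
  "circle_root d z = cis ((if Im z \<ge> 0 then 1 else -1) * arccos (max (-1) (min 1 (Re z))) / d)"

lemma circle_root_power:
  assumes "cmod z = 1" "d > 0" shows "circle_root d z ^ d = z"
proof -
  have r: "\<bar>Re z\<bar> \<le> 1" using assms(1) abs_Re_le_cmod[of z] by simp
  have n: "(Re z)\<^sup>2 + (Im z)\<^sup>2 = 1" using assms(1) by (metis cmod_power2 one_power2)
  have "circle_root d z ^ d = cis ((if Im z \<ge> 0 then 1 else -1) * arccos (Re z))"
    using r unfolding circle_root_def cis_div_power[OF assms(2)] by (simp add: abs_le_iff)
  also have "\<dots> = z"
  proof (rule complex_eqI)
    show "Re (cis ((if Im z \<ge> 0 then 1 else -1) * arccos (Re z))) = Re z"
      using r by (simp add: cos_arccos_abs)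
    have "sin (arccos (Re z)) = \<bar>Im z\<bar>"
      using r n by (subst sin_arccos) (auto simp: abs_le_iff algebra_simps intro!: real_sqrt_unique)
    then show "Im (cis ((if Im z \<ge> 0 then 1 else -1) * arccos (Re z))) = Im z"
      by auto
  qed
  finally show ?thesis .
qed

lemma measurable_circle_root [measurable]: "circle_root d \<in> borel_measurable borel"
proof -
  have "continuous_on UNIV (\<lambda>x::real. arccos (max (-1) (min 1 x)))"
    by (intro continuous_on_arccos continuous_intros) (auto simp: min_def)
  then have [measurable]: "(\<lambda>x::real. arccos (max (-1) (min 1 x))) \<in> borel_measurable borel"
    by (rule borel_measurable_continuous_onI)
  show ?thesis unfolding circle_root_def[abs_def] by measurable
qed

lemma borel_measurable_power_int [measurable (raw)]:
  fixes f :: "'a \<Rightarrow> complex"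
  shows "f \<in> borel_measurable M \<Longrightarrow> (\<lambda>x. f x powi k) \<in> borel_measurable M"
  by (cases "k \<ge> 0") (simp_all add: power_int_def)

text \<open>Rounding makes \<open>root_phase d u\<close> an exact \<open>d\<close>-th root of unity for every \<open>u\<close>, not only almost surely.\<close>

definition root_phase :: "nat \<Rightarrow> real \<Rightarrow> complex" where
  "root_phase d u = (if d = 0 then cis (2 * pi * u) else cis (2 * pi * of_int \<lfloor>u\<rfloor> / d))"

text \<open>Under this law \<open>root_phase d\<close> is Haar distributed on the circle
  (\<open>d = 0\<close>) or on the group of d-th roots of unity. Both laws live on the reals, so
  that a single product space carries all coordinates.\<close>

definition root_measure :: "nat \<Rightarrow> real measure" where
  "root_measure d = (if d = 0 then uniform_measure lborel {0..1} else measure_pmf (map_pmf real (pmf_of_set {..<d})))"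

lemma prob_space_root_measure: "prob_space (root_measure d)"
  by (auto simp: root_measure_def prob_space_measure_pmf intro!: prob_space_uniform_measure)

lemma cmod_root_phase [simp]: "cmod (root_phase d u) = 1"
  by (simp add: root_phase_def)

lemma root_phase_power: "d > 0 \<Longrightarrow> root_phase d u ^ d = 1"
  by (simp add: root_phase_def cis_div_power cis_multiple_2pi)

lemma measurable_root_phase [measurable]: "root_phase d \<in> borel_measurable (root_measure d)"
proof (cases "d = 0")
  case True
  then show ?thesis by (simp add: root_phase_def[abs_def] root_measure_def)
qed (simp add: root_measure_def)

lemma integral_cis_period:
  assumes "k \<noteq> (0::int)"
  shows "(LINT u|uniform_measure lborel {0..1}. cis (of_int k * (2 * pi * u))) = 0"
proof -
  define c where "c = of_int k * (2 * pi)"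
  have c: "c \<noteq> 0" using assms by (simp add: c_def)
  have "(LINT u|uniform_measure lborel {0..1}. cis (of_int k * (2 * pi * u)))
      = (LINT u|lborel. indicator {0..1} u *\<^sub>R cis (c * u))"
  proof -
    have u: "uniform_measure lborel {0..1::real} = density lborel (\<lambda>u. ennreal (indicator {0..1} u))"
      unfolding uniform_measure_def
      by (rule arg_cong[where f = "density lborel"]) (auto simp: fun_eq_iff indicator_def divide_ennreal_def)
    show ?thesis unfolding u c_def
      by (subst integral_density) (auto simp: mult.assoc)
  qed
  also have "\<dots> = cis (c * 1) / (\<i> * c) - cis (c * 0) / (\<i> * c)"
  proof (rule integral_FTC_Icc)
    show "continuous_on {0..1} (\<lambda>u. cis (c * u))"
      by (intro continuous_intros)
    fix x :: real
    have "((\<lambda>u. cis (c * u) / (\<i> * c)) has_vector_derivative (c *\<^sub>R (\<i> * cis (c * x))) / (\<i> * c)) (at x within {0..1})"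
      by (auto intro!: derivative_eq_intros simp: has_vector_derivative_def scaleR_conv_of_real field_simps)
    then show "((\<lambda>u. cis (c * u) / (\<i> * c)) has_vector_derivative cis (c * x)) (at x within {0..1})"
      using c by (simp add: scaleR_conv_of_real)
  qed simp
  also have "\<dots> = 0"
    using cis_multiple_2pi[of "of_int k"] by (simp add: c_def mult_ac)
  finally show ?thesis .
qed

text \<open>A nontrivial character of a compact group has mean zero. For \<open>d = 0\<close> the
  hypothesis says \<open>k \<noteq> 0\<close> and a full period is integrated; otherwise a geometric
  sum runs over the powers of a d-th root of unity other than 1.\<close>

lemma integral_root_phase:
  assumes nd: "\<not> int d dvd k"
  shows "(LINT u|root_measure d. root_phase d u powi k) = 0"
proof (cases "d = 0")
  case True
  then show ?thesis
    using nd integral_cis_period[of k] by (simp add: root_phase_def root_measure_def cis_power_int)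
next
  case False
  define q where "q = cis (2 * pi * k / d)"
  have "q ^ d = cis (2 * pi * of_int k)" using False by (simp add: q_def cis_div_power)
  then have qd: "q ^ d = 1" by (simp add: cis_multiple_2pi)
  have q1: "q \<noteq> 1"
  proof
    assume "q = 1"
    then obtain n :: int where "2 * pi * k / d = of_int n * (2 * pi)" by (auto simp: q_def cis_eq_1_iff)
    then have "real_of_int k = of_int n * real d" using False by (simp add: field_simps)
    then have "k = n * int d" by (metis of_int_eq_iff of_int_mult of_int_of_nat_eq)
    then show False using nd by simp
  qed
  have e: "root_phase d (real j) powi k = q ^ j" for j
    using False by (simp add: root_phase_def q_def cis_power_int Complex.DeMoivre mult_ac)
  have "(LINT u|root_measure d. root_phase d u powi k) = (LINT j|measure_pmf (pmf_of_set {..<d}). q ^ j)"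
    using False by (simp add: root_measure_def e)
  also have "\<dots> = (\<Sum>j<d. (1 / real d) *\<^sub>R q ^ j)"
    using False
    by (subst integral_measure_pmf[of "{..<d}"]) (auto simp: lessThan_empty_iff set_pmf_of_set pmf_of_set)
  also have "\<dots> = (1 / real d) *\<^sub>R (\<Sum>j<d. q ^ j)" by (rule scaleR_sum_right[symmetric])
  also have "(\<Sum>j<d. q ^ j) = 0" using q1 qd by (simp add: geometric_sum)
  finally show ?thesis by simp
qed

text \<open>Characters are extended successively along the subgroups generated by initial segments of the
  enumeration of the group, the freedom at step \<open>n\<close> being used up by an independent random root of
  unity of the relative order, or by an independent uniform point of the circle.\<close>

primrec gen_subgroup :: "nat \<Rightarrow> 'g::{ab_group_add, countable} set" where
  "gen_subgroup 0 = {0}"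
| "gen_subgroup (Suc n) = adjoin (gen_subgroup n) (from_nat n)"

text \<open>The \<open>itself\<close> argument fixes the group, whose type would not occur in the
  sequence of orders otherwise.\<close>

definition gen_order :: "'g::{ab_group_add, countable} itself \<Rightarrow> nat \<Rightarrow> nat" where
  "gen_order _ n = rel_order (gen_subgroup n) (from_nat n :: 'g)"

text \<open>One solution of the equation imposed on the value at the new element; multiplying it by
  a d-th root of unity reaches the others. Infinite order imposes no equation, and 1 serves as base
  point.\<close>

definition phase_step :: "nat \<Rightarrow> ('g::{ab_group_add, countable} \<Rightarrow> complex) \<Rightarrow> complex" where
  "phase_step n X = (let d = rel_order (gen_subgroup n) (from_nat n :: 'g)
     in if d = 0 then 1 else circle_root d (X (zmul (int d) (from_nat n))))"

primrec random_char_upto :: "nat \<Rightarrow> (nat \<Rightarrow> real) \<Rightarrow> 'g::{ab_group_add, countable} \<Rightarrow> complex" where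
  "random_char_upto 0 \<omega> = (\<lambda>a. 1)"
| "random_char_upto (Suc n) \<omega> =
    extend_char (gen_subgroup n) (from_nat n) (random_char_upto n \<omega>)
      (phase_step n (random_char_upto n \<omega>) * root_phase (gen_order TYPE('g) n) (\<omega> n))"

definition random_char :: "'g::{ab_group_add, countable} \<Rightarrow> (nat \<Rightarrow> real) \<Rightarrow> complex" where
  "random_char a \<omega> = random_char_upto (Suc (to_nat a)) \<omega> a"

lemma add_subgroup_gen: "add_subgroup (gen_subgroup n)"
  by (induction n) (simp_all add: add_subgroup_adjoin, simp add: add_subgroup_def)

lemma gen_subgroup_mono: "n \<le> m \<Longrightarrow> gen_subgroup n \<subseteq> gen_subgroup m"
  by (rule lift_Suc_mono_le[of gen_subgroup]) (auto intro: adjoin_superset)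

lemma mem_gen_subgroup: "a \<in> gen_subgroup (Suc (to_nat a))"
  using adjoin_mem[OF add_subgroup_gen, of a "to_nat a"] by simp

lemma phase_step_props:
  assumes X: "character_on (gen_subgroup n) (X :: 'g::{ab_group_add, countable} \<Rightarrow> complex)"
  defines "d \<equiv> rel_order (gen_subgroup n) (from_nat n :: 'g)"
  shows "cmod (phase_step n X * root_phase (gen_order TYPE('g) n) u) = 1"
    "(phase_step n X * root_phase (gen_order TYPE('g) n) u) ^ d = X (zmul (int d) (from_nat n))"
proof -
  have 1: "cmod (X (zmul (int d) (from_nat n))) = 1"
    unfolding d_def by (rule character_onD(1)[OF X zmul_rel_order[OF add_subgroup_gen]])
  show "cmod (phase_step n X * root_phase (gen_order TYPE('g) n) u) = 1"
    by (simp add: norm_mult phase_step_def Let_def circle_root_def)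
  show "(phase_step n X * root_phase (gen_order TYPE('g) n) u) ^ d = X (zmul (int d) (from_nat n))"
    using circle_root_power[OF 1] root_phase_power[of d u] character_on_zero[OF add_subgroup_gen X]
    by (cases "d = 0") (simp_all add: phase_step_def Let_def d_def[symmetric] gen_order_def power_mult_distrib)
qed

lemma character_on_random_char_upto: "character_on (gen_subgroup n) (random_char_upto n \<omega>)"
proof (induction n)
  case 0
  then show ?case by (simp add: character_on_def)
next
  case (Suc n)
  then show ?case
    using character_on_extend_char[OF add_subgroup_gen Suc phase_step_props[OF Suc]] by simp
qed

lemma random_char_upto_Suc:
  fixes a :: "'g::{ab_group_add, countable}"
  assumes "a \<in> gen_subgroup n" shows "random_char_upto (Suc n) \<omega> a = random_char_upto n \<omega> a"
  using extend_char_agrees[OF add_subgroup_gen character_on_random_char_upto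
      phase_step_props[OF character_on_random_char_upto] assms] by simp

lemma random_char_eq:
  fixes a :: "'g::{ab_group_add, countable}"
  assumes "a \<in> gen_subgroup n" shows "random_char a \<omega> = random_char_upto n \<omega> a"
proof -
  have *: "random_char_upto m \<omega> a = random_char_upto k \<omega> a" if "a \<in> gen_subgroup k" "k \<le> m" for k m
    using that(2)
  proof (induction rule: dec_induct)
    case (step i)
    then show ?case using random_char_upto_Suc[of a i \<omega>] gen_subgroup_mono[of k i] that(1) by auto
  qed simp
  show ?thesis
    using *[OF assms, of "max n (Suc (to_nat a))"] *[OF mem_gen_subgroup, of "max n (Suc (to_nat a))"]
    by (simp add: random_char_def)
qed

lemma random_char_add:
  fixes a b :: "'g::{ab_group_add, countable}"
  shows "random_char (a + b) \<omega> = random_char a \<omega> * random_char b \<omega>"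
proof -
  define n where "n = max (Suc (to_nat a)) (Suc (to_nat b))"
  have ab: "a \<in> gen_subgroup n" "b \<in> gen_subgroup n"
    using mem_gen_subgroup[of a] mem_gen_subgroup[of b] gen_subgroup_mono
    unfolding n_def by (meson max.cobounded1 max.cobounded2 subsetD)+
  have "a + b \<in> gen_subgroup n" using add_subgroupD(3)[OF add_subgroup_gen ab] .
  then show ?thesis
    using ab character_onD(3)[OF character_on_random_char_upto ab] by (simp add: random_char_eq)
qed

lemma cmod_random_char [simp]: "cmod (random_char a \<omega>) = 1"
  unfolding random_char_def
  by (rule character_onD(1)[OF character_on_random_char_upto mem_gen_subgroup])

section \<open>The law of a random character\<close>

definition char_measure :: "'g::{ab_group_add, countable} itself \<Rightarrow> (nat \<Rightarrow> real) measure" where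
  "char_measure t = PiM UNIV (\<lambda>n. root_measure (gen_order t n))"

text \<open>The index set is left general because the stage-\<open>n\<close> character must be
  measurable in its first \<open>n\<close> coordinates alone, which is what makes it independent of
  coordinate \<open>n\<close>.\<close>

lemma measurable_random_char_upto:
  assumes "{..<n} \<subseteq> I"
  shows "(\<lambda>\<omega>. random_char_upto n \<omega> (a::'g::{ab_group_add, countable}))
    \<in> borel_measurable (PiM I (\<lambda>n. root_measure (gen_order TYPE('g) n)))"
  using assms
proof (induction n arbitrary: a)
  case (Suc n)
  have "{..<n} \<subseteq> I" using Suc.prems by (auto simp: lessThan_Suc)
  note [measurable] = Suc.IH[OF this]
  have "n \<in> I" using Suc by auto
  then have "(\<lambda>\<omega>. \<omega> n) \<in> measurable (PiM I (\<lambda>n. root_measure (gen_order TYPE('g) n))) (root_measure (gen_order TYPE('g) n))"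
    by (rule measurable_component_singleton)
  then have [measurable]: "(\<lambda>\<omega>. root_phase (gen_order TYPE('g) n) (\<omega> n))
      \<in> borel_measurable (PiM I (\<lambda>n. root_measure (gen_order TYPE('g) n)))"
    by (rule measurable_compose) (rule measurable_root_phase)
  show ?case
    unfolding random_char_upto.simps extend_char_def phase_step_def Let_def
    by (cases "rel_order (gen_subgroup n) (from_nat n :: 'g) = 0") simp_all
qed simp

lemma random_char_upto_restrict:
  assumes "{..<n} \<subseteq> I" shows "random_char_upto n (restrict \<omega> I) = random_char_upto n \<omega>"
  using assms by (induction n) (auto simp: lessThan_Suc)

lemma measurable_random_char:
  "random_char (a::'g::{ab_group_add, countable}) \<in> borel_measurable (char_measure TYPE('g))"
  unfolding random_char_def[abs_def] char_measure_def by (rule measurable_random_char_upto) simp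

lemma prob_space_char_measure: "prob_space (char_measure t)"
  unfolding char_measure_def by (intro prob_space_PiM prob_space_root_measure)

text \<open>At the first stage that contains \<open>a\<close>, the value at \<open>a\<close> splits
  into a factor depending on earlier coordinates and a power of the newest root of unity.
  Independence factorises the integral, and the second factor has mean zero.\<close>

lemma integral_random_char:
  fixes a :: "'g::{ab_group_add, countable}"
  assumes a: "a \<noteq> 0"
  shows "(LINT \<omega>|char_measure TYPE('g). random_char a \<omega>) = 0"
proof -
  define R where "R n = root_measure (gen_order TYPE('g) n)" for n
  define P where "P = char_measure TYPE('g)"
  have PR: "P = PiM UNIV R" by (simp add: P_def R_def[abs_def] char_measure_def)
  interpret prob_space P unfolding P_def by (rule prob_space_char_measure)
  define n where "n = (LEAST n. a \<in> gen_subgroup n)"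
  have an: "a \<in> gen_subgroup n" unfolding n_def by (rule LeastI_ex) (use mem_gen_subgroup in blast)
  have "n \<noteq> 0" using an a by (cases n) auto
  then obtain p where p: "n = Suc p" by (cases n) auto
  have ap: "a \<notin> gen_subgroup p" using not_less_Least[of p "\<lambda>n. a \<in> gen_subgroup n"] p by (simp add: n_def)
  define g where "g = (from_nat p :: 'g)"
  define d where "d = gen_order TYPE('g) p"
  define k where "k = adjoin_exp (gen_subgroup p) g a"
  have ak: "a - zmul k g \<in> gen_subgroup p"
    using an unfolding p k_def g_def by (intro adjoin_exp) simp
  \<comment> \<open>Minimality of the stage enters here: if d divided k, then
    \<open>zmul k g\<close>, and with it \<open>a\<close>, would already lie in the previous
    subgroup.\<close>
  have dk: "\<not> int d dvd k"
  proof
    assume "int d dvd k"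
    then have "zmul k g \<in> gen_subgroup p"
      using zmul_mem_iff[OF add_subgroup_gen, of k g p] by (simp add: d_def gen_order_def g_def)
    from add_subgroupD(3)[OF add_subgroup_gen ak this] ap show False by simp
  qed
  define A where "A \<omega> = random_char_upto p \<omega> (a - zmul k g) * phase_step p (random_char_upto p \<omega> :: 'g \<Rightarrow> complex) powi k" for \<omega> :: "nat \<Rightarrow> real"
  define B where "B \<omega> = root_phase d (\<omega> p) powi k" for \<omega> :: "nat \<Rightarrow> real"
  have AB: "random_char a \<omega> = A \<omega> * B \<omega>" for \<omega>
    unfolding random_char_eq[OF an] p A_def B_def
    by (simp add: extend_char_def k_def g_def d_def power_int_mult_distrib)
  have Am: "A \<in> borel_measurable (PiM I R)" if "{..<p} \<subseteq> I" for I
  proof -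
    have [measurable]: "(\<lambda>\<omega>. random_char_upto p \<omega> (a::'g)) \<in> borel_measurable (PiM I R)" for a
      unfolding R_def[abs_def] by (rule measurable_random_char_upto[OF that])
    show ?thesis unfolding A_def[abs_def] phase_step_def Let_def
      by (cases "rel_order (gen_subgroup p) (from_nat p :: 'g) = 0") simp_all
  qed
  have phm: "root_phase d \<in> borel_measurable (R p)"
    unfolding R_def d_def by (rule measurable_root_phase)
  have Bm: "B \<in> borel_measurable (PiM I R)" if "p \<in> I" for I
    unfolding B_def[abs_def]
    by (intro borel_measurable_power_int measurable_compose[OF measurable_component_singleton[OF that, of R] phm])
  have Ares: "A (restrict \<omega> {..<p}) = A \<omega>" for \<omega>
    unfolding A_def by (simp add: random_char_upto_restrict)
  have Bres: "B (restrict \<omega> {p}) = B \<omega>" for \<omega>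
    unfolding B_def by simp
  have prR: "prob_space (R i)" for i unfolding R_def by (rule prob_space_root_measure)
  \<comment> \<open>The coordinates are independent because their joint distribution is
    \<open>P\<close> itself, the product of their marginals.\<close>
  have "indep_vars R (\<lambda>i \<omega>. \<omega> i) UNIV"
  proof (subst indep_vars_iff_distr_eq_PiM)
    have "distr P (R i) (\<lambda>\<omega>. \<omega> i) = R i" for i
      unfolding PR by (rule distr_PiM_component[OF prR]) simp
    then have "PiM UNIV (\<lambda>i. distr P (R i) (\<lambda>\<omega>. \<omega> i)) = P" by (simp add: PR)
    moreover have "distr P (PiM UNIV R) (\<lambda>\<omega>. \<lambda>i\<in>UNIV. \<omega> i) = P"
      unfolding PR restrict_UNIV by (simp add: distr_id2)
    ultimately show "distr P (PiM UNIV R) (\<lambda>\<omega>. \<lambda>i\<in>UNIV. \<omega> i) = PiM UNIV (\<lambda>i. distr P (R i) (\<lambda>\<omega>. \<omega> i))" by simp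
  qed (simp_all add: PR)
  then have "indep_var (PiM {..<p} R) (\<lambda>\<omega>. restrict \<omega> {..<p}) (PiM {p} R) (\<lambda>\<omega>. restrict \<omega> {p})"
    by (rule indep_var_restrict) auto
  then have "indep_var borel (A \<circ> (\<lambda>\<omega>. restrict \<omega> {..<p})) borel (B \<circ> (\<lambda>\<omega>. restrict \<omega> {p}))"
    by (rule indep_var_compose) (use Am Bm in auto)
  then have iv: "indep_var borel A borel B" by (simp add: comp_def Ares Bres)
  have ph1: "cmod (phase_step p (X :: 'g \<Rightarrow> complex)) = 1" for X
    by (simp add: phase_step_def Let_def circle_root_def)
  have A1: "cmod (A \<omega>) = 1" for \<omega>
    unfolding A_def using character_onD(1)[OF character_on_random_char_upto ak]
    by (simp add: norm_mult norm_power_int ph1)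
  have B1: "cmod (B \<omega>) = 1" for \<omega>
    unfolding B_def by (simp add: norm_power_int)
  have iA: "integrable P A"
    by (rule integrable_const_bound[of _ 1]) (use A1 Am[of UNIV] PR in auto)
  have iB: "integrable P B"
    by (rule integrable_const_bound[of _ 1]) (use B1 Bm[of UNIV] PR in auto)
  have "(LINT \<omega>|P. B \<omega>) = (LINT u|distr P (R p) (\<lambda>\<omega>. \<omega> p). root_phase d u powi k)"
    unfolding B_def
    by (subst integral_distr) (use phm in \<open>auto simp: PR intro!: borel_measurable_power_int\<close>)
  also have "distr P (R p) (\<lambda>\<omega>. \<omega> p) = R p"
    unfolding PR by (rule distr_PiM_component[OF prR]) simp
  also have "(LINT u|R p. root_phase d u powi k) = 0"
    unfolding R_def d_def using dk by (intro integral_root_phase) (simp add: d_def)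
  finally have "(LINT \<omega>|P. B \<omega>) = 0" .
  then have "(LINT \<omega>|P. A \<omega> * B \<omega>) = 0"
    using indep_var_lebesgue_integral[OF iv iA iB] by simp
  then show ?thesis by (simp add: AB P_def)
qed

text \<open>The last clause says that the characters generate the sigma-algebra.\<close>

definition haar_characters :: "'w measure \<Rightarrow> ('g::ab_group_add \<Rightarrow> 'w \<Rightarrow> complex) \<Rightarrow> bool" where
  "haar_characters P ch \<longleftrightarrow>
     prob_space P \<and> (\<forall>a. ch a \<in> borel_measurable P) \<and> (\<forall>a \<omega>. cmod (ch a \<omega>) = 1) \<and>
     (\<forall>a b \<omega>. ch (a + b) \<omega> = ch a \<omega> * ch b \<omega>) \<and> (\<forall>a. a \<noteq> 0 \<longrightarrow> (LINT \<omega>|P. ch a \<omega>) = 0) \<and>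
     (\<forall>D. space D = space P \<longrightarrow> (\<forall>a. ch a \<in> borel_measurable D) \<longrightarrow> sets P \<subseteq> sets D)"

text \<open>The product sigma-algebra can be finer than what the characters see, so the measure is
  transported along the identity to the pullback sigma-algebra of the joint map \<open>f\<close>. A
  sigma-algebra making every character measurable makes \<open>f\<close> measurable and hence
  contains this pullback; the integrals of the characters do not change.\<close>

theorem exists_haar_characters:
  "\<exists>(P :: (nat \<Rightarrow> real) measure) (ch :: 'g::{ab_group_add, countable} \<Rightarrow> _). haar_characters P ch"
proof -
  define P0 where "P0 = char_measure TYPE('g)"
  define f where "f \<omega> a = random_char (a::'g) \<omega>" for \<omega> a
  define V where "V = vimage_algebra (space P0) f (PiM UNIV (\<lambda>_. borel :: complex measure))"
  define P where "P = distr P0 V (\<lambda>\<omega>. \<omega>)"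
  interpret P0: prob_space P0 unfolding P0_def by (rule prob_space_char_measure)
  have fm: "f \<in> measurable N (PiM UNIV (\<lambda>_. borel))" if "\<And>a. random_char (a::'g) \<in> borel_measurable N" for N
    using that by (intro measurable_PiM_single') (auto simp: f_def[abs_def])
  have f0: "f \<in> measurable P0 (PiM UNIV (\<lambda>_. borel))"
    by (rule fm) (simp add: P0_def measurable_random_char)
  have sV: "space V = space P0" by (simp add: V_def)
  have idm: "(\<lambda>\<omega>. \<omega>) \<in> measurable P0 V"
    unfolding V_def by (rule measurable_vimage_algebra2) (use f0 in auto)
  have chV: "random_char (a::'g) \<in> borel_measurable V" for a
  proof -
    have "f \<in> measurable V (PiM UNIV (\<lambda>_. borel))"
      unfolding V_def by (rule measurable_vimage_algebra1) (auto simp: space_PiM)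
    from measurable_compose[OF this measurable_component_singleton[of a]]
    show ?thesis by (simp add: f_def[abs_def])
  qed
  have chP: "random_char (a::'g) \<in> borel_measurable P" for a
    using chV by (simp add: P_def)
  have "prob_space P" unfolding P_def by (rule P0.prob_space_distr[OF idm])
  moreover have "(LINT \<omega>|P. random_char a \<omega>) = 0" if "a \<noteq> 0" for a :: 'g
    unfolding P_def using integral_random_char[OF that]
    by (subst integral_distr[OF idm]) (use chV in \<open>auto simp: P0_def\<close>)
  moreover have "sets P \<subseteq> sets N" if N: "space N = space P" "\<forall>a. random_char (a::'g) \<in> borel_measurable N" for N
  proof
    fix E assume "E \<in> sets P"
    then have "E \<in> sets V" by (simp add: P_def)
    then obtain E' where E': "E' \<in> sets (PiM UNIV (\<lambda>_::'g. borel :: complex measure))" "E = f -` E' \<inter> space P0"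
      unfolding V_def by (subst (asm) sets_vimage_algebra2) (auto simp: space_PiM)
    have "f -` E' \<inter> space N \<in> sets N" using fm[of N] N(2) E'(1) by (auto intro: measurable_sets)
    then show "E \<in> sets N" using E'(2) N(1) by (simp add: P_def sV)
  qed
  moreover have "\<forall>a b \<omega>. random_char (a + b :: 'g) \<omega> = random_char a \<omega> * random_char b \<omega>"
    by (intro allI random_char_add)
  ultimately show ?thesis
    using chP cmod_random_char unfolding haar_characters_def by (intro exI[of _ P] exI[of _ random_char]) simp
qed

section \<open>Measurable selection of minimisers\<close>

text \<open>By continuity the infimum over \<open>L\<close> equals the infimum over a countable
  dense subset, and a countable infimum of measurable functions is measurable.\<close>

lemma measurable_min_compact:
  fixes h :: "'w \<Rightarrow> 'v::{metric_space, second_countable_topology} \<Rightarrow> real"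
  assumes L: "compact L" "L \<noteq> {}"
    and hm: "\<And>v. v \<in> L \<Longrightarrow> (\<lambda>w. h w v) \<in> borel_measurable W"
    and hc: "\<And>w. w \<in> space W \<Longrightarrow> continuous_on L (h w)"
  shows "(\<lambda>w. INF v\<in>L. h w v) \<in> borel_measurable W"
proof -
  obtain D where D: "countable D" "D \<subseteq> L" "L \<subseteq> closure D"
    using separable[of L] by metis
  have "D \<noteq> {}" using D L by auto
  have bdd: "bdd_below (h w ` L)" if "w \<in> space W" for w
    by (intro bounded_imp_bdd_below compact_imp_bounded compact_continuous_image hc that L)
  have "(INF v\<in>L. h w v) = (INF v\<in>D. h w v)" if w: "w \<in> space W" for w
  proof (rule antisym)
    show "(INF v\<in>L. h w v) \<le> (INF v\<in>D. h w v)"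
      by (rule cINF_superset_mono) (use \<open>D \<noteq> {}\<close> D bdd[OF w] in auto)
    show "(INF v\<in>D. h w v) \<le> (INF v\<in>L. h w v)"
    proof (rule cINF_greatest[OF L(2)])
      fix v assume v: "v \<in> L"
      have bD: "bdd_below (h w ` D)" using bdd[OF w] D(2) by (meson bdd_below_mono image_mono)
      have "closed {x \<in> L. (INF v\<in>D. h w v) \<le> h w x}"
        by (intro continuous_on_closed_Collect_le continuous_on_const hc w compact_imp_closed L)
      moreover have "D \<subseteq> {x \<in> L. (INF v\<in>D. h w v) \<le> h w x}"
        using D(2) by (auto intro: cINF_lower[OF bD])
      ultimately have "closure D \<subseteq> {x \<in> L. (INF v\<in>D. h w v) \<le> h w x}"
        by (simp add: closure_minimal)
      then show "(INF v\<in>D. h w v) \<le> h w v" using v D(3) by auto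
    qed
  qed
  moreover have "(\<lambda>w. INF v\<in>D. h w v) \<in> borel_measurable W"
  proof (rule borel_measurable_cINF_real[OF D(1)])
    show "\<And>v. v \<in> D \<Longrightarrow> (\<lambda>w. h w v) \<in> borel_measurable W" using hm D by auto
  qed
  ultimately show ?thesis by (subst measurable_cong[where g = "\<lambda>w. INF v\<in>D. h w v"]) auto
qed

lemma INF_compact_attained:
  fixes f :: "'v::metric_space \<Rightarrow> real"
  assumes "compact L" "L \<noteq> {}" "continuous_on L f"
  shows "\<exists>v\<in>L. f v = (INF v\<in>L. f v)"
proof -
  obtain v where v: "v \<in> L" "\<And>y. y \<in> L \<Longrightarrow> f v \<le> f y"
    using continuous_attains_inf[OF assms] by blast
  then have "f v = (INF v\<in>L. f v)"
    by (intro cInf_eq_minimum[symmetric]) auto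
  with v show ?thesis by blast
qed

text \<open>Kuratowski--Ryll-Nardzewski selection for the sets of minimisers: those meeting a given compact
  set form a measurable condition on the parameter, since it compares two minima.  Picking
  successively the first ball of radius \<open>2\<^sup>-\<^sup>n\<close> that still meets the set of minimisers gives measurable
  approximations that converge to a minimiser.\<close>

lemma measurable_argmin:
  fixes h :: "'w \<Rightarrow> 'v::{metric_space, second_countable_topology} \<Rightarrow> real"
  assumes K: "compact K" "K \<noteq> {}"
    and hm: "\<And>v. v \<in> K \<Longrightarrow> (\<lambda>w. h w v) \<in> borel_measurable W"
    and hc: "\<And>w. w \<in> space W \<Longrightarrow> continuous_on K (h w)"
  shows "\<exists>u\<in>borel_measurable W. \<forall>w\<in>space W. u w \<in> K \<and> (\<forall>v\<in>K. h w (u w) \<le> h w v)"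
proof -
  obtain D where D: "countable D" "D \<subseteq> K" "K \<subseteq> closure D"
    using separable[of K] by metis
  have "D \<noteq> {}" using D K by auto
  define d where "d = from_nat_into D"
  have d: "range d = D" unfolding d_def using D(1) \<open>D \<noteq> {}\<close> by (simp add: range_from_nat_into)
  have dcover: "\<exists>n. v \<in> cball (d n) e" if v: "v \<in> K" and e: "e > 0" for v e
  proof -
    have "v \<in> closure D" using v D(3) by auto
    then obtain y where "y \<in> D" "dist y v < e" using e by (auto simp: closure_approachable)
    then show ?thesis using d by (auto intro: less_imp_le)
  qed
  define F where "F w = {v \<in> K. \<forall>y\<in>K. h w v \<le> h w y}" for w
  \<comment> \<open>The list \<open>ns\<close> records the centres chosen so far, the i-th with
    radius \<open>(1/2)^i\<close>; \<open>S ns\<close> is what these balls leave of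
    \<open>K\<close>.\<close>
  define S where "S ns = K \<inter> (\<Inter>i<length ns. cball (d (ns ! i)) ((1/2)^i))" for ns
  have Sc: "compact (S ns)" for ns
    unfolding S_def by (rule compact_Int_closed[OF K(1)]) auto
  have SK: "S ns \<subseteq> K" for ns by (auto simp: S_def)
  have SApp: "S (ns @ [n]) = S ns \<inter> cball (d n) ((1/2)^length ns)" for ns n
    unfolding S_def by (simp add: lessThan_Suc nth_append Int_ac cong: INF_cong_simp)
  define Q where "Q w ns \<longleftrightarrow> F w \<inter> S ns \<noteq> {}" for w ns
  have Qm: "{w \<in> space W. Q w ns} \<in> sets W" for ns
  proof (cases "S ns = {}")
    case True then show ?thesis by (simp add: Q_def)
  next
    case False
    have [measurable]: "(\<lambda>w. INF v\<in>S ns. h w v) \<in> borel_measurable W"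
      by (rule measurable_min_compact[OF Sc False]) (use SK[of ns] hm hc in \<open>auto intro: continuous_on_subset\<close>)
    have [measurable]: "(\<lambda>w. INF v\<in>K. h w v) \<in> borel_measurable W"
      by (rule measurable_min_compact[OF K]) (use hm hc in auto)
    \<comment> \<open>Both infima are attained by compactness, so a minimiser over \<open>K\<close>
      lies in \<open>S ns\<close> exactly when restricting to \<open>S ns\<close> does not raise the
      minimum.\<close>
    have "Q w ns \<longleftrightarrow> (INF v\<in>S ns. h w v) \<le> (INF v\<in>K. h w v)" if w: "w \<in> space W" for w
    proof
      obtain v0 where v0: "v0 \<in> K" "h w v0 = (INF v\<in>K. h w v)"
        using INF_compact_attained[OF K hc[OF w]] by blast
      have cS: "continuous_on (S ns) (h w)" using hc[OF w] SK by (rule continuous_on_subset)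
      obtain v1 where v1: "v1 \<in> S ns" "h w v1 = (INF v\<in>S ns. h w v)"
        using INF_compact_attained[OF Sc False cS] by blast
      have bdK: "bdd_below (h w ` K)"
        by (intro bounded_imp_bdd_below compact_imp_bounded compact_continuous_image hc w K)
      then have bdS: "bdd_below (h w ` S ns)" using SK by (meson bdd_below_mono image_mono)
      {
        assume "Q w ns"
        then obtain v where v: "v \<in> S ns" "\<forall>y\<in>K. h w v \<le> h w y" by (auto simp: Q_def F_def)
        have "(INF v\<in>S ns. h w v) \<le> h w v" by (rule cINF_lower[OF bdS v(1)])
        also have "\<dots> \<le> h w v0" using v v0 by auto
        finally show "(INF v\<in>S ns. h w v) \<le> (INF v\<in>K. h w v)" using v0 by simp
      next
        assume le: "(INF v\<in>S ns. h w v) \<le> (INF v\<in>K. h w v)"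
        have "h w v1 \<le> h w y" if "y \<in> K" for y
          using v1(2) le cINF_lower[OF bdK that] by simp
        then have "v1 \<in> F w" using v1 SK by (auto simp: F_def)
        then show "Q w ns" using v1 by (auto simp: Q_def)
      }
    qed
    then have "{w \<in> space W. Q w ns} = {w \<in> space W. (INF v\<in>S ns. h w v) \<le> (INF v\<in>K. h w v)}" by auto
    also have "\<dots> \<in> sets W" by measurable
    finally show ?thesis .
  qed
  have Q0: "Q w []" if w: "w \<in> space W" for w
    using continuous_attains_inf[OF K hc[OF w]] by (auto simp: Q_def F_def S_def)
  have Qstep: "\<exists>n. Q w (ns @ [n])" if "Q w ns" for w ns
  proof -
    obtain v where v: "v \<in> F w" "v \<in> S ns" using \<open>Q w ns\<close> by (auto simp: Q_def)
    then obtain n where "v \<in> cball (d n) ((1/2)^length ns)"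
      using dcover[of v "(1/2)^length ns"] SK by auto
    then show ?thesis using v unfolding Q_def SApp by blast
  qed
  define N where "N w k = rec_nat [] (\<lambda>_ ns. ns @ [LEAST n. Q w (ns @ [n])]) k" for w and k :: nat
  have N0: "N w 0 = []" and NS: "N w (Suc k) = N w k @ [LEAST n. Q w (N w k @ [n])]" for w k
    by (simp_all add: N_def)
  have lenN: "length (N w k) = k" for w k by (induction k) (simp_all add: N0 NS)
  have QN: "Q w (N w k)" if "w \<in> space W" for w k
  proof (induction k)
    case 0 then show ?case using Q0[OF that] by (simp add: N0)
  next
    case (Suc k)
    show ?case unfolding NS by (rule LeastI_ex[OF Qstep[OF Suc]])
  qed
  \<comment> \<open>The chosen lists range over a countable type, so the recursion may be treated
    separately on each fixed value of the previous list.\<close>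
  have Nm: "(\<lambda>w. N w k) \<in> measurable W (count_space UNIV)" for k
  proof (induction k)
    case 0 then show ?case by (simp add: N0)
  next
    case (Suc k)
    have "(\<lambda>w. (\<lambda>ns w. ns @ [LEAST n. Q w (ns @ [n])]) (N w k) w) \<in> measurable W (count_space UNIV)"
    proof (rule measurable_compose_countable[OF _ Suc])
      fix ns :: "nat list"
      have [measurable]: "Measurable.pred W (\<lambda>w. Q w ns')" for ns'
        using Qm[of ns'] by (simp add: pred_def)
      have "(\<lambda>w. LEAST n. Q w (ns @ [n])) \<in> measurable W (count_space UNIV)" by measurable
      then show "(\<lambda>w. ns @ [LEAST n. Q w (ns @ [n])]) \<in> measurable W (count_space UNIV)"
        by (rule measurable_compose) simp
    qed
    then show ?case by (simp add: NS)
  qed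
  define a where "a w k = d (last (N w (Suc k)))" for w k
  have am: "(\<lambda>w. a w k) \<in> borel_measurable W" for k
    unfolding a_def by (rule measurable_compose[OF Nm]) simp
  define u where "u w = (SOME v. v \<in> F w \<and> (\<lambda>k. a w k) \<longlonglongrightarrow> v)" for w
  have ex: "\<exists>v. v \<in> F w \<and> (\<lambda>k. a w k) \<longlonglongrightarrow> v" if w: "w \<in> space W" for w
  proof -
    have Fc: "compact (F w)"
    proof -
      have "F w = K \<inter> (\<Inter>y\<in>K. {v \<in> K. h w v \<le> h w y})" by (auto simp: F_def)
      moreover have "closed {v \<in> K. h w v \<le> h w y}" for y
        by (intro continuous_on_closed_Collect_le continuous_on_const hc w compact_imp_closed K)
      ultimately show ?thesis by (metis (mono_tags, lifting) K(1) closed_INT compact_Int_closed)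
    qed
    \<comment> \<open>The surviving sets of minimisers are compact, nested and nonempty, so they
      share a point; it lies within \<open>(1/2)^k\<close> of the k-th centre and is therefore the
      limit of the centres.\<close>
    have "(\<Inter>k. F w \<inter> S (N w k)) \<noteq> {}"
    proof (rule compact_space_imp_nest)
      show "compact_space (top_of_set (F w))"
        using Fc by (simp add: compact_space_subtopology)
      show "closedin (top_of_set (F w)) (F w \<inter> S (N w k))" for k
        by (intro closed_subset compact_imp_closed compact_Int Fc Sc) auto
      show "F w \<inter> S (N w k) \<noteq> {}" for k using QN[OF w, of k] by (simp add: Q_def)
      show "decseq (\<lambda>k. F w \<inter> S (N w k))"
        by (rule decseq_SucI) (auto simp: NS SApp)
    qed
    then obtain v where v: "\<And>k. v \<in> F w" "\<And>k. v \<in> S (N w k)" by blast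
    have dk: "\<forall>k. norm (dist (a w k) v) \<le> (1/2)^k"
      using v(2)[of "Suc _"] unfolding NS SApp a_def lenN by simp
    have "(\<lambda>k. (1/2::real)^k) \<longlonglongrightarrow> 0" by (rule LIMSEQ_power_zero) simp
    then have "(\<lambda>k. dist (a w k) v) \<longlonglongrightarrow> 0"
      by (rule Lim_null_comparison[OF always_eventually[OF dk]])
    then have "(\<lambda>k. a w k) \<longlonglongrightarrow> v" by (subst tendsto_dist_iff)
    then show ?thesis using v(1) by blast
  qed
  have u: "u w \<in> F w" "(\<lambda>k. a w k) \<longlonglongrightarrow> u w" if "w \<in> space W" for w
    using someI_ex[OF ex[OF that]] by (auto simp: u_def)
  have "u \<in> borel_measurable W"
    by (rule borel_measurable_LIMSEQ_metric[OF am u(2)])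
  then show ?thesis using u(1) by (intro bexI[of _ u]) (auto simp: F_def)
qed

section \<open>The unitary representation\<close>

locale quasi_action = sigma_finite_measure M
  for M :: "'a measure" +
  fixes \<sigma> :: "'g::{ab_group_add, countable} \<Rightarrow> 'a \<Rightarrow> 'a"
    and J :: "'g \<Rightarrow> 'a \<Rightarrow> real"
  assumes qi: "quasi_invariant_action M \<sigma> J"
begin

abbreviation gen_space :: "('a \<Rightarrow> complex) set \<Rightarrow> ('a \<Rightarrow> complex) set" where
  "gen_space \<equiv> generated_space M \<sigma> J"

abbreviation rep :: "'g \<Rightarrow> ('a \<Rightarrow> complex) \<Rightarrow> 'a \<Rightarrow> complex" where
  "rep \<equiv> l2_rep \<sigma> J"

lemma measurable_action [measurable]: "\<sigma> a \<in> measurable M M"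
  using qi by (auto simp: quasi_invariant_action_def measurable_action_def)

lemma action_space: "x \<in> space M \<Longrightarrow> \<sigma> a x \<in> space M"
  using measurable_space[OF measurable_action] by blast

lemma action_add: "x \<in> space M \<Longrightarrow> \<sigma> a (\<sigma> b x) = \<sigma> (a + b) x"
  using qi by (auto simp: quasi_invariant_action_def measurable_action_def)

lemma action_zero: "x \<in> space M \<Longrightarrow> \<sigma> 0 x = x"
  using qi by (auto simp: quasi_invariant_action_def measurable_action_def)

lemma action_inverse: "x \<in> space M \<Longrightarrow> \<sigma> a (\<sigma> (- a) x) = x" "x \<in> space M \<Longrightarrow> \<sigma> (- a) (\<sigma> a x) = x"
  by (simp_all add: action_add action_zero)

lemma action_image: "E \<in> sets M \<Longrightarrow> \<sigma> a ` E = \<sigma> (- a) -` E \<inter> space M"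
  using action_inverse action_space sets.sets_into_space[of E M] by (auto intro!: rev_image_eqI)

lemma sets_action_image [measurable]: "E \<in> sets M \<Longrightarrow> \<sigma> a ` E \<in> sets M"
  by (simp add: action_image)

lemma measurable_jacobian [measurable]: "J a \<in> borel_measurable M"
proof -
  have "(\<lambda>(\<gamma>, x). J \<gamma> x) \<in> borel_measurable (count_space UNIV \<Otimes>\<^sub>M M)"
    using qi by (auto simp: quasi_invariant_action_def is_jacobian_def)
  from measurable_compose[OF measurable_Pair1'[of a] this] show ?thesis by simp
qed

lemma jacobian_pos: "x \<in> space M \<Longrightarrow> J a x > 0"
  using qi by (auto simp: quasi_invariant_action_def is_jacobian_def)

lemma emeasure_action_image: "E \<in> sets M \<Longrightarrow> emeasure M (\<sigma> a ` E) = (\<integral>\<^sup>+x\<in>E. ennreal (J a x) \<partial>M)"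
  using qi by (auto simp: quasi_invariant_action_def is_jacobian_def)

text \<open>The Jacobian identity for images, applied to preimages, in pushforward form; this opens
  it to arbitrary nonnegative integrands.\<close>

lemma distr_density_jacobian: "distr (density M (\<lambda>x. ennreal (J a x))) M (\<sigma> a) = M"
proof (rule measure_eqI)
  fix E assume "E \<in> sets (distr (density M (\<lambda>x. ennreal (J a x))) M (\<sigma> a))"
  then have E [measurable]: "E \<in> sets M" by simp
  have p: "\<sigma> a -` E \<inter> space M \<in> sets M" by measurable
  have "\<sigma> a ` (\<sigma> a -` E \<inter> space M) = E"
    using sets.sets_into_space[OF E] unfolding action_image[OF p]
    by (auto simp: action_inverse action_space)
  then show "emeasure (distr (density M (\<lambda>x. ennreal (J a x))) M (\<sigma> a)) E = emeasure M E"
    using emeasure_action_image[OF p, of a] p by (simp add: emeasure_distr emeasure_density)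
qed simp

lemma nn_integral_action:
  assumes [measurable]: "h \<in> borel_measurable M"
  shows "(\<integral>\<^sup>+x. ennreal (J a x) * h (\<sigma> a x) \<partial>M) = (\<integral>\<^sup>+x. h x \<partial>M)"
proof -
  have "(\<integral>\<^sup>+x. h x \<partial>M) = (\<integral>\<^sup>+x. h x \<partial>distr (density M (\<lambda>x. ennreal (J a x))) M (\<sigma> a))"
    by (simp only: distr_density_jacobian)
  also have "\<dots> = (\<integral>\<^sup>+x. h (\<sigma> a x) \<partial>density M (\<lambda>x. ennreal (J a x)))"
    by (rule nn_integral_distr) simp_all
  also have "\<dots> = (\<integral>\<^sup>+x. ennreal (J a x) * h (\<sigma> a x) \<partial>M)"
    by (rule nn_integral_density) simp_all
  finally show ?thesis by simp
qed

text \<open>Chain rule: both sides are densities of the set function sending E to the measure of its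
  image under \<open>\<sigma> (a + b)\<close>, and densities over a sigma-finite measure are unique
  almost everywhere.\<close>

lemma jacobian_cocycle: "AE x in M. J a (\<sigma> b x) * J b x = J (a + b) x"
proof -
  have "density M (\<lambda>x. ennreal (J a (\<sigma> b x) * J b x)) = density M (\<lambda>x. ennreal (J (a + b) x))"
  proof (rule measure_eqI)
    fix E assume "E \<in> sets (density M (\<lambda>x. ennreal (J a (\<sigma> b x) * J b x)))"
    then have E [measurable]: "E \<in> sets M" by simp
    have ind: "indicator (\<sigma> b ` E) (\<sigma> b x) = (indicator E x :: ennreal)" if "x \<in> space M" for x
      using that sets.sets_into_space[OF E] action_inverse(2)
      by (auto simp: indicator_def) (metis subsetD)
    have "emeasure (density M (\<lambda>x. ennreal (J (a + b) x))) E = emeasure M (\<sigma> (a + b) ` E)"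
      by (simp add: emeasure_action_image emeasure_density)
    also have "\<sigma> (a + b) ` E = \<sigma> a ` (\<sigma> b ` E)"
      using sets.sets_into_space[OF E] by (auto simp: image_image action_add subset_iff intro!: image_cong)
    also have "emeasure M \<dots> = (\<integral>\<^sup>+x. ennreal (J a x) * indicator (\<sigma> b ` E) x \<partial>M)"
      by (simp add: emeasure_action_image)
    also have "\<dots> = (\<integral>\<^sup>+x. ennreal (J b x) * (ennreal (J a (\<sigma> b x)) * indicator (\<sigma> b ` E) (\<sigma> b x)) \<partial>M)"
      by (rule nn_integral_action[symmetric]) simp
    also have "\<dots> = (\<integral>\<^sup>+x. ennreal (J a (\<sigma> b x) * J b x) * indicator E x \<partial>M)"
    proof (rule nn_integral_cong)
      fix x assume x: "x \<in> space M"
      show "ennreal (J b x) * (ennreal (J a (\<sigma> b x)) * indicator (\<sigma> b ` E) (\<sigma> b x))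
          = ennreal (J a (\<sigma> b x) * J b x) * indicator E x"
        unfolding ind[OF x] using jacobian_pos[OF x, of b] jacobian_pos[OF action_space[OF x], of a]
        by (simp add: ennreal_mult' mult_ac)
    qed
    also have "\<dots> = emeasure (density M (\<lambda>x. ennreal (J a (\<sigma> b x) * J b x))) E"
      by (simp add: emeasure_density)
    finally show "emeasure (density M (\<lambda>x. ennreal (J a (\<sigma> b x) * J b x))) E
        = emeasure (density M (\<lambda>x. ennreal (J (a + b) x))) E" by simp
  qed simp
  then have "AE x in M. ennreal (J a (\<sigma> b x) * J b x) = ennreal (J (a + b) x)"
    by (intro density_unique) simp_all
  then show ?thesis using AE_space
  proof eventually_elim
    case (elim x)
    then show ?case
      using jacobian_pos[of x b] jacobian_pos[of "\<sigma> b x" a] jacobian_pos[of x "a + b"] action_space[of x b]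
      by (simp add: ennreal_inj mult_pos_pos less_imp_le)
  qed
qed

lemma measurable_rep [measurable]:
  assumes [measurable]: "f \<in> borel_measurable M" shows "rep a f \<in> borel_measurable M"
  unfolding l2_rep_def by measurable

text \<open>Localised unitarity. With E the whole space it gives norm preservation; with E the tile
  it moves the energy of \<open>f\<close> on a translate onto the tile.\<close>

lemma nn_integral_rep:
  assumes [measurable]: "f \<in> borel_measurable M" "E \<in> sets M"
  shows "(\<integral>\<^sup>+x. ennreal ((cmod (rep a f x))\<^sup>2) * indicator E x \<partial>M)
    = (\<integral>\<^sup>+x. ennreal ((cmod (f x))\<^sup>2) * indicator (\<sigma> (- a) ` E) x \<partial>M)"
proof -
  have "(\<integral>\<^sup>+x. ennreal ((cmod (f x))\<^sup>2) * indicator (\<sigma> (- a) ` E) x \<partial>M)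
     = (\<integral>\<^sup>+x. ennreal (J (- a) x) * (ennreal ((cmod (f (\<sigma> (- a) x)))\<^sup>2) * indicator (\<sigma> (- a) ` E) (\<sigma> (- a) x)) \<partial>M)"
    by (rule nn_integral_action[symmetric]) simp
  also have "\<dots> = (\<integral>\<^sup>+x. ennreal ((cmod (rep a f x))\<^sup>2) * indicator E x \<partial>M)"
  proof (rule nn_integral_cong)
    fix x assume x: "x \<in> space M"
    have "indicator (\<sigma> (- a) ` E) (\<sigma> (- a) x) = (indicator E x :: ennreal)"
      using x by (auto simp: action_image indicator_def action_inverse action_space)
    then show "ennreal (J (- a) x) * (ennreal ((cmod (f (\<sigma> (- a) x)))\<^sup>2) * indicator (\<sigma> (- a) ` E) (\<sigma> (- a) x))
        = ennreal ((cmod (rep a f x))\<^sup>2) * indicator E x"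
      using jacobian_pos[OF x, of "- a"]
      by (simp add: l2_rep_def norm_mult power_mult_distrib ennreal_mult' mult_ac)
  qed
  finally show ?thesis by simp
qed

lemma rep_nn_norm:
  assumes [measurable]: "f \<in> borel_measurable M"
  shows "nn_sq M (rep a f) = nn_sq M f"
proof -
  have "\<sigma> (- a) ` space M = space M"
    using action_image[OF sets.top, of "- a"] action_space by auto
  moreover have "(\<integral>\<^sup>+x. g x \<partial>M) = (\<integral>\<^sup>+x. g x * indicator (space M) x \<partial>M)" for g :: "'a \<Rightarrow> ennreal"
    by (rule nn_integral_cong) simp
  ultimately show ?thesis
    using nn_integral_rep[OF assms sets.top, of a] by simp
qed

lemma rep_L2:
  assumes f: "f \<in> L2 M" shows "rep a f \<in> L2 M"
proof (rule L2_nnI)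
  note [measurable] = L2_measurable[OF f]
  show "rep a f \<in> borel_measurable M" by simp
  show "nn_sq M (rep a f) < \<infinity>"
    by (simp add: rep_nn_norm l2_norm_nn[OF f, symmetric])
qed

lemma rep_norm:
  assumes f: "f \<in> L2 M" shows "l2_norm M (rep a f) = l2_norm M f"
proof -
  have "ennreal ((l2_norm M (rep a f))\<^sup>2) = ennreal ((l2_norm M f)\<^sup>2)"
    unfolding l2_norm_nn[OF f] l2_norm_nn[OF rep_L2[OF f]] by (rule rep_nn_norm[OF L2_measurable[OF f]])
  then show ?thesis by (simp add: power2_eq_iff_nonneg)
qed

lemma rep_add: "rep a (\<lambda>x. f x + g x) = (\<lambda>x. rep a f x + rep a g x)"
  and rep_diff: "rep a (\<lambda>x. f x - g x) = (\<lambda>x. rep a f x - rep a g x)"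
  and rep_scale: "rep a (\<lambda>x. c * f x) = (\<lambda>x. c * rep a f x)"
  and rep_zero: "rep a (\<lambda>x. 0) = (\<lambda>x. 0)"
  by (auto simp: l2_rep_def algebra_simps)

text \<open>The homomorphism law inherits its exceptional null set from the cocycle identity, so
  later uses of it have to absorb null sets.\<close>

lemma rep_rep: "AE x in M. rep a (rep b f) x = rep (a + b) f x"
  using jacobian_cocycle[of "- b" "- a"] AE_space
proof eventually_elim
  case (elim x)
  have "sqrt (J (- a) x) * sqrt (J (- b) (\<sigma> (- a) x)) = sqrt (J (- (a + b)) x)"
    using elim(1) by (simp add: real_sqrt_mult[symmetric] mult.commute add.commute)
  then have "complex_of_real (sqrt (J (- a) x)) * complex_of_real (sqrt (J (- b) (\<sigma> (- a) x)))
      = complex_of_real (sqrt (J (- (a + b)) x))"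
    by (metis of_real_mult)
  then show ?case using elim(2) by (simp add: l2_rep_def action_add add.commute flip: mult.assoc)
qed

text \<open>The algebraic span is invariant only up to null sets, because
  \<open>rep a (rep d h)\<close> agrees with \<open>rep (a + d) h\<close> almost everywhere. The
  closure absorbs this, and isometry carries invariance over to limits.\<close>

lemma invariant_generated_space:
  assumes A: "A \<subseteq> L2 M"
  shows "invariant_subspace M \<sigma> J (gen_space A)"
proof -
  define S where "S = {rep a f | a f. f \<in> A}"
  have S: "S \<subseteq> L2 M" using A rep_L2 by (auto simp: S_def)
  have VS: "gen_space A = l2_closure M (cspan_fun S)"
    by (simp add: generated_space_def S_def)
  define V where "V = l2_closure M (cspan_fun S)"
  have V: "closed_l2_subspace M V" unfolding V_def by (rule closed_l2_subspace_cspan[OF S])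
  note VD = closed_l2_subspaceD[OF V]
  have SV: "cspan_fun S \<subseteq> V" unfolding V_def by (rule l2_closure_superset[OF cspan_fun_L2[OF S]])
  have 1: "rep a f \<in> V" if "f \<in> cspan_fun S" for a f
    using that
  proof (induction rule: cspan_fun_induct)
    case zero
    then show ?case using VD(2) by (simp add: rep_zero)
  next
    case (step c b g)
    then obtain d h where b: "b = rep d h" "h \<in> A" by (auto simp: S_def)
    have hm: "h \<in> borel_measurable M" using A b(2) by (auto simp: L2_def)
    have "rep (a + d) h \<in> V"
      using SV b(2) cspan_fun_superset[of "rep (a + d) h" S] by (auto simp: S_def)
    moreover have "AE x in M. rep (a + d) h x = rep a b x"
      using rep_rep[of a d h] unfolding b(1) by eventually_elim simp
    moreover have "rep a b \<in> borel_measurable M" using hm by (simp add: b(1))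
    ultimately have "rep a b \<in> V" using closed_l2_subspace_AE[OF V] by blast
    then show ?case using VD(3,4) step by (simp add: rep_add rep_scale)
  qed
  have "rep a f \<in> V" if f: "f \<in> V" for a f
  proof -
    have fL: "f \<in> L2 M" using f VD(1) by auto
    have "rep a f \<in> l2_closure M V"
      unfolding l2_closure_def
    proof (safe intro!: rep_L2[OF fL])
      fix e :: real assume "e > 0"
      then obtain g where g: "g \<in> cspan_fun S" "l2_dist M f g < e"
        using f by (auto simp: V_def l2_closure_def)
      have "g \<in> L2 M" using g cspan_fun_L2[OF S] by auto
      then have "l2_dist M (rep a f) (rep a g) = l2_dist M f g"
        using rep_norm[OF L2_diff[OF fL]] by (simp add: rep_diff)
      then show "\<exists>h\<in>V. l2_dist M (rep a f) h < e"
        using g(2) 1[OF g(1)] by (intro bexI[of _ "rep a g"]) auto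
    qed
    then show ?thesis using V by (auto simp: closed_l2_subspace_def)
  qed
  with V show ?thesis by (auto simp: invariant_subspace_def VS V_def[symmetric])
qed

text \<open>The generators include \<open>rep 0 f\<close> rather than \<open>f\<close>. The cocycle
  identity at 0 gives J 0 squared equal to J 0, so positivity forces J 0 = 1 almost everywhere and
  the two functions agree there.\<close>

lemma generated_space_superset:
  assumes "A \<subseteq> L2 M" "f \<in> A" shows "f \<in> gen_space A"
proof -
  define S where "S = {rep a f | a f. f \<in> A}"
  have S: "S \<subseteq> L2 M" using assms rep_L2 by (auto simp: S_def)
  have VS: "gen_space A = l2_closure M (cspan_fun S)"
    by (simp add: generated_space_def S_def)
  have V: "closed_l2_subspace M (gen_space A)" unfolding VS by (rule closed_l2_subspace_cspan[OF S])
  have "rep 0 f \<in> gen_space A"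
    unfolding VS using l2_closure_superset[OF cspan_fun_L2[OF S]] cspan_fun_superset[of "rep 0 f" S] assms(2)
    by (auto simp: S_def)
  have fm: "f \<in> borel_measurable M" using assms by (auto simp: L2_def)
  have "AE x in M. rep 0 f x = f x"
    using jacobian_cocycle[of 0 0] AE_space
  proof eventually_elim
    case (elim x)
    then have "J 0 x * J 0 x = J 0 x" by (simp add: action_zero)
    then have "J 0 x = 1" using jacobian_pos[OF elim(2), of 0] by simp
    then show ?case using elim by (simp add: l2_rep_def action_zero)
  qed
  with \<open>rep 0 f \<in> gen_space A\<close> show ?thesis
    using fm closed_l2_subspace_AE[OF V] by blast
qed

end

section \<open>The Zak transform\<close>

text \<open>Translates of the tile are disjoint outright, so that indicators of finite unions are
  sums of indicators; \<open>disjoint_tile\<close> arranges this. The space \<open>P\<close> stands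
  for the dual group and is left abstract.\<close>

locale zak_action = quasi_action M \<sigma> J + P: prob_space P
  for M :: "'a measure" and \<sigma> :: "'g::{ab_group_add, countable} \<Rightarrow> 'a \<Rightarrow> 'a" and J
    and P :: "'w measure" +
  fixes C :: "'a set" and ch :: "'g \<Rightarrow> 'w \<Rightarrow> complex"
  assumes C [measurable]: "C \<in> sets M"
    and tile_disjoint: "\<And>a b. a \<noteq> b \<Longrightarrow> \<sigma> a ` C \<inter> \<sigma> b ` C = {}"
    and tile_cover: "AE x in M. x \<in> (\<Union>a. \<sigma> a ` C)"
    and ch_measurable [measurable]: "\<And>a. ch a \<in> borel_measurable P"
    and ch_norm [simp]: "\<And>a w. cmod (ch a w) = 1"
    and ch_add: "\<And>a b w. ch (a + b) w = ch a w * ch b w"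
    and ch_int: "\<And>a. a \<noteq> 0 \<Longrightarrow> (LINT w|P. ch a w) = 0"
    and ch_generate: "\<And>D. space D = space P \<Longrightarrow> (\<And>a. ch a \<in> borel_measurable D) \<Longrightarrow> sets P \<subseteq> sets D"
begin

sublocale N: pair_sigma_finite P M
  by unfold_locales

abbreviation N :: "('w \<times> 'a) measure" where "N \<equiv> P \<Otimes>\<^sub>M M"

lemma ch_cnj_mult: "ch a w * cnj (ch a w) = 1"
  using complex_norm_square[of "ch a w"] by simp

lemma ch_zero: "ch 0 w = 1"
  using ch_add[of 0 0 w] ch_norm[of 0 w] by (metis add_0 mult_cancel_right1 norm_zero zero_neq_one)

lemma ch_minus: "ch (- a) w = cnj (ch a w)"
proof -
  have "ch (- a) w * (ch a w * cnj (ch a w)) = cnj (ch a w)"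
    using ch_add[of "- a" a w] by (simp add: ch_zero flip: mult.assoc)
  then show ?thesis by (simp add: ch_cnj_mult)
qed

lemma ch_orthonormal: "(LINT w|P. cnj (ch a w) * ch b w) = (if a = b then 1 else 0)"
proof -
  have "cnj (ch a w) * ch b w = ch (b - a) w" for w
    using ch_add[of b "- a" w] by (simp add: ch_minus mult.commute)
  then show ?thesis using ch_int[of "b - a"] by (simp add: ch_zero P.prob_space)
qed

text \<open>Parseval for trigonometric polynomials, in extended nonnegative form so that it can be
  inserted pointwise in x under Tonelli.\<close>

lemma nn_integral_ch_sum:
  assumes A: "finite A"
  shows "(\<integral>\<^sup>+w. ennreal ((cmod (\<Sum>a\<in>A. c a * cnj (ch a w)))\<^sup>2) \<partial>P) = (\<Sum>a\<in>A. ennreal ((cmod (c a))\<^sup>2))"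
proof -
  let ?s = "\<lambda>w. \<Sum>a\<in>A. c a * cnj (ch a w)"
  have int: "integrable P (\<lambda>w. (c a * cnj (c b)) * (cnj (ch a w) * ch b w))" for a b
    by (rule P.integrable_const_bound[of _ "cmod (c a * cnj (c b))"]) (auto simp: norm_mult)
  have sq: "complex_of_real ((cmod (?s w))\<^sup>2)
      = (\<Sum>a\<in>A. \<Sum>b\<in>A. (c a * cnj (c b)) * (cnj (ch a w) * ch b w))" for w
    unfolding complex_norm_square by (simp add: sum_product mult_ac)
  have "(LINT w|P. complex_of_real ((cmod (?s w))\<^sup>2))
      = (\<Sum>a\<in>A. \<Sum>b\<in>A. (c a * cnj (c b)) * (LINT w|P. cnj (ch a w) * ch b w))"
    unfolding sq using int by (simp add: Bochner_Integration.integral_sum Bochner_Integration.integrable_sum)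
  also have "\<dots> = (\<Sum>a\<in>A. c a * cnj (c a))"
    unfolding ch_orthonormal using A by (simp add: if_distrib cong: if_cong)
  also have "\<dots> = complex_of_real (\<Sum>a\<in>A. (cmod (c a))\<^sup>2)"
    by (simp only: complex_norm_square[symmetric] of_real_sum)
  finally have "(LINT w|P. (cmod (?s w))\<^sup>2) = (\<Sum>a\<in>A. (cmod (c a))\<^sup>2)"
    unfolding integral_complex_of_real of_real_eq_iff .
  moreover have "integrable P (\<lambda>w. (cmod (?s w))\<^sup>2)"
  proof (rule P.integrable_const_bound[of _ "(\<Sum>a\<in>A. cmod (c a))\<^sup>2"])
    show "AE w in P. norm ((cmod (?s w))\<^sup>2) \<le> (\<Sum>a\<in>A. cmod (c a))\<^sup>2"
      by (rule AE_I2) (auto intro!: power_mono sum_norm_le simp: norm_mult)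
  qed simp
  ultimately show ?thesis
    by (subst nn_integral_eq_integral) (auto simp: sum_ennreal)
qed

section \<open>Partial Zak sums and the energy of a function on the tiles\<close>

abbreviation tiles :: "'g set \<Rightarrow> 'a set" where
  "tiles A \<equiv> (\<Union>a\<in>A. \<sigma> (- a) ` C)"

text \<open>Since \<open>rep a f\<close> on \<open>C\<close> reads off \<open>f\<close> on
  \<open>\<sigma> (- a)\<close> composed with the tile, this is also the energy of
  \<open>rep a f\<close> on \<open>C\<close>, as \<open>tile_norm_nn\<close> shows; hence the minus
  sign.\<close>

definition tile_norm :: "('a \<Rightarrow> complex) \<Rightarrow> 'g \<Rightarrow> real" where
  "tile_norm f a = (LINT x|M. (cmod (f x))\<^sup>2 * indicator (\<sigma> (- a) ` C) x)"

lemma tile_norm_nn: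
  assumes f: "f \<in> L2 M"
  shows "(\<integral>\<^sup>+x. ennreal ((cmod (rep a f x))\<^sup>2) * indicator C x \<partial>M) = ennreal (tile_norm f a)"
proof -
  note [measurable] = L2_measurable[OF f]
  have "(\<integral>\<^sup>+x. ennreal ((cmod (rep a f x))\<^sup>2) * indicator C x \<partial>M)
      = (\<integral>\<^sup>+x. ennreal ((cmod (f x))\<^sup>2) * indicator (\<sigma> (- a) ` C) x \<partial>M)"
    by (rule nn_integral_rep) simp_all
  also have "\<dots> = (\<integral>\<^sup>+x. ennreal ((cmod (f x))\<^sup>2 * indicator (\<sigma> (- a) ` C) x) \<partial>M)"
    by (intro nn_integral_cong) (simp add: ennreal_mult' ennreal_indicator)
  also have "\<dots> = ennreal (tile_norm f a)"
    unfolding tile_norm_def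
    by (rule nn_integral_eq_integral) (auto intro: integrable_real_mult_indicator L2_integrable[OF f])
  finally show ?thesis .
qed

lemma tile_norm_nonneg: "tile_norm f a \<ge> 0"
  unfolding tile_norm_def by (intro Bochner_Integration.integral_nonneg) simp

text \<open>A finite section of the Zak series, supported over the tile in the second variable.
  Conjugating the character makes \<open>rep d\<close> correspond to multiplication by
  \<open>ch d\<close> rather than by its inverse.\<close>

definition zak_part :: "'g set \<Rightarrow> ('a \<Rightarrow> complex) \<Rightarrow> 'w \<times> 'a \<Rightarrow> complex" where
  "zak_part A f = (\<lambda>(w, x). \<Sum>a\<in>A. (indicator C x * rep a f x) * cnj (ch a w))"

lemma measurable_zak_part [measurable]:
  assumes [measurable]: "f \<in> borel_measurable M"
  shows "zak_part A f \<in> borel_measurable N"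
  unfolding zak_part_def by measurable

lemma zak_part_nn:
  assumes f: "f \<in> L2 M" and A: "finite A"
  shows "nn_sq N (zak_part A f) = ennreal (\<Sum>a\<in>A. tile_norm f a)"
proof -
  note [measurable] = L2_measurable[OF f]
  have "nn_sq N (zak_part A f)
     = (\<integral>\<^sup>+x. \<integral>\<^sup>+w. ennreal ((cmod (zak_part A f (w, x)))\<^sup>2) \<partial>P \<partial>M)"
    by (rule N.nn_integral_snd[symmetric]) simp
  also have "\<dots> = (\<integral>\<^sup>+x. (\<Sum>a\<in>A. ennreal ((cmod (rep a f x))\<^sup>2) * indicator C x) \<partial>M)"
    unfolding zak_part_def case_prod_conv nn_integral_ch_sum[OF A]
    by (intro nn_integral_cong sum.cong refl)
      (auto simp: norm_mult power_mult_distrib indicator_def)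
  also have "\<dots> = (\<Sum>a\<in>A. \<integral>\<^sup>+x. ennreal ((cmod (rep a f x))\<^sup>2) * indicator C x \<partial>M)"
    by (rule nn_integral_sum) simp
  also have "\<dots> = ennreal (\<Sum>a\<in>A. tile_norm f a)"
    by (simp add: tile_norm_nn[OF f] sum_ennreal tile_norm_nonneg)
  finally show ?thesis .
qed

lemma zak_part_L2:
  assumes "f \<in> L2 M" "finite A" shows "zak_part A f \<in> L2 N"
  by (rule L2_nnI) (use assms zak_part_nn[OF assms] L2_measurable[OF assms(1)] in auto)

lemma zak_part_norm:
  assumes "f \<in> L2 M" "finite A"
  shows "(l2_norm N (zak_part A f))\<^sup>2 = (\<Sum>a\<in>A. tile_norm f a)"
  using zak_part_nn[OF assms] l2_norm_nn[OF zak_part_L2[OF assms]]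
  by (simp add: sum_nonneg tile_norm_nonneg)

lemma zak_part_add: "zak_part A (\<lambda>x. f x + g x) = (\<lambda>p. zak_part A f p + zak_part A g p)"
  by (auto simp: zak_part_def rep_add algebra_simps sum.distrib)

lemma zak_part_scale: "zak_part A (\<lambda>x. c * f x) = (\<lambda>p. c * zak_part A f p)"
  by (auto simp: zak_part_def rep_scale sum_distrib_left mult_ac)

lemma zak_part_Diff:
  assumes "finite A" "B \<subseteq> A"
  shows "zak_part (A - B) f = (\<lambda>p. zak_part A f p - zak_part B f p)"
  using assms by (auto simp: zak_part_def sum_diff)

lemma tile_norm_sum_eq:
  assumes f: "f \<in> L2 M" and A: "finite A"
  shows "(\<Sum>a\<in>A. tile_norm f a) = (LINT x|M. (cmod (f x))\<^sup>2 * indicator (tiles A) x)"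
proof -
  have "(\<Sum>a\<in>A. tile_norm f a) = (LINT x|M. (\<Sum>a\<in>A. (cmod (f x))\<^sup>2 * indicator (\<sigma> (- a) ` C) x))"
    unfolding tile_norm_def
    by (rule Bochner_Integration.integral_sum[symmetric])
      (auto intro: integrable_real_mult_indicator L2_integrable[OF f])
  also have "\<dots> = (LINT x|M. (cmod (f x))\<^sup>2 * indicator (tiles A) x)"
  proof (rule Bochner_Integration.integral_cong[OF refl])
    fix x
    have "disjoint_family_on (\<lambda>a. \<sigma> (- a) ` C) A"
      unfolding disjoint_family_on_def using tile_disjoint by (metis minus_minus)
    then have "(\<Sum>a\<in>A. indicator (\<sigma> (- a) ` C) x) = (indicator (tiles A) x :: real)"
      using A by (intro indicator_UN_disjoint[symmetric])
    then show "(\<Sum>a\<in>A. (cmod (f x))\<^sup>2 * indicator (\<sigma> (- a) ` C) x) = (cmod (f x))\<^sup>2 * indicator (tiles A) x"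
      by (simp flip: sum_distrib_left)
  qed
  finally show ?thesis .
qed

text \<open>The tiles cover almost everything, so by dominated convergence their energies exhaust
  the squared norm. This is where isometry of the transform originates.\<close>

lemma tile_norm_sums:
  assumes f: "f \<in> L2 M"
  shows "(\<lambda>n. \<Sum>a\<in>from_nat ` {..<n}. tile_norm f a) \<longlonglongrightarrow> (l2_norm M f)\<^sup>2"
proof -
  note [measurable] = L2_measurable[OF f]
  have "(\<lambda>n. LINT x|M. (cmod (f x))\<^sup>2 * indicator (tiles (from_nat ` {..<n})) x)
      \<longlonglongrightarrow> (LINT x|M. (cmod (f x))\<^sup>2)"
  proof (rule integral_dominated_convergence[where w = "\<lambda>x. (cmod (f x))\<^sup>2"])
    show "AE x in M. (\<lambda>n. (cmod (f x))\<^sup>2 * indicator (tiles (from_nat ` {..<n})) x) \<longlonglongrightarrow> (cmod (f x))\<^sup>2"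
      using tile_cover
    proof eventually_elim
      case (elim x)
      then obtain a where a: "x \<in> \<sigma> a ` C" by auto
      have "x \<in> (tiles (from_nat ` {..<n}))" if "n \<ge> Suc (to_nat (- a))" for n
        using a that by (intro UN_I[of "- a"] image_eqI[of _ _ "to_nat (- a)"]) auto
      then have "\<forall>\<^sub>F n in sequentially. (cmod (f x))\<^sup>2 * indicator (tiles (from_nat ` {..<n})) x = (cmod (f x))\<^sup>2"
        by (intro eventually_sequentiallyI[of "Suc (to_nat (- a))"]) (simp only: indicator_simps mult_1_right)
      then show ?case by (rule tendsto_eventually)
    qed
    show "AE x in M. norm ((cmod (f x))\<^sup>2 * indicator (tiles (from_nat ` {..<n})) x) \<le> (cmod (f x))\<^sup>2" for n
      by (rule AE_I2) (auto simp: indicator_def)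
  qed (use L2_integrable[OF f] in \<open>auto intro!: borel_measurable_times borel_measurable_indicator sets.finite_UN\<close>)
  then show ?thesis by (simp only: tile_norm_sum_eq[OF f] finite_imageI finite_lessThan l2_norm_sq)
qed

lemma tile_norm_sum_bound:
  assumes f: "f \<in> L2 M" and A: "finite A"
  shows "(\<Sum>a\<in>A. tile_norm f a) \<le> (l2_norm M f)\<^sup>2"
  unfolding tile_norm_sum_eq[OF f A] l2_norm_sq
proof (rule integral_mono)
  show "integrable M (\<lambda>x. (cmod (f x))\<^sup>2 * indicator (tiles A) x)"
    using A by (intro integrable_real_mult_indicator L2_integrable[OF f] sets.finite_UN) auto
qed (auto simp: L2_integrable[OF f] indicator_def)

text \<open>Convergence is along the net of all finite subsets, not along an enumeration: the
  representation translates the index set, and the net is stable under translation.\<close>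

definition is_zak :: "('a \<Rightarrow> complex) \<Rightarrow> ('w \<times> 'a \<Rightarrow> complex) \<Rightarrow> bool" where
  "is_zak f F \<longleftrightarrow> F \<in> L2 N \<and>
    ((\<lambda>A. l2_dist N (zak_part A f) F) \<longlongrightarrow> 0) (finite_subsets_at_top UNIV)"

text \<open>By orthogonality the squared distance of two nested partial sums is the energy on the
  tiles in between, so the tail \<open>e\<close> of the squared norm controls the whole net at
  once.\<close>

lemma is_zak_exists:
  assumes f: "f \<in> L2 M" shows "\<exists>F. is_zak f F"
proof -
  define E where "E n = (from_nat ` {..<n} :: 'g set)" for n
  have Efin [simp]: "finite (E n)" for n by (simp add: E_def)
  have Emono: "E n \<subseteq> E m" if "n \<le> m" for n m using that by (auto simp: E_def)
  define e where "e n = (l2_norm M f)\<^sup>2 - (\<Sum>a\<in>E n. tile_norm f a)" for n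
  have "(\<lambda>n. (l2_norm M f)\<^sup>2 - (\<Sum>a\<in>E n. tile_norm f a)) \<longlonglongrightarrow> (l2_norm M f)\<^sup>2 - (l2_norm M f)\<^sup>2"
    unfolding E_def by (intro tendsto_diff tendsto_const tile_norm_sums[OF f])
  then have e0: "e \<longlonglongrightarrow> 0" by (simp add: e_def[abs_def])
  have bd: "(l2_dist N (zak_part A f) (zak_part (E n) f))\<^sup>2 \<le> e n" if A: "finite A" "E n \<subseteq> A" for A n
  proof -
    have "(l2_dist N (zak_part A f) (zak_part (E n) f))\<^sup>2 = (\<Sum>a\<in>A - E n. tile_norm f a)"
      unfolding zak_part_Diff[OF A, symmetric] using A by (intro zak_part_norm[OF f]) auto
    also have "\<dots> = (\<Sum>a\<in>A. tile_norm f a) - (\<Sum>a\<in>E n. tile_norm f a)"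
      using A by (simp add: sum_diff)
    also have "\<dots> \<le> e n" unfolding e_def using tile_norm_sum_bound[OF f A(1)] by simp
    finally show ?thesis .
  qed
  have small: "\<exists>n0. \<forall>n\<ge>n0. \<forall>A. finite A \<longrightarrow> E n \<subseteq> A \<longrightarrow> l2_dist N (zak_part A f) (zak_part (E n) f) < r"
    if r: "r > 0" for r
  proof -
    have "\<forall>\<^sub>F n in sequentially. e n < r\<^sup>2" using e0 r by (intro order_tendstoD) auto
    then obtain n0 where n0: "\<And>n. n \<ge> n0 \<Longrightarrow> e n < r\<^sup>2" by (auto simp: eventually_sequentially)
    show ?thesis
    proof (intro exI[of _ n0] allI impI)
      fix n A assume "n \<ge> n0" "finite A" "E n \<subseteq> A"
      then have "(l2_dist N (zak_part A f) (zak_part (E n) f))\<^sup>2 < r\<^sup>2"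
        using bd[of A n] n0[of n] by simp
      then show "l2_dist N (zak_part A f) (zak_part (E n) f) < r"
        using r by (simp add: power_less_imp_less_base)
    qed
  qed
  have "\<exists>F\<in>L2 N. (\<lambda>n. l2_dist N (zak_part (E n) f) F) \<longlonglongrightarrow> 0"
  proof (rule L2_complete)
    show "zak_part (E n) f \<in> L2 N" for n by (rule zak_part_L2[OF f]) simp
    fix r :: real assume "r > 0"
    from small[OF this] obtain n0 where n0':
      "\<forall>n\<ge>n0. \<forall>A. finite A \<longrightarrow> E n \<subseteq> A \<longrightarrow> l2_dist N (zak_part A f) (zak_part (E n) f) < r" by (rule exE)
    note n0 = n0'[rule_format]
    show "\<exists>n0. \<forall>m\<ge>n0. \<forall>n\<ge>n0. l2_dist N (zak_part (E m) f) (zak_part (E n) f) < r"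
    proof (intro exI[of _ n0] allI impI)
      fix m n assume "n0 \<le> m" "n0 \<le> n"
      then show "l2_dist N (zak_part (E m) f) (zak_part (E n) f) < r"
        using n0[OF _ Efin Emono, of n m] n0[OF _ Efin Emono, of m n]
          l2_norm_minus_commute[of N "zak_part (E m) f" "zak_part (E n) f"]
        by (cases "n \<le> m") simp_all
    qed
  qed
  then obtain F where F: "F \<in> L2 N" and lim: "(\<lambda>n. l2_dist N (zak_part (E n) f) F) \<longlonglongrightarrow> 0" by blast
  have "((\<lambda>A. l2_dist N (zak_part A f) F) \<longlongrightarrow> 0) (finite_subsets_at_top UNIV)"
  proof (rule tendsto_iff[THEN iffD2, rule_format])
    fix r :: real assume r: "r > 0"
    then have "r / 2 > 0" by simp
    from small[OF this] obtain n0 where n0':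
      "\<forall>n\<ge>n0. \<forall>A. finite A \<longrightarrow> E n \<subseteq> A \<longrightarrow> l2_dist N (zak_part A f) (zak_part (E n) f) < r / 2" by (rule exE)
    note n0 = n0'[rule_format]
    have "\<forall>\<^sub>F n in sequentially. l2_dist N (zak_part (E n) f) F < r / 2"
      using lim r by (intro order_tendstoD) auto
    then obtain n1 where n1: "\<And>n. n \<ge> n1 \<Longrightarrow> l2_dist N (zak_part (E n) f) F < r / 2"
      by (auto simp: eventually_sequentially)
    define n where "n = max n0 n1"
    show "\<forall>\<^sub>F A in finite_subsets_at_top UNIV. dist (l2_dist N (zak_part A f) F) 0 < r"
      unfolding eventually_finite_subsets_at_top
    proof (intro exI[of _ "E n"] conjI allI impI)
      fix A assume A: "finite A \<and> E n \<subseteq> A \<and> A \<subseteq> UNIV"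
      have "l2_dist N (zak_part A f) F
          \<le> l2_dist N (zak_part A f) (zak_part (E n) f) + l2_dist N (zak_part (E n) f) F"
        using A by (intro l2_norm_triangle zak_part_L2[OF f] F) auto
      also have "\<dots> < r" using n0[of n A] n1[of n] A by (simp add: n_def)
      finally show "dist (l2_dist N (zak_part A f) F) 0 < r" by simp
    qed simp_all
  qed
  with F show ?thesis by (auto simp: is_zak_def)
qed

lemma finite_subsets_finite: "\<forall>\<^sub>F A in finite_subsets_at_top (UNIV :: 'g set). finite A"
  by (rule eventually_finite_subsets_at_top_weakI) simp

lemma is_zak_L2: "is_zak f F \<Longrightarrow> F \<in> L2 N"
  by (simp add: is_zak_def)

lemma is_zak_add:
  assumes f: "f \<in> L2 M" "is_zak f F" and g: "g \<in> L2 M" "is_zak g G"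
  shows "is_zak (\<lambda>x. f x + g x) (\<lambda>p. F p + G p)"
  unfolding is_zak_def
proof
  show "(\<lambda>p. F p + G p) \<in> L2 N" using f g by (intro L2_add is_zak_L2)
  have "((\<lambda>A. l2_dist N (zak_part A f) F + l2_dist N (zak_part A g) G) \<longlongrightarrow> 0 + 0) (finite_subsets_at_top UNIV)"
    using f g by (intro tendsto_add) (auto simp: is_zak_def)
  then have lim: "((\<lambda>A. l2_dist N (zak_part A f) F + l2_dist N (zak_part A g) G) \<longlongrightarrow> 0) (finite_subsets_at_top UNIV)"
    by simp
  show "((\<lambda>A. l2_norm N (\<lambda>p. zak_part A (\<lambda>x. f x + g x) p - (F p + G p))) \<longlongrightarrow> 0) (finite_subsets_at_top UNIV)"
  proof (rule Lim_null_comparison[OF _ lim])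
    show "\<forall>\<^sub>F A in finite_subsets_at_top UNIV. norm (l2_norm N (\<lambda>p. zak_part A (\<lambda>x. f x + g x) p - (F p + G p)))
        \<le> l2_dist N (zak_part A f) F + l2_dist N (zak_part A g) G"
      using finite_subsets_finite
    proof eventually_elim
      case (elim A)
      have "l2_norm N (\<lambda>p. (zak_part A f p - F p) + (zak_part A g p - G p))
        \<le> l2_dist N (zak_part A f) F + l2_dist N (zak_part A g) G"
        using elim f g by (intro l2_norm_add_le L2_diff zak_part_L2 is_zak_L2) auto
      then show ?case by (simp add: zak_part_add algebra_simps)
    qed
  qed
qed

lemma is_zak_scale:
  assumes "is_zak f F" shows "is_zak (\<lambda>x. c * f x) (\<lambda>p. c * F p)"
proof -
  have "((\<lambda>A. cmod c * l2_dist N (zak_part A f) F) \<longlongrightarrow> cmod c * 0) (finite_subsets_at_top UNIV)"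
    using assms by (intro tendsto_mult tendsto_const) (simp add: is_zak_def)
  then show ?thesis
    using assms L2_scale[OF is_zak_L2[OF assms]]
    by (simp add: is_zak_def zak_part_scale right_diff_distrib[symmetric] l2_norm_scale)
qed

lemma is_zak_unique:
  assumes f: "f \<in> L2 M" and F: "is_zak f F" "is_zak f G"
  shows "AE p in N. F p = G p"
proof -
  have "((\<lambda>A. l2_dist N (zak_part A f) F + l2_dist N (zak_part A f) G) \<longlongrightarrow> 0 + 0) (finite_subsets_at_top UNIV)"
    using F by (intro tendsto_add) (auto simp: is_zak_def)
  moreover have "\<forall>\<^sub>F A in finite_subsets_at_top UNIV. l2_dist N F G
      \<le> l2_dist N (zak_part A f) F + l2_dist N (zak_part A f) G"
    using finite_subsets_finite
  proof eventually_elim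
    case (elim A)
    then show ?case
      using l2_norm_triangle[OF is_zak_L2[OF F(1)] zak_part_L2[OF f elim] is_zak_L2[OF F(2)]]
      by (simp add: l2_norm_minus_commute[of N F])
  qed
  ultimately have "l2_dist N F G \<le> 0 + 0"
    by (rule tendsto_lowerbound) simp
  then have "l2_dist N F G = 0" by (simp add: antisym)
  then have "AE p in N. F p - G p = 0"
    using l2_norm_eq_0_iff[OF L2_diff[OF is_zak_L2[OF F(1)] is_zak_L2[OF F(2)]]] by simp
  then show ?thesis by eventually_elim simp
qed

lemma is_zak_norm:
  assumes f: "f \<in> L2 M" and F: "is_zak f F"
  shows "l2_norm N F = l2_norm M f"
proof -
  \<comment> \<open>Initial segments of the enumeration are cofinal among finite subsets, so the net
    limit may be evaluated along a sequence and compared with \<open>tile_norm_sums\<close>.\<close>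
  have fl: "filterlim (\<lambda>n. from_nat ` {..<n} :: 'g set) (finite_subsets_at_top UNIV) sequentially"
    unfolding filterlim_iff eventually_finite_subsets_at_top
  proof safe
    fix Q and A :: "'g set" assume A: "finite A" "\<forall>B. finite B \<and> A \<subseteq> B \<and> B \<subseteq> UNIV \<longrightarrow> Q B"
    have "Q (from_nat ` {..<n})" if "n \<ge> Suc (Max (insert 0 (to_nat ` A)))" for n
    proof (intro A(2)[rule_format] conjI subsetI)
      fix a assume "a \<in> A"
      then have "to_nat a \<le> Max (insert 0 (to_nat ` A))" using A(1) by (intro Max_ge) auto
      then have "to_nat a < n" using that by simp
      then show "a \<in> from_nat ` {..<n}" by (intro image_eqI[of _ _ "to_nat a"]) auto
    qed simp_all
    then show "\<forall>\<^sub>F n in sequentially. Q (from_nat ` {..<n})"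
      by (rule eventually_sequentiallyI)
  qed
  have lim: "(\<lambda>n. l2_dist N (zak_part (from_nat ` {..<n}) f) F) \<longlonglongrightarrow> 0"
    using F fl unfolding is_zak_def by (auto intro: filterlim_compose)
  have "(\<lambda>n. l2_norm N (zak_part (from_nat ` {..<n}) f)) \<longlonglongrightarrow> l2_norm N F"
  proof (rule LIM_zero_cancel, rule Lim_null_comparison[OF _ lim], intro always_eventually allI)
    fix n
    show "norm (l2_norm N (zak_part (from_nat ` {..<n}) f) - l2_norm N F) \<le> l2_dist N (zak_part (from_nat ` {..<n}) f) F"
      using l2_norm_diff_abs[OF zak_part_L2[OF f] is_zak_L2[OF F]] by simp
  qed
  then have "(\<lambda>n. (l2_norm N (zak_part (from_nat ` {..<n}) f))\<^sup>2) \<longlonglongrightarrow> (l2_norm N F)\<^sup>2"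
    by (intro tendsto_power)
  then have "(\<lambda>n. \<Sum>a\<in>from_nat ` {..<n}. tile_norm f a) \<longlonglongrightarrow> (l2_norm N F)\<^sup>2"
    by (simp add: zak_part_norm[OF f])
  from LIMSEQ_unique[OF this tile_norm_sums[OF f]] show ?thesis
    by (simp add: power2_eq_iff_nonneg)
qed

text \<open>Reindexing by a + d turns the partial sum of \<open>rep d f\<close> over
  \<open>A\<close> into \<open>ch d\<close> times the partial sum of \<open>f\<close> over the
  translate of \<open>A\<close>. Translation permutes the finite subsets and preserves the
  limit.\<close>

lemma is_zak_rep:
  assumes f: "f \<in> L2 M" and F: "is_zak f F"
  shows "is_zak (rep d f) (\<lambda>(w, x). ch d w * F (w, x))"
  unfolding is_zak_def
proof
  note [measurable] = L2_measurable[OF is_zak_L2[OF F]] L2_measurable[OF f]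
  show "(\<lambda>(w, x). ch d w * F (w, x)) \<in> L2 N"
    by (rule L2_bound[OF is_zak_L2[OF F], where B = 1]) (auto simp: norm_mult)
  have "filterlim (\<lambda>A. (\<lambda>a. a + d) ` A) (finite_subsets_at_top UNIV) (finite_subsets_at_top UNIV)"
    unfolding filterlim_def by (subst filtermap_image_finite_subsets_at_top) (auto simp: inj_on_def surj_plus_right)
  then have lim: "((\<lambda>A. l2_norm N (\<lambda>p. zak_part ((\<lambda>a. a + d) ` A) f p - F p)) \<longlongrightarrow> 0) (finite_subsets_at_top UNIV)"
    using F unfolding is_zak_def by (auto intro: filterlim_compose)
  have ae: "AE p in N. zak_part A (rep d f) p = ch d (fst p) * zak_part ((\<lambda>a. a + d) ` A) f p" for A
  proof -
    have "AE x in M. \<forall>a. rep a (rep d f) x = rep (a + d) f x"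
      by (subst AE_all_countable) (intro allI rep_rep)
    then have "AE x in M. zak_part A (rep d f) (w, x) = ch d (fst (w, x)) * zak_part ((\<lambda>a. a + d) ` A) f (w, x)" for w
    proof eventually_elim
      case e: (elim x)
      have "zak_part ((\<lambda>a. a + d) ` A) f (w, x) = (\<Sum>a\<in>A. (indicator C x * rep (a + d) f x) * cnj (ch (a + d) w))"
        unfolding zak_part_def case_prod_conv by (subst sum.reindex) (auto simp: inj_on_def)
      then have "ch d w * zak_part ((\<lambda>a. a + d) ` A) f (w, x)
          = (\<Sum>a\<in>A. (indicator C x * rep (a + d) f x) * (cnj (ch a w) * (ch d w * cnj (ch d w))))"
        by (simp add: sum_distrib_left ch_add mult_ac)
      then show ?case
        by (simp add: ch_cnj_mult zak_part_def e)
    qed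
    then show ?thesis
      by (intro N.AE_pair_measure) (auto simp: split_beta')
  qed
  have "l2_norm N (\<lambda>p. zak_part A (rep d f) p - (case p of (w, x) \<Rightarrow> ch d w * F (w, x)))
     = l2_norm N (\<lambda>p. zak_part ((\<lambda>a. a + d) ` A) f p - F p)" for A
  proof -
    have "l2_norm N (\<lambda>p. zak_part A (rep d f) p - (case p of (w, x) \<Rightarrow> ch d w * F (w, x)))
       = l2_norm N (\<lambda>p. ch d (fst p) * (zak_part ((\<lambda>a. a + d) ` A) f p - F p))"
    proof (rule l2_norm_cong_AE)
      show "AE p in N. zak_part A (rep d f) p - (case p of (w, x) \<Rightarrow> ch d w * F (w, x))
          = ch d (fst p) * (zak_part ((\<lambda>a. a + d) ` A) f p - F p)"
        using ae[of A] by eventually_elim (auto simp: split_beta' algebra_simps)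
    qed (simp_all add: split_beta')
    also have "\<dots> = l2_norm N (\<lambda>p. zak_part ((\<lambda>a. a + d) ` A) f p - F p)"
      by (simp add: l2_norm_def norm_mult)
    finally show ?thesis .
  qed
  then show "((\<lambda>A. l2_norm N (\<lambda>p. zak_part A (rep d f) p - (case p of (w, x) \<Rightarrow> ch d w * F (w, x)))) \<longlongrightarrow> 0) (finite_subsets_at_top UNIV)"
    using lim by simp
qed

end

section \<open>The Zak transform as a linear isometry, up to null sets\<close>

context zak_action
begin

definition zak :: "('a \<Rightarrow> complex) \<Rightarrow> 'w \<times> 'a \<Rightarrow> complex" where
  "zak f = (SOME F. is_zak f F)"

lemma is_zak_zak: "f \<in> L2 M \<Longrightarrow> is_zak f (zak f)"
  unfolding zak_def by (rule someI_ex[OF is_zak_exists])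

lemma zak_L2: "f \<in> L2 M \<Longrightarrow> zak f \<in> L2 N"
  by (rule is_zak_L2[OF is_zak_zak])

lemma zak_add:
  assumes "f \<in> L2 M" "g \<in> L2 M"
  shows "AE p in N. zak (\<lambda>x. f x + g x) p = zak f p + zak g p"
  by (rule is_zak_unique[OF L2_add[OF assms] is_zak_zak[OF L2_add[OF assms]]
        is_zak_add[OF assms(1) is_zak_zak[OF assms(1)] assms(2) is_zak_zak[OF assms(2)]]])

lemma zak_scale:
  assumes "f \<in> L2 M" shows "AE p in N. zak (\<lambda>x. c * f x) p = c * zak f p"
  by (rule is_zak_unique[OF L2_scale[OF assms] is_zak_zak[OF L2_scale[OF assms]] is_zak_scale[OF is_zak_zak[OF assms]]])

lemma zak_zero: "AE p in N. zak (\<lambda>x. 0) p = 0"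
  using zak_scale[OF L2_zero, of 0] by simp

lemma zak_diff:
  assumes "f \<in> L2 M" "g \<in> L2 M"
  shows "AE p in N. zak (\<lambda>x. f x - g x) p = zak f p - zak g p"
  using zak_add[OF assms(1) L2_scale[OF assms(2)], of "-1"] zak_scale[OF assms(2), of "-1"]
  by eventually_elim simp

lemma zak_rep:
  assumes "f \<in> L2 M" shows "AE p in N. zak (rep d f) p = ch d (fst p) * zak f p"
  using is_zak_unique[OF rep_L2[OF assms] is_zak_zak[OF rep_L2[OF assms]] is_zak_rep[OF assms is_zak_zak[OF assms]]]
  by (simp add: split_beta')

lemma zak_norm: "f \<in> L2 M \<Longrightarrow> l2_norm N (zak f) = l2_norm M f"
  by (rule is_zak_norm[OF _ is_zak_zak])

lemma zak_norm_diff: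
  assumes f: "f \<in> L2 M" and g: "g \<in> L2 M"
  shows "l2_dist N (zak f) (zak g) = l2_dist M f g"
proof -
  have "l2_dist N (zak f) (zak g) = l2_norm N (zak (\<lambda>x. f x - g x))"
    using zak_diff[OF f g] zak_L2[OF f] zak_L2[OF g] zak_L2[OF L2_diff[OF f g]]
    by (intro l2_norm_cong_AE) (auto simp: L2_def)
  then show ?thesis by (simp add: zak_norm[OF L2_diff[OF f g]])
qed

lemma zak_sum:
  assumes "finite I" "\<And>i. i \<in> I \<Longrightarrow> f i \<in> L2 M"
  shows "AE p in N. zak (\<lambda>x. \<Sum>i\<in>I. f i x) p = (\<Sum>i\<in>I. zak (f i) p)"
  using assms
proof (induction I)
  case empty
  then show ?case using zak_zero by simp
next
  case (insert i I)
  have "AE p in N. zak (\<lambda>x. f i x + (\<Sum>i\<in>I. f i x)) p = zak (f i) p + zak (\<lambda>x. \<Sum>i\<in>I. f i x) p"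
    by (intro zak_add L2_sum) (use insert in auto)
  moreover have "AE p in N. zak (\<lambda>x. \<Sum>i\<in>I. f i x) p = (\<Sum>i\<in>I. zak (f i) p)"
    using insert by auto
  ultimately show ?case
  proof eventually_elim
    case (elim p)
    then show ?case using insert.hyps by simp
  qed
qed

section \<open>Multipliers of an invariant space\<close>

abbreviation fibre_mult :: "('w \<Rightarrow> complex) \<Rightarrow> ('w \<times> 'a \<Rightarrow> complex) \<Rightarrow> 'w \<times> 'a \<Rightarrow> complex" where
  "fibre_mult a F \<equiv> \<lambda>p. a (fst p) * F p"

lemma L2_multiplier:
  assumes [measurable]: "a \<in> borel_measurable P" and B: "\<And>w. w \<in> space P \<Longrightarrow> cmod (a w) \<le> B" and F: "F \<in> L2 N"
  shows "(\<lambda>p. a (fst p) * F p) \<in> L2 N"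
proof (rule L2_bound[OF F, where B = B])
  note [measurable] = L2_measurable[OF F]
  show "(\<lambda>p. a (fst p) * F p) \<in> borel_measurable N" by simp
  show "AE p in N. cmod (a (fst p) * F p) \<le> B * cmod (F p)"
    by (rule AE_I2) (auto simp: norm_mult space_pair_measure intro!: mult_right_mono B)
qed

text \<open>Multiplying a transform by a bounded function yields an element of \<open>L2 N\<close>
  that need not be a transform a priori; the definition demands that it be one, of an element of
  \<open>V\<close>.\<close>

definition multipliers :: "('a \<Rightarrow> complex) set \<Rightarrow> ('w \<Rightarrow> complex) set" where
  "multipliers V = {a \<in> borel_measurable P. (\<exists>B. \<forall>w\<in>space P. cmod (a w) \<le> B) \<and>
     (\<forall>f\<in>V. \<exists>g\<in>V. AE p in N. zak g p = a (fst p) * zak f p)}"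

lemma multipliers_cong:
  assumes "a \<in> multipliers V" "\<And>w. w \<in> space P \<Longrightarrow> a w = b w"
  shows "b \<in> multipliers V"
proof -
  have a: "a \<in> borel_measurable P" "\<exists>B. \<forall>w\<in>space P. cmod (a w) \<le> B"
    "\<And>f. f \<in> V \<Longrightarrow> \<exists>g\<in>V. AE p in N. zak g p = a (fst p) * zak f p"
    using assms(1) by (auto simp: multipliers_def)
  have "b \<in> borel_measurable P"
    using a(1) assms(2) by (subst measurable_cong[of P b a]) auto
  moreover have "\<exists>B. \<forall>w\<in>space P. cmod (b w) \<le> B" using a(2) assms(2) by auto
  moreover have "\<exists>g\<in>V. AE p in N. zak g p = b (fst p) * zak f p" if f: "f \<in> V" for f
  proof -
    obtain g where g: "g \<in> V" "AE p in N. zak g p = a (fst p) * zak f p" using a(3)[OF f] by blast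
    have "AE p in N. zak g p = b (fst p) * zak f p"
      using g(2) AE_space
    proof eventually_elim
      case (elim p)
      then show ?case using assms(2)[of "fst p"] by (auto simp: space_pair_measure)
    qed
    with g(1) show ?thesis by blast
  qed
  ultimately show ?thesis by (auto simp: multipliers_def)
qed

context
  fixes V :: "('a \<Rightarrow> complex) set"
  assumes inv: "invariant_subspace M \<sigma> J V"
begin

lemma V_closed: "closed_l2_subspace M V"
  using inv by (simp add: invariant_subspace_def)

lemma V_L2: "f \<in> V \<Longrightarrow> f \<in> L2 M"
  using closed_l2_subspaceD(1)[OF V_closed] by auto

lemma multipliers_const: "(\<lambda>w. c) \<in> multipliers V"
  unfolding multipliers_def
proof (intro CollectI conjI ballI)
  fix f assume f: "f \<in> V"
  show "\<exists>g\<in>V. AE p in N. zak g p = c * zak f p"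
    using zak_scale[OF V_L2[OF f], of c] closed_l2_subspaceD(4)[OF V_closed f, of c] by blast
qed auto

lemma multipliers_ch: "ch a \<in> multipliers V"
  unfolding multipliers_def
proof (intro CollectI conjI ballI)
  fix f assume f: "f \<in> V"
  show "\<exists>g\<in>V. AE p in N. zak g p = ch a (fst p) * zak f p"
    using zak_rep[OF V_L2[OF f], of a] inv f by (intro bexI[of _ "rep a f"]) (auto simp: invariant_subspace_def)
qed (auto intro!: exI[of _ 1])

lemma multipliers_add:
  assumes a: "a \<in> multipliers V" and b: "b \<in> multipliers V"
  shows "(\<lambda>w. a w + b w) \<in> multipliers V"
  unfolding multipliers_def
proof (intro CollectI conjI ballI)
  have [measurable]: "a \<in> borel_measurable P" "b \<in> borel_measurable P"
    using a b by (auto simp: multipliers_def)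
  show "(\<lambda>w. a w + b w) \<in> borel_measurable P" by simp
  obtain A B where "\<forall>w\<in>space P. cmod (a w) \<le> A" "\<forall>w\<in>space P. cmod (b w) \<le> B"
    using a b unfolding multipliers_def by blast
  then have "\<forall>w\<in>space P. cmod (a w + b w) \<le> A + B"
    by (auto intro!: order_trans[OF norm_triangle_ineq] add_mono)
  then show "\<exists>B. \<forall>w\<in>space P. cmod (a w + b w) \<le> B" by blast
  fix f assume f: "f \<in> V"
  obtain g where g: "g \<in> V" "AE p in N. zak g p = a (fst p) * zak f p"
    using a f by (auto simp: multipliers_def)
  obtain h where h: "h \<in> V" "AE p in N. zak h p = b (fst p) * zak f p"
    using b f by (auto simp: multipliers_def)
  have "AE p in N. zak (\<lambda>x. g x + h x) p = (a (fst p) + b (fst p)) * zak f p"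
    using zak_add[OF V_L2[OF g(1)] V_L2[OF h(1)]] g(2) h(2) by eventually_elim (simp add: algebra_simps)
  then show "\<exists>g\<in>V. AE p in N. zak g p = (a (fst p) + b (fst p)) * zak f p"
    using closed_l2_subspaceD(3)[OF V_closed g(1) h(1)] by blast
qed

lemma multipliers_mult:
  assumes a: "a \<in> multipliers V" and b: "b \<in> multipliers V"
  shows "(\<lambda>w. a w * b w) \<in> multipliers V"
  unfolding multipliers_def
proof (intro CollectI conjI ballI)
  have [measurable]: "a \<in> borel_measurable P" "b \<in> borel_measurable P"
    using a b by (auto simp: multipliers_def)
  show "(\<lambda>w. a w * b w) \<in> borel_measurable P" by simp
  obtain A B where AB: "\<forall>w\<in>space P. cmod (a w) \<le> A" "\<forall>w\<in>space P. cmod (b w) \<le> B"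
    using a b unfolding multipliers_def by blast
  have "cmod (a w * b w) \<le> A * B" if "w \<in> space P" for w
    unfolding norm_mult
    using AB[THEN bspec, OF that] order_trans[OF norm_ge_zero AB(1)[THEN bspec, OF that]] by (intro mult_mono) auto
  then show "\<exists>B. \<forall>w\<in>space P. cmod (a w * b w) \<le> B" by blast
  fix f assume f: "f \<in> V"
  obtain g where g: "g \<in> V" "AE p in N. zak g p = b (fst p) * zak f p"
    using b f by (auto simp: multipliers_def)
  obtain h where h: "h \<in> V" "AE p in N. zak h p = a (fst p) * zak g p"
    using a g(1) by (auto simp: multipliers_def)
  have "AE p in N. zak h p = (a (fst p) * b (fst p)) * zak f p"
    using g(2) h(2) by eventually_elim simp
  then show "\<exists>g\<in>V. AE p in N. zak g p = (a (fst p) * b (fst p)) * zak f p"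
    using h(1) by blast
qed

lemma multipliers_sum:
  "finite I \<Longrightarrow> (\<And>i. i \<in> I \<Longrightarrow> a i \<in> multipliers V) \<Longrightarrow> (\<lambda>w. \<Sum>i\<in>I. a i w) \<in> multipliers V"
  by (induction I rule: finite_induct) (simp_all add: multipliers_const multipliers_add)

text \<open>Dominated convergence makes the products converge in \<open>L2 N\<close>. Isometry
  transfers the Cauchy property to the preimages in \<open>V\<close>, and completeness and
  closedness supply the preimage of the limit.\<close>

lemma multipliers_limit:
  assumes a: "\<And>n. a n \<in> multipliers V"
    and B: "\<And>n w. w \<in> space P \<Longrightarrow> cmod (a n w) \<le> B"
    and lim: "\<And>w. w \<in> space P \<Longrightarrow> (\<lambda>n. a n w) \<longlonglongrightarrow> b w"
  shows "b \<in> multipliers V"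
  unfolding multipliers_def
proof (intro CollectI conjI ballI)
  have [measurable]: "a n \<in> borel_measurable P" for n
    using a by (auto simp: multipliers_def)
  show bm [measurable]: "b \<in> borel_measurable P"
    by (rule borel_measurable_LIMSEQ_metric[OF _ lim]) simp
  have bB: "cmod (b w) \<le> B" if "w \<in> space P" for w
    using tendsto_norm[OF lim[OF that]] B[OF that] by (intro LIMSEQ_le_const2) auto
  then show "\<exists>B. \<forall>w\<in>space P. cmod (b w) \<le> B" by blast
  fix f assume f: "f \<in> V"
  define F where "F = zak f"
  have FL: "F \<in> L2 N" unfolding F_def by (rule zak_L2[OF V_L2[OF f]])
  note [measurable] = L2_measurable[OF FL]
  have "\<forall>n. \<exists>g. g \<in> V \<and> (AE p in N. zak g p = fibre_mult (a n) F p)"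
    using a f unfolding F_def multipliers_def by blast
  then obtain g where gV: "\<And>n. g n \<in> V" and g: "\<And>n. AE p in N. zak (g n) p = fibre_mult (a n) F p" by metis
  have bL: "fibre_mult b F \<in> L2 N" by (rule L2_multiplier[OF _ bB FL]) auto
  have eq: "l2_dist N (zak (g n)) h = l2_dist N (fibre_mult (a n) F) h"
    if "h \<in> borel_measurable N" for n h
    using g[of n] L2_measurable[OF zak_L2[OF V_L2[OF gV[of n]]]] that
    by (intro l2_norm_cong_AE) auto
  have "(\<lambda>n. LINT p|N. (cmod (fibre_mult (a n) F p - fibre_mult b F p))\<^sup>2) \<longlonglongrightarrow> (LINT p|N. 0)"
  proof (rule integral_dominated_convergence[where w = "\<lambda>p. (2 * B)\<^sup>2 * (cmod (F p))\<^sup>2"])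
    show "integrable N (\<lambda>p. (2 * B)\<^sup>2 * (cmod (F p))\<^sup>2)" using L2_integrable[OF FL] by simp
    show "AE p in N. (\<lambda>n. (cmod (fibre_mult (a n) F p - fibre_mult b F p))\<^sup>2) \<longlonglongrightarrow> 0"
    proof (rule AE_I2)
      fix p assume "p \<in> space N"
      then have w: "fst p \<in> space P" by (auto simp: space_pair_measure)
      have "(\<lambda>n. (cmod (fibre_mult (a n) F p - fibre_mult b F p))\<^sup>2) \<longlonglongrightarrow> (cmod (fibre_mult b F p - fibre_mult b F p))\<^sup>2"
        by (intro tendsto_intros lim[OF w])
      then show "(\<lambda>n. (cmod (fibre_mult (a n) F p - fibre_mult b F p))\<^sup>2) \<longlonglongrightarrow> 0" by simp
    qed
    show "AE p in N. norm ((cmod (fibre_mult (a n) F p - fibre_mult b F p))\<^sup>2) \<le> (2 * B)\<^sup>2 * (cmod (F p))\<^sup>2" for n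
    proof (rule AE_I2)
      fix p assume "p \<in> space N"
      then have w: "fst p \<in> space P" by (auto simp: space_pair_measure)
      have "cmod (a n (fst p) - b (fst p)) \<le> 2 * B"
        using norm_triangle_ineq4[of "a n (fst p)" "b (fst p)"] B[OF w, of n] bB[OF w] by linarith
      then have "(cmod (a n (fst p) - b (fst p)))\<^sup>2 * (cmod (F p))\<^sup>2 \<le> (2 * B)\<^sup>2 * (cmod (F p))\<^sup>2"
        by (intro mult_right_mono power_mono) auto
      then show "norm ((cmod (fibre_mult (a n) F p - fibre_mult b F p))\<^sup>2) \<le> (2 * B)\<^sup>2 * (cmod (F p))\<^sup>2"
        by (simp add: norm_mult power_mult_distrib flip: left_diff_distrib)
    qed
  qed simp_all
  then have "(\<lambda>n. (l2_dist N (fibre_mult (a n) F) (fibre_mult b F))\<^sup>2) \<longlonglongrightarrow> 0"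
    by (simp add: l2_norm_sq)
  then have "(\<lambda>n. sqrt ((l2_dist N (fibre_mult (a n) F) (fibre_mult b F))\<^sup>2)) \<longlonglongrightarrow> sqrt 0"
    by (rule tendsto_real_sqrt)
  then have "(\<lambda>n. l2_dist N (fibre_mult (a n) F) (fibre_mult b F)) \<longlonglongrightarrow> 0" by simp
  then have l1: "(\<lambda>n. l2_dist N (zak (g n)) (fibre_mult b F)) \<longlonglongrightarrow> 0"
    by (subst eq) auto
  have "\<exists>h\<in>L2 M. (\<lambda>n. l2_dist M (g n) h) \<longlonglongrightarrow> 0"
  proof (rule L2_complete[OF V_L2[OF gV]])
    fix e :: real assume e: "e > 0"
    then have "\<forall>\<^sub>F n in sequentially. l2_dist N (zak (g n)) (fibre_mult b F) < e / 2"
      using l1 by (intro order_tendstoD) auto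
    then obtain n0 where n0: "\<And>n. n \<ge> n0 \<Longrightarrow> l2_dist N (zak (g n)) (fibre_mult b F) < e / 2"
      by (auto simp: eventually_sequentially)
    show "\<exists>n0. \<forall>m\<ge>n0. \<forall>n\<ge>n0. l2_dist M (g m) (g n) < e"
    proof (intro exI[of _ n0] allI impI)
      fix m n assume mn: "n0 \<le> m" "n0 \<le> n"
      have "l2_dist N (zak (g m)) (zak (g n))
          \<le> l2_dist N (zak (g m)) (fibre_mult b F) + l2_dist N (fibre_mult b F) (zak (g n))"
        by (intro l2_norm_triangle zak_L2 V_L2 gV bL)
      also have "l2_dist N (fibre_mult b F) (zak (g n)) = l2_dist N (zak (g n)) (fibre_mult b F)"
        by (rule l2_norm_minus_commute)
      also have "l2_dist N (zak (g m)) (fibre_mult b F) + \<dots> < e"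
        using n0[OF mn(1)] n0[OF mn(2)] by simp
      finally show "l2_dist M (g m) (g n) < e" by (simp add: zak_norm_diff[OF V_L2[OF gV] V_L2[OF gV]])
    qed
  qed
  then obtain h where h: "h \<in> L2 M" "(\<lambda>n. l2_dist M (g n) h) \<longlonglongrightarrow> 0" by blast
  have hV: "h \<in> V" by (rule closed_l2_subspaceD(6)[OF V_closed gV h])
  have "(\<lambda>n. l2_dist M (g n) h + l2_dist N (zak (g n)) (fibre_mult b F)) \<longlonglongrightarrow> 0 + 0"
    by (intro tendsto_add h l1)
  moreover have "l2_dist N (zak h) (fibre_mult b F) \<le> l2_dist M (g n) h + l2_dist N (zak (g n)) (fibre_mult b F)" for n
    using l2_norm_triangle[OF zak_L2[OF h(1)] zak_L2[OF V_L2[OF gV]] bL, of n]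
      zak_norm_diff[OF V_L2[OF gV] h(1), of n] l2_norm_minus_commute[of N "zak h" "zak (g n)"] by simp
  ultimately have "l2_dist N (zak h) (fibre_mult b F) \<le> 0 + 0"
    by (intro LIMSEQ_le_const) auto
  then have "l2_dist N (zak h) (fibre_mult b F) = 0" by (simp add: antisym)
  then have "AE p in N. zak h p - fibre_mult b F p = 0"
    using l2_norm_eq_0_iff[OF L2_diff[OF zak_L2[OF h(1)] bL]] by simp
  then have "AE p in N. zak h p = b (fst p) * zak f p"
    by eventually_elim (simp add: F_def)
  with hV show "\<exists>g\<in>V. AE p in N. zak g p = b (fst p) * zak f p" by blast
qed

text \<open>Multipliers form an algebra, so polynomials in \<open>r\<close> belong to them;
  Weierstrass approximation on \<open>{-1..1}\<close> then exhibits \<open>h\<close> as a bounded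
  pointwise limit.\<close>

lemma multipliers_continuous:
  assumes r: "(\<lambda>w. complex_of_real (r w)) \<in> multipliers V" and r1: "\<And>w. \<bar>r w\<bar> \<le> 1"
    and h: "continuous_on {-1..1} (h :: real \<Rightarrow> real)"
  shows "(\<lambda>w. complex_of_real (h (r w))) \<in> multipliers V"
proof -
  have pol: "(\<lambda>w. complex_of_real (g (r w))) \<in> multipliers V" if "real_polynomial_function g" for g
    using that
  proof induction
    case (linear f)
    then obtain c where "f = (\<lambda>x. x * c)" by (auto simp: real_bounded_linear)
    then show ?case using multipliers_mult[OF r multipliers_const[of "complex_of_real c"]] by simp
  next
    case (const c)
    then show ?case by (rule multipliers_const)
  next
    case (add f g)
    then show ?case using multipliers_add by simp
  next
    case (mult f g)
    then show ?case using multipliers_mult by simp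
  qed
  have "\<exists>g. real_polynomial_function g \<and> (\<forall>x\<in>{-1..1}. \<bar>h x - g x\<bar> < 1 / real (Suc n))" for n
    using Stone_Weierstrass_real_polynomial_function[OF compact_Icc h, of "1 / real (Suc n)"]
    by (metis of_nat_0_less_iff zero_less_Suc zero_less_divide_1_iff)
  then obtain g where g: "\<And>n. real_polynomial_function (g n)"
    and gh: "\<And>n x. x \<in> {-1..1} \<Longrightarrow> \<bar>h x - g n x\<bar> < 1 / real (Suc n)" by metis
  have "compact (h ` {-1..1})" by (rule compact_continuous_image[OF h compact_Icc])
  then obtain B where B': "\<forall>x\<in>{-1..1}. \<bar>h x\<bar> \<le> B"
    using compact_imp_bounded[of "h ` {-1..1}"] by (auto simp: bounded_iff)
  note B = B'[rule_format]
  have rw: "r w \<in> {-1..1}" for w using r1[of w] by (auto simp: abs_le_iff)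
  show ?thesis
  proof (rule multipliers_limit[where a = "\<lambda>n w. complex_of_real (g n (r w))" and B = "B + 1"])
    show "(\<lambda>w. complex_of_real (g n (r w))) \<in> multipliers V" for n by (rule pol[OF g])
    show "cmod (complex_of_real (g n (r w))) \<le> B + 1" for n w
    proof -
      have "\<bar>h (r w) - g n (r w)\<bar> \<le> 1"
        by (rule order_trans[OF less_imp_le[OF gh[OF rw]]]) simp
      moreover have "\<bar>h (r w)\<bar> \<le> B" by (rule B[OF rw])
      ultimately show ?thesis unfolding norm_of_real by linarith
    qed
    show "(\<lambda>n. complex_of_real (g n (r w))) \<longlonglongrightarrow> complex_of_real (h (r w))" for w
    proof (rule tendsto_of_real, rule LIM_zero_cancel)
      show "(\<lambda>n. g n (r w) - h (r w)) \<longlonglongrightarrow> 0"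
      proof (rule Lim_null_comparison[OF always_eventually])
        show "\<forall>n. norm (g n (r w) - h (r w)) \<le> 1 / real (Suc n)"
          unfolding real_norm_def by (subst abs_minus_commute) (intro allI less_imp_le gh rw)
        show "(\<lambda>n. 1 / real (Suc n)) \<longlonglongrightarrow> 0" using LIMSEQ_inverse_real_of_nat by (simp add: inverse_eq_divide)
      qed
    qed
  qed
qed

text \<open>The clipped ramps min 1 (n max 0 (t - r)) are continuous in r, bounded by 1, and tend
  pointwise to the indicator of r < t.\<close>

lemma multipliers_indicator_less:
  assumes r: "(\<lambda>w. complex_of_real (r w)) \<in> multipliers V" and r1: "\<And>w. \<bar>r w\<bar> \<le> 1"
  shows "(\<lambda>w. if r w < t then 1 else 0) \<in> multipliers V"
proof -
  let ?m = "\<lambda>n w. complex_of_real (min 1 (real n * max 0 (t - r w)))"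
  show ?thesis
  proof (rule multipliers_limit[where a = ?m and B = 1])
    show "?m n \<in> multipliers V" for n
      by (rule multipliers_continuous[OF r r1]) (intro continuous_intros)
    show "cmod (?m n w) \<le> 1" for n w
      by (simp add: abs_le_iff min_def)
    show "(\<lambda>n. ?m n w) \<longlonglongrightarrow> (if r w < t then 1 else 0)" for w
    proof (cases "r w < t")
      case True
      obtain n0 where n0: "1 / (t - r w) \<le> real n0" using real_arch_simple by blast
      have "?m n w = 1" if "n \<ge> n0" for n
      proof -
        have "1 / (t - r w) \<le> real n" using n0 that by linarith
        then have "1 \<le> real n * (t - r w)" using True by (simp add: field_simps)
        then show ?thesis using True by simp
      qed
      then have "\<forall>\<^sub>F n in sequentially. ?m n w = 1"
        by (rule eventually_sequentiallyI)
      then show ?thesis using True by (simp add: tendsto_eventually)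
    qed simp
  qed
qed

section \<open>From characters to all bounded measurable multipliers\<close>

definition mult_sets :: "'w set set" where
  "mult_sets = {E \<in> sets P. (indicator E :: 'w \<Rightarrow> complex) \<in> multipliers V}"

lemma sigma_algebra_mult_sets: "sigma_algebra (space P) mult_sets"
  unfolding sigma_algebra_iff2
proof (intro conjI ballI allI impI)
  show "mult_sets \<subseteq> Pow (space P)" using sets.space_closed by (auto simp: mult_sets_def)
  have "(indicator {} :: 'w \<Rightarrow> complex) = (\<lambda>w. 0)" by auto
  then show "{} \<in> mult_sets" using multipliers_const[of 0] by (simp add: mult_sets_def)
  have compl: "space P - E \<in> mult_sets" if E: "E \<in> mult_sets" for E
  proof -
    have "(\<lambda>w. 1 + -1 * indicator E w) \<in> multipliers V"
      using E by (intro multipliers_add multipliers_mult multipliers_const) (simp add: mult_sets_def)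
    then have "(indicator (space P - E) :: 'w \<Rightarrow> complex) \<in> multipliers V"
      by (rule multipliers_cong) (auto simp: indicator_def)
    then show ?thesis using E by (auto simp: mult_sets_def)
  qed
  then show "\<And>E. E \<in> mult_sets \<Longrightarrow> space P - E \<in> mult_sets" .
  have inter: "E \<inter> F \<in> mult_sets" if "E \<in> mult_sets" "F \<in> mult_sets" for E F
  proof -
    have "(\<lambda>w. indicator E w * indicator F w) \<in> multipliers V"
      using that by (intro multipliers_mult) (auto simp: mult_sets_def)
    then have "(indicator (E \<inter> F) :: 'w \<Rightarrow> complex) \<in> multipliers V"
      by (rule multipliers_cong) (auto simp: indicator_def)
    then show ?thesis using that by (auto simp: mult_sets_def)
  qed
  have union: "E \<union> F \<in> mult_sets" if EF: "E \<in> mult_sets" "F \<in> mult_sets" for E F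
  proof -
    have "E \<union> F = space P - ((space P - E) \<inter> (space P - F))"
      using EF sets.sets_into_space by (fastforce simp: mult_sets_def)
    then show ?thesis using compl inter EF by metis
  qed
  fix A :: "nat \<Rightarrow> 'w set" assume A: "range A \<subseteq> mult_sets"
  have fin: "(\<Union>i<n. A i) \<in> mult_sets" for n
  proof (induction n)
    case 0
    then show ?case using \<open>{} \<in> mult_sets\<close> by simp
  next
    case (Suc n)
    then show ?case using union[of "A n"] A by (auto simp: lessThan_Suc)
  qed
  have "(indicator (\<Union>i. A i) :: 'w \<Rightarrow> complex) \<in> multipliers V"
  proof (rule multipliers_limit[where a = "\<lambda>n. indicator (\<Union>i<n. A i)" and B = 1])
    show "(indicator (\<Union>i<n. A i) :: 'w \<Rightarrow> complex) \<in> multipliers V" for n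
      using fin[of n] by (simp add: mult_sets_def)
    show "(\<lambda>n. indicator (\<Union>i<n. A i) w :: complex) \<longlonglongrightarrow> indicator (\<Union>i. A i) w" for w
      by (rule LIMSEQ_indicator_UN)
  qed (auto simp: indicator_def)
  moreover have "(\<Union>i. A i) \<in> sets P" using A by (auto simp: mult_sets_def)
  ultimately show "(\<Union>i. A i) \<in> mult_sets" by (simp add: mult_sets_def)
qed

text \<open>Sublevel sets of the real and imaginary parts of the characters lie in
  \<open>mult_sets\<close>, so the characters are measurable for this sigma-algebra; the generation
  property then forces it to contain every set of \<open>P\<close>.\<close>

lemma sets_mult_sets: "sets P \<subseteq> mult_sets"
proof -
  define D where "D = sigma (space P) mult_sets"
  have sD: "space D = space P" "sets D = mult_sets"
    unfolding D_def using sigma_algebra.sigma_sets_eq[OF sigma_algebra_mult_sets] sets.space_closed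
    by (auto simp: mult_sets_def space_measure_of_conv sets_measure_of_conv)
  have rm: "r \<in> borel_measurable D"
    if r: "(\<lambda>w. complex_of_real (r w)) \<in> multipliers V" and r1: "\<And>w. \<bar>r w\<bar> \<le> 1" for r
    unfolding borel_measurable_iff_less
  proof
    fix t
    have "(\<lambda>w. complex_of_real (r w)) \<in> borel_measurable P" using r by (simp add: multipliers_def)
    from measurable_compose[OF this borel_measurable_Re] have [measurable]: "r \<in> borel_measurable P" by simp
    have "{w \<in> space P. r w < t} \<in> sets P" by measurable
    moreover have "(indicator {w \<in> space P. r w < t} :: 'w \<Rightarrow> complex) \<in> multipliers V"
      by (rule multipliers_cong[OF multipliers_indicator_less[OF r r1, of t]]) (auto simp: indicator_def)
    ultimately show "{w \<in> space D. r w < t} \<in> sets D" by (simp add: sD mult_sets_def)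
  qed
  have "ch a \<in> borel_measurable D" for a
  proof (subst borel_measurable_complex_iff, intro conjI rm)
    \<comment> \<open>As \<open>ch (- a)\<close> is the conjugate of \<open>ch a\<close>, real and
      imaginary parts are linear combinations of characters and hence multipliers.\<close>
    have "(\<lambda>w. (1/2) * (ch a w + ch (- a) w)) \<in> multipliers V"
      by (intro multipliers_mult multipliers_add multipliers_const multipliers_ch)
    then show "(\<lambda>w. complex_of_real (Re (ch a w))) \<in> multipliers V"
      by (rule multipliers_cong) (auto simp: ch_minus complex_eq_iff)
    have "(\<lambda>w. (- \<i>/2) * (ch a w + -1 * ch (- a) w)) \<in> multipliers V"
      by (intro multipliers_mult multipliers_add multipliers_const multipliers_ch)
    then show "(\<lambda>w. complex_of_real (Im (ch a w))) \<in> multipliers V"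
      by (rule multipliers_cong) (auto simp: ch_minus complex_eq_iff)
    show "\<bar>Re (ch a w)\<bar> \<le> 1" "\<bar>Im (ch a w)\<bar> \<le> 1" for w
      using abs_Re_le_cmod[of "ch a w"] abs_Im_le_cmod[of "ch a w"] by auto
  qed
  from ch_generate[OF sD(1) this] show ?thesis by (simp add: sD)
qed

text \<open>Simple functions are combinations of indicator multipliers; the approximating sequence
  is dominated by twice the modulus of \<open>a\<close>, hence the bound \<open>2 * B\<close> in the
  limit argument.\<close>

theorem bounded_multiplier:
  assumes a: "a \<in> borel_measurable P" and B: "\<And>w. w \<in> space P \<Longrightarrow> cmod (a w) \<le> B" and f: "f \<in> V"
  shows "\<exists>g\<in>V. AE p in N. zak g p = a (fst p) * zak f p"
proof -
  obtain s where s: "\<And>i. simple_function P (s i)" "\<And>w. w \<in> space P \<Longrightarrow> (\<lambda>i. s i w) \<longlonglongrightarrow> a w"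
    "\<And>i w. w \<in> space P \<Longrightarrow> dist (s i w) 0 \<le> 2 * dist (a w) 0"
    using borel_measurable_implies_sequence_metric[OF a, of 0] by blast
  have ind: "(indicator E :: 'w \<Rightarrow> complex) \<in> multipliers V" if "E \<in> sets P" for E
    using that sets_mult_sets by (auto simp: mult_sets_def)
  have "a \<in> multipliers V"
  proof (rule multipliers_limit[OF _ _ s(2), where B = "2 * B"])
    show "s i \<in> multipliers V" for i
    proof (rule multipliers_cong)
      show "(\<lambda>w. \<Sum>y\<in>s i ` space P. indicator (s i -` {y} \<inter> space P) w * y) \<in> multipliers V"
      proof (rule multipliers_sum)
        show "finite (s i ` space P)" using s(1)[of i] by (simp add: simple_function_def)
        show "(\<lambda>w. indicator (s i -` {y} \<inter> space P) w * y) \<in> multipliers V" if "y \<in> s i ` space P" for y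
          using s(1)[of i] that by (intro multipliers_mult[OF ind multipliers_const]) (auto simp: simple_function_def)
      qed
      show "(\<Sum>y\<in>s i ` space P. indicator (s i -` {y} \<inter> space P) w * y) = s i w" if "w \<in> space P" for w
      proof -
        have eq: "indicator (s i -` {y} \<inter> space P) w * y = indicator (s i -` {y} \<inter> space P) w *\<^sub>R y" for y
          by (simp add: indicator_def)
        show ?thesis
          unfolding eq by (rule simple_function_indicator_representation_banach[OF s(1) that, symmetric])
      qed
    qed
    show "cmod (s i w) \<le> 2 * B" if "w \<in> space P" for i w
      using s(3)[OF that, of i] B[OF that] by simp
  qed
  then show ?thesis using f by (auto simp: multipliers_def)
qed

end

end

section \<open>Low-rank approximation in a fibre\<close>

definition fin_inner :: "'k set \<Rightarrow> ('k \<Rightarrow> complex) \<Rightarrow> ('k \<Rightarrow> complex) \<Rightarrow> complex" where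
  "fin_inner S v w = (\<Sum>k\<in>S. v k * cnj (w k))"

text \<open>The self-adjoint matrix I - v v^* applied to w: the projection orthogonal to
  \<open>v\<close> for a unit vector, the identity for \<open>v = 0\<close> on \<open>S\<close>.
  These are the two cases that \<open>deflate_normalised\<close> produces.\<close>

definition deflate :: "'k set \<Rightarrow> ('k \<Rightarrow> complex) \<Rightarrow> ('k \<Rightarrow> complex) \<Rightarrow> 'k \<Rightarrow> complex" where
  "deflate S v w k = w k - v k * fin_inner S w v"

lemma fin_inner_self: "fin_inner S v v = complex_of_real (\<Sum>k\<in>S. (cmod (v k))\<^sup>2)"
  by (simp only: fin_inner_def complex_norm_square of_real_sum)

lemma fin_inner_cnj: "cnj (fin_inner S v w) = fin_inner S w v"
  by (simp add: fin_inner_def mult.commute)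

lemma deflate_self_adjoint: "fin_inner S (deflate S v w) a = fin_inner S w (deflate S v a)"
proof -
  have "fin_inner S (deflate S v w) a = fin_inner S w a - fin_inner S w v * fin_inner S v a"
    by (simp add: fin_inner_def[of S _ a] deflate_def algebra_simps sum_subtractf sum_distrib_left)
  moreover have "fin_inner S w (deflate S v a) = fin_inner S w a - fin_inner S w v * cnj (fin_inner S a v)"
    by (simp add: fin_inner_def[of S w] deflate_def algebra_simps sum_subtractf sum_distrib_left)
  ultimately show ?thesis by (simp add: fin_inner_cnj)
qed

text \<open>With c the inner product of w and v, the new squared norm is |w|^2 - 2|c|^2 + |c|^2
  |v|^2, at most |w|^2 - |c|^2 when |v| \<le> 1.\<close>

lemma deflate_norm_le:
  assumes v: "(\<Sum>k\<in>S. (cmod (v k))\<^sup>2) \<le> 1"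
  shows "(\<Sum>k\<in>S. (cmod (deflate S v w k))\<^sup>2) \<le> (\<Sum>k\<in>S. (cmod (w k))\<^sup>2)"
proof -
  define c where "c = fin_inner S w v"
  have expand: "(\<Sum>k\<in>S. (w k - v k * c) * cnj (w k - v k * c))
      = fin_inner S w w - cnj c * fin_inner S w v - c * fin_inner S v w + c * cnj c * fin_inner S v v" for c
    unfolding fin_inner_def by (simp add: algebra_simps sum.distrib sum_subtractf sum_distrib_left)
  have "complex_of_real (\<Sum>k\<in>S. (cmod (deflate S v w k))\<^sup>2)
      = fin_inner S w w - cnj c * fin_inner S w v - c * fin_inner S v w + c * cnj c * fin_inner S v v"
    unfolding of_real_sum complex_norm_square deflate_def c_def by (rule expand)
  also have "\<dots> = complex_of_real ((\<Sum>k\<in>S. (cmod (w k))\<^sup>2) - 2 * (cmod c)\<^sup>2 + (cmod c)\<^sup>2 * (\<Sum>k\<in>S. (cmod (v k))\<^sup>2))"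
    unfolding fin_inner_self fin_inner_cnj[of S w v, symmetric] c_def[symmetric] of_real_add of_real_diff of_real_mult complex_norm_square
    by (simp add: mult.commute)
  finally have "(\<Sum>k\<in>S. (cmod (deflate S v w k))\<^sup>2)
      = (\<Sum>k\<in>S. (cmod (w k))\<^sup>2) - 2 * (cmod c)\<^sup>2 + (cmod c)\<^sup>2 * (\<Sum>k\<in>S. (cmod (v k))\<^sup>2)"
    by (simp only: of_real_eq_iff)
  moreover have "(cmod c)\<^sup>2 * (\<Sum>k\<in>S. (cmod (v k))\<^sup>2) \<le> (cmod c)\<^sup>2 * 1" by (intro mult_left_mono v) simp
  ultimately show ?thesis using zero_le_power2[of "cmod c"] by linarith
qed

text \<open>Vectors are indexed by \<open>S\<close>, so the \<open>\<phi> i\<close> are scalars for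
  the deflation and only the columns \<open>b i\<close> are transformed.\<close>

lemma deflate_diff_sum:
  "deflate S v (\<lambda>k. \<psi> k - (\<Sum>i\<in>I. b i k * \<phi> i)) j = deflate S v \<psi> j - (\<Sum>i\<in>I. deflate S v (b i) j * \<phi> i)"
proof -
  have *: "fin_inner S (\<lambda>k. \<psi> k - (\<Sum>i\<in>I. b i k * \<phi> i)) v = fin_inner S \<psi> v - (\<Sum>i\<in>I. fin_inner S (b i) v * \<phi> i)"
    unfolding fin_inner_def
    by (simp add: algebra_simps sum_subtractf sum_distrib_left sum.swap[of _ S])
  show ?thesis
    unfolding deflate_def * by (simp add: algebra_simps sum_subtractf sum_distrib_left sum.distrib)
qed

lemma deflate_normalised:
  assumes S: "finite S"
  shows "\<exists>v. (\<Sum>k\<in>S. (cmod (v k))\<^sup>2) \<le> 1 \<and> (\<forall>k\<in>S. deflate S v w k = 0)"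
proof -
  define q where "q = (\<Sum>k\<in>S. (cmod (w k))\<^sup>2)"
  \<comment> \<open>For \<open>w = 0\<close> on \<open>S\<close> the division by zero yields
    \<open>v = 0\<close> there, so \<open>q / q \<le> 1\<close> covers both cases.\<close>
  define v where "v k = w k / complex_of_real (sqrt q)" for k
  have q: "q \<ge> 0" by (simp add: q_def sum_nonneg)
  have "(\<Sum>k\<in>S. (cmod (v k))\<^sup>2) = q / q"
    using q by (simp add: v_def norm_divide power_divide q_def flip: sum_divide_distrib)
  moreover have "deflate S v w k = 0" if k: "k \<in> S" for k
  proof (cases "q = 0")
    case True
    then have "w k = 0" using S k by (simp add: q_def sum_nonneg_eq_0_iff)
    then show ?thesis by (simp add: deflate_def v_def)
  next
    case False
    have "fin_inner S w v = fin_inner S w w / complex_of_real (sqrt q)"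
      by (simp add: fin_inner_def v_def sum_divide_distrib)
    also have "fin_inner S w w = complex_of_real q" by (simp only: fin_inner_self q_def)
    finally have "v k * fin_inner S w v = w k * complex_of_real q / (complex_of_real (sqrt q) * complex_of_real (sqrt q))"
      by (simp add: v_def[of k])
    also have "complex_of_real (sqrt q) * complex_of_real (sqrt q) = complex_of_real q"
      using q by (simp flip: of_real_mult)
    finally show ?thesis using False by (simp add: deflate_def)
  qed
  ultimately show ?thesis by (intro exI[of _ v]) (auto simp: divide_le_eq_1)
qed

text \<open>Deflating by one normalised column of \<open>b\<close> after the other annihilates \<open>\<Sum>\<^sub>i b\<^sub>i \<phi>\<^sub>i\<close> and does
  not increase the norm of the remainder.\<close>

lemma low_rank_compression:
  fixes b :: "nat \<Rightarrow> 'k \<Rightarrow> complex"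
  assumes S: "finite S"
  shows "\<exists>c a. (\<forall>i<l. (\<Sum>k\<in>S. (cmod (c i k))\<^sup>2) \<le> 1 \<and> (\<Sum>k\<in>S. (cmod (a i k))\<^sup>2) \<le> 1) \<and>
    (\<forall>\<psi> \<phi>. (\<Sum>j\<in>S. (cmod (\<psi> j - (\<Sum>i<l. c i j * fin_inner S \<psi> (a i))))\<^sup>2)
       \<le> (\<Sum>j\<in>S. (cmod (\<psi> j - (\<Sum>i<l. b i j * \<phi> i)))\<^sup>2))"
proof (induction l arbitrary: b)
  case 0
  show ?case by simp
next
  case (Suc l)
  obtain v where v: "(\<Sum>k\<in>S. (cmod (v k))\<^sup>2) \<le> 1" and vb: "\<And>k. k \<in> S \<Longrightarrow> deflate S v (b l) k = 0"
    using deflate_normalised[OF S] by blast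
  \<comment> \<open>The hypothesis is applied to the deflated columns; the last one has become zero,
    so \<open>l\<close> of them remain.\<close>
  obtain c a where ca: "\<And>i. i < l \<Longrightarrow> (\<Sum>k\<in>S. (cmod (c i k))\<^sup>2) \<le> 1" "\<And>i. i < l \<Longrightarrow> (\<Sum>k\<in>S. (cmod (a i k))\<^sup>2) \<le> 1"
    and IH: "\<And>\<psi> \<phi>. (\<Sum>j\<in>S. (cmod (\<psi> j - (\<Sum>i<l. c i j * fin_inner S \<psi> (a i))))\<^sup>2)
       \<le> (\<Sum>j\<in>S. (cmod (\<psi> j - (\<Sum>i<l. deflate S v (b i) j * \<phi> i)))\<^sup>2)"
    using Suc[of "\<lambda>i. deflate S v (b i)"] by blast
  define c' where "c' i = (if i = l then v else c i)" for i
  \<comment> \<open>Deflating \<open>a i\<close> lets self-adjointness move the deflation onto the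
    data, which reduces the residual of \<psi> to the residual of its deflation.\<close>
  define a' where "a' i = (if i = l then v else deflate S v (a i))" for i
  show ?case
  proof (rule exI[of _ c'], rule exI[of _ a'], intro conjI allI impI)
    fix i assume "i < Suc l"
    then show "(\<Sum>k\<in>S. (cmod (c' i k))\<^sup>2) \<le> 1" "(\<Sum>k\<in>S. (cmod (a' i k))\<^sup>2) \<le> 1"
      using ca[of i] v order_trans[OF deflate_norm_le[OF v] ca(2)] by (auto simp: c'_def a'_def)
  next
    fix \<psi> \<phi>
    have "(\<Sum>j\<in>S. (cmod (\<psi> j - (\<Sum>i<Suc l. c' i j * fin_inner S \<psi> (a' i))))\<^sup>2)
        = (\<Sum>j\<in>S. (cmod (deflate S v \<psi> j - (\<Sum>i<l. c i j * fin_inner S (deflate S v \<psi>) (a i))))\<^sup>2)"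
      by (simp add: c'_def a'_def deflate_self_adjoint deflate_def[of S v \<psi>] algebra_simps)
    also have "\<dots> \<le> (\<Sum>j\<in>S. (cmod (deflate S v \<psi> j - (\<Sum>i<l. deflate S v (b i) j * \<phi> i)))\<^sup>2)"
      by (rule IH)
    also have "\<dots> = (\<Sum>j\<in>S. (cmod (deflate S v (\<lambda>k. \<psi> k - (\<Sum>i<Suc l. b i k * \<phi> i)) j))\<^sup>2)"
      unfolding deflate_diff_sum by (simp add: vb)
    also have "\<dots> \<le> (\<Sum>j\<in>S. (cmod (\<psi> j - (\<Sum>i<Suc l. b i j * \<phi> i)))\<^sup>2)"
      by (rule deflate_norm_le[OF v])
    finally show "(\<Sum>j\<in>S. (cmod (\<psi> j - (\<Sum>i<Suc l. c' i j * fin_inner S \<psi> (a' i))))\<^sup>2)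
       \<le> (\<Sum>j\<in>S. (cmod (\<psi> j - (\<Sum>i<Suc l. b i j * \<phi> i)))\<^sup>2)" .
  qed
qed

section \<open>The optimal subspace\<close>

lemma closed_l2_subspace_sum:
  assumes V: "closed_l2_subspace M V" and "finite I" "\<And>i. i \<in> I \<Longrightarrow> f i \<in> V"
  shows "(\<lambda>x. \<Sum>i\<in>I. f i x) \<in> V"
  using assms(2,3)
proof (induction I)
  case empty
  then show ?case using closed_l2_subspaceD(2)[OF V] by simp
next
  case (insert i I)
  then show ?case using closed_l2_subspaceD(3)[OF V, of "f i" "\<lambda>x. \<Sum>i\<in>I. f i x"] by simp
qed

lemma closed_l2_subspace_L2: "closed_l2_subspace M (L2 M)"
  by (auto simp: closed_l2_subspace_def l2_closure_def intro: L2_add L2_scale)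

lemma (in quasi_action) length_class_generatedI:
  assumes A: "finite A" "A \<subseteq> L2 M" "card A \<le> l"
  shows "gen_space A \<in> length_class M \<sigma> J l"
proof -
  have "space_length M \<sigma> J (gen_space A) \<le> card A"
    unfolding space_length_def by (rule Least_le) (use A in blast)
  then show ?thesis
    using A invariant_generated_space[OF A(2)] by (auto simp: length_class_def finitely_generated_def)
qed

text \<open>Minimal generating sets may have fewer than \<open>l\<close> elements; padding with zero
  functions gives every competitor exactly \<open>l\<close> columns in each fibre.\<close>

lemma length_class_generators:
  assumes "V \<in> length_class M \<sigma> J l"
  shows "\<exists>\<phi>. (\<forall>i. \<phi> i \<in> L2 M) \<and> (\<exists>A. A \<subseteq> \<phi> ` {..<l} \<and> A \<subseteq> L2 M \<and> V = generated_space M \<sigma> J A)"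
proof -
  have "\<exists>n A. finite A \<and> card A = n \<and> A \<subseteq> L2 M \<and> V = generated_space M \<sigma> J A"
    using assms by (auto simp: length_class_def finitely_generated_def)
  from LeastI_ex[OF this] obtain A where A: "finite A" "card A = space_length M \<sigma> J V" "A \<subseteq> L2 M"
    "V = generated_space M \<sigma> J A"
    by (auto simp: space_length_def)
  then have c: "card A \<le> l" using assms by (simp add: length_class_def)
  obtain e where e: "bij_betw e {0..<card A} A" using ex_bij_betw_nat_finite[OF A(1)] by blast
  define \<phi> where "\<phi> i = (if i < card A then e i else (\<lambda>x. 0))" for i
  have "\<phi> i \<in> L2 M" for i
    using A(3) bij_betwE[OF e] by (auto simp: \<phi>_def)
  moreover have "A \<subseteq> \<phi> ` {..<l}"
  proof
    fix f assume "f \<in> A"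
    then have "f \<in> e ` {0..<card A}" using bij_betw_imp_surj_on[OF e] by simp
    then obtain i where "i < card A" "f = e i" by auto
    then show "f \<in> \<phi> ` {..<l}" using c by (auto simp: \<phi>_def intro!: image_eqI[of _ _ i])
  qed
  ultimately show ?thesis using A by blast
qed

text \<open>Tychonoff. Keeping infinitely many coordinates lets the parameter be a plain function,
  whose type is metrisable because the index type is countable, as the measurable selection
  requires.\<close>

lemma compact_disc_functions: "compact {v :: 'i::countable \<Rightarrow> complex. \<forall>p. cmod (v p) \<le> 1}"
proof -
  have "{v :: 'i \<Rightarrow> complex. \<forall>p. cmod (v p) \<le> 1} = PiE UNIV (\<lambda>_. cball 0 1)" by (auto simp: PiE_def Pi_def)
  moreover have "compactin (product_topology (\<lambda>_::'i. euclidean :: complex topology) UNIV) (PiE UNIV (\<lambda>_. cball 0 1))"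
    by (subst compactin_PiE) simp
  ultimately show ?thesis by (simp only: euclidean_product_topology compactin_euclidean_iff)
qed

text \<open>The Boolean component of an index separates the coefficients \<open>c\<^sub>i\<^sub>j\<close> from the coefficients \<open>a\<^sub>i\<^sub>k\<close>.\<close>

definition compression_coeff :: "nat \<Rightarrow> (bool \<times> nat \<times> nat \<Rightarrow> complex) \<Rightarrow> nat \<Rightarrow> nat \<Rightarrow> complex" where
  "compression_coeff l v j k = (if j = k then 1 else 0) - (\<Sum>i<l. v (True, i, j) * cnj (v (False, i, k)))"

lemma compression_coeff_sum:
  assumes "finite S" "j \<in> S"
  shows "(\<Sum>k\<in>S. compression_coeff l v j k * y k) = y j - (\<Sum>i<l. v (True, i, j) * (\<Sum>k\<in>S. cnj (v (False, i, k)) * y k))"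
proof -
  have "(\<Sum>k\<in>S. compression_coeff l v j k * y k)
      = (\<Sum>k\<in>S. if k = j then y k else 0) - (\<Sum>k\<in>S. (\<Sum>i<l. v (True, i, j) * cnj (v (False, i, k))) * y k)"
    unfolding compression_coeff_def left_diff_distrib sum_subtractf by (intro arg_cong2[where f = "(-)"] sum.cong) auto
  also have "(\<Sum>k\<in>S. (\<Sum>i<l. v (True, i, j) * cnj (v (False, i, k))) * y k) = (\<Sum>i<l. v (True, i, j) * (\<Sum>k\<in>S. cnj (v (False, i, k)) * y k))"
    by (simp add: sum_distrib_left sum_distrib_right sum.swap[of _ S] mult_ac)
  finally show ?thesis using assms by simp
qed

section \<open>Fibrewise error and the optimal generators\<close>

context zak_action
begin

text \<open>The representation acts on a fibre by scalars, so an element of the algebraic span has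
  every fibre in the span of the \<open>l\<close> generator fibres. The same coefficients serve for
  all x in a fibre.\<close>

lemma zak_span:
  fixes l :: nat
  assumes \<phi>: "\<And>i. \<phi> i \<in> L2 M" and A: "A \<subseteq> \<phi> ` {..<l}"
    and f: "f \<in> cspan_fun {rep a g | a g. g \<in> A}"
  shows "\<exists>b. AE p in N. zak f p = (\<Sum>i<l. b i (fst p) * zak (\<phi> i) p)"
proof -
  have SL: "{rep a g | a g. g \<in> A} \<subseteq> L2 M" using A \<phi> by (auto intro: rep_L2)
  show ?thesis
    using f
  proof (induction rule: cspan_fun_induct)
    case zero
    show ?case using zak_zero by (intro exI[of _ "\<lambda>_ _. 0"]) simp
  next
    case (step c b g)
    then obtain a i where i: "i < l" "b = rep a (\<phi> i)" using A by blast
    obtain d where d: "AE p in N. zak g p = (\<Sum>i<l. d i (fst p) * zak (\<phi> i) p)" using step by blast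
    have gL: "g \<in> L2 M" using step(2) cspan_fun_L2[OF SL] by auto
    have bL: "b \<in> L2 M" using i \<phi> by (simp add: rep_L2)
    define e where "e i' w = (if i' = i then c * ch a w else 0) + d i' w" for i' w
    have "AE p in N. zak (\<lambda>x. c * b x + g x) p = (\<Sum>i<l. e i (fst p) * zak (\<phi> i) p)"
      using zak_add[OF L2_scale[OF bL] gL, of c] zak_scale[OF bL, of c] zak_rep[OF \<phi>, of a i] d
    proof eventually_elim
      case (elim p)
      have "(\<Sum>i<l. e i (fst p) * zak (\<phi> i) p)
          = (\<Sum>i'<l. if i' = i then c * ch a (fst p) * zak (\<phi> i) p else 0) + (\<Sum>i<l. d i (fst p) * zak (\<phi> i) p)"
        unfolding e_def distrib_right sum.distrib by (intro arg_cong2[where f = "(+)"] sum.cong) auto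
      then show ?case using elim i by simp
    qed
    then show ?case by blast
  qed
qed

lemma zak_sum_norm:
  assumes S: "finite S" and f: "\<And>j. j \<in> S \<Longrightarrow> f j \<in> L2 M" and g: "\<And>j. j \<in> S \<Longrightarrow> g j \<in> L2 M"
  shows "ennreal (\<Sum>j\<in>S. (l2_dist M (f j) (g j))\<^sup>2)
    = (\<integral>\<^sup>+w. \<integral>\<^sup>+x. (\<Sum>j\<in>S. ennreal ((cmod (zak (f j) (w, x) - zak (g j) (w, x)))\<^sup>2)) \<partial>M \<partial>P)"
proof -
  have m: "j \<in> S \<Longrightarrow> zak (f j) \<in> borel_measurable N" "j \<in> S \<Longrightarrow> zak (g j) \<in> borel_measurable N" for j
    using L2_measurable[OF zak_L2[OF f]] L2_measurable[OF zak_L2[OF g]] by auto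
  have "ennreal (\<Sum>j\<in>S. (l2_dist M (f j) (g j))\<^sup>2)
      = ennreal (\<Sum>j\<in>S. (l2_dist N (zak (f j)) (zak (g j)))\<^sup>2)"
    using f g by (intro arg_cong[where f = ennreal] sum.cong) (simp_all add: zak_norm_diff)
  also have "\<dots> = (\<Sum>j\<in>S. ennreal ((l2_dist N (zak (f j)) (zak (g j)))\<^sup>2))"
    by (rule sum_ennreal[symmetric]) simp
  also have "\<dots> = (\<Sum>j\<in>S. \<integral>\<^sup>+p. ennreal ((cmod (zak (f j) p - zak (g j) p))\<^sup>2) \<partial>N)"
    using f g by (intro sum.cong refl l2_norm_nn L2_diff zak_L2)
  also have "\<dots> = (\<integral>\<^sup>+p. (\<Sum>j\<in>S. ennreal ((cmod (zak (f j) p - zak (g j) p))\<^sup>2)) \<partial>N)"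
    using m by (intro nn_integral_sum[symmetric]) simp
  also have "\<dots> = (\<integral>\<^sup>+w. \<integral>\<^sup>+x. (\<Sum>j\<in>S. ennreal ((cmod (zak (f j) (w, x) - zak (g j) (w, x)))\<^sup>2)) \<partial>M \<partial>P)"
    using m by (intro nn_integral_fst[symmetric]) simp
  finally show ?thesis .
qed

lemma zak_fibre_L2:
  assumes f: "f \<in> L2 M" shows "AE w in P. (\<lambda>x. zak f (w, x)) \<in> L2 M"
proof -
  note [measurable] = L2_measurable[OF zak_L2[OF f]]
  have "(\<integral>\<^sup>+w. \<integral>\<^sup>+x. ennreal ((cmod (zak f (w, x)))\<^sup>2) \<partial>M \<partial>P) = nn_sq N (zak f)"
    by (rule nn_integral_fst) simp
  also have "\<dots> \<noteq> \<infinity>" by (simp flip: l2_norm_nn[OF zak_L2[OF f]])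
  finally have "AE w in P. nn_sq M (\<lambda>x. zak f (w, x)) \<noteq> \<infinity>"
    by (intro nn_integral_noteq_infinite) simp_all
  then show ?thesis
    using AE_space
  proof eventually_elim
    case (elim w)
    have "zak f \<circ> Pair w \<in> borel_measurable M"
      using elim(2) by (intro measurable_comp[OF measurable_Pair1' L2_measurable[OF zak_L2[OF f]]])
    then show ?case using elim(1) by (intro L2_nnI) (auto simp: comp_def less_top)
  qed
qed

abbreviation fibre_residual ::
    "nat \<Rightarrow> nat set \<Rightarrow> (nat \<Rightarrow> 'a \<Rightarrow> complex) \<Rightarrow> 'w \<Rightarrow> (bool \<times> nat \<times> nat \<Rightarrow> complex) \<Rightarrow> nat \<Rightarrow> 'a \<Rightarrow> complex" where
  "fibre_residual l S \<psi> w v j x \<equiv>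
     zak (\<psi> j) (w, x) - (\<Sum>i<l. v (True, i, j) * (\<Sum>k\<in>S. cnj (v (False, i, k)) * zak (\<psi> k) (w, x)))"

text \<open>The fibrewise error is a polynomial in the parameter \<open>v\<close>, with the entries of the Gramian as
  coefficients; this makes measurability and continuity evident on every fibre.\<close>

definition fibre_error :: "nat \<Rightarrow> nat set \<Rightarrow> (nat \<Rightarrow> 'a \<Rightarrow> complex) \<Rightarrow> 'w \<Rightarrow> (bool \<times> nat \<times> nat \<Rightarrow> complex) \<Rightarrow> real" where
  "fibre_error l S \<psi> w v = Re (\<Sum>j\<in>S. \<Sum>k\<in>S. \<Sum>k'\<in>S.
     compression_coeff l v j k * cnj (compression_coeff l v j k') *
     l2_inner M (\<lambda>x. zak (\<psi> k) (w, x)) (\<lambda>x. zak (\<psi> k') (w, x)))"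

lemma measurable_fibre_error:
  assumes "\<And>j. j \<in> S \<Longrightarrow> \<psi> j \<in> L2 M"
  shows "(\<lambda>w. fibre_error l S \<psi> w v) \<in> borel_measurable P"
proof -
  have "(\<lambda>w. l2_inner M (\<lambda>x. zak (\<psi> k) (w, x)) (\<lambda>x. zak (\<psi> k') (w, x))) \<in> borel_measurable P"
    if "k \<in> S" "k' \<in> S" for k k'
  proof -
    have [measurable]: "zak (\<psi> k) \<in> borel_measurable N" "zak (\<psi> k') \<in> borel_measurable N"
      using L2_measurable[OF zak_L2[OF assms]] that by auto
    show ?thesis unfolding l2_inner_def by measurable
  qed
  then show ?thesis
    unfolding fibre_error_def
    by (intro measurable_compose[OF _ borel_measurable_Re] borel_measurable_sum borel_measurable_times) auto
qed

lemma continuous_fibre_error: "continuous_on K (fibre_error l S \<psi> w)"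
proof -
  have c: "continuous_on K (\<lambda>v. v p)" for p :: "bool \<times> nat \<times> nat" and K :: "(bool \<times> nat \<times> nat \<Rightarrow> complex) set"
    using continuous_on_product_coordinates[of p] continuous_on_subset by blast
  show ?thesis
    unfolding fibre_error_def[abs_def] compression_coeff_def by (intro continuous_intros c)
qed

text \<open>Expanding the squares produces the Gramian polynomial. Exchanging sums and integral
  needs square-integrable fibres, which \<open>zak_fibre_L2\<close> provides for almost every
  \<open>w\<close>.\<close>

lemma fibre_error_nn:
  assumes S: "finite S" and good: "\<And>j. j \<in> S \<Longrightarrow> (\<lambda>x. zak (\<psi> j) (w, x)) \<in> L2 M"
  shows "ennreal (fibre_error l S \<psi> w v) = (\<integral>\<^sup>+x. (\<Sum>j\<in>S. ennreal ((cmod (fibre_residual l S \<psi> w v j x))\<^sup>2)) \<partial>M)"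
proof -
  define c where "c = compression_coeff l v"
  define y where "y k x = zak (\<psi> k) (w, x)" for k x
  define D where "D j x = (\<Sum>k\<in>S. c j k * y k x)" for j x
  have yL: "y k \<in> L2 M" if "k \<in> S" for k using good[OF that] by (simp add: y_def[abs_def])
  have DL: "D j \<in> L2 M" for j unfolding D_def[abs_def] by (intro L2_sum L2_scale yL)
  have "complex_of_real ((l2_norm M (D j))\<^sup>2) = (\<Sum>k\<in>S. \<Sum>k'\<in>S. c j k * cnj (c j k') * l2_inner M (y k) (y k'))" for j
  proof -
    have "complex_of_real ((l2_norm M (D j))\<^sup>2) = (LINT x|M. D j x * cnj (D j x))"
      unfolding l2_norm_sq by (simp only: integral_complex_of_real[symmetric] complex_norm_square)
    also have "\<dots> = (LINT x|M. (\<Sum>k\<in>S. \<Sum>k'\<in>S. c j k * cnj (c j k') * (y k x * cnj (y k' x))))"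
      unfolding D_def by (simp add: sum_product mult_ac)
    also have "\<dots> = (\<Sum>k\<in>S. \<Sum>k'\<in>S. c j k * cnj (c j k') * l2_inner M (y k) (y k'))"
    proof -
      have I: "integrable M (\<lambda>x. c j k * cnj (c j k') * (y k x * cnj (y k' x)))" if "k \<in> S" "k' \<in> S" for k k'
        by (intro integrable_mult_right L2_inner_integrable yL that)
      have "(LINT x|M. (\<Sum>k\<in>S. \<Sum>k'\<in>S. c j k * cnj (c j k') * (y k x * cnj (y k' x))))
          = (\<Sum>k\<in>S. LINT x|M. (\<Sum>k'\<in>S. c j k * cnj (c j k') * (y k x * cnj (y k' x))))"
        by (rule Bochner_Integration.integral_sum) (intro Bochner_Integration.integrable_sum I)
      also have "\<dots> = (\<Sum>k\<in>S. \<Sum>k'\<in>S. LINT x|M. c j k * cnj (c j k') * (y k x * cnj (y k' x)))"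
        by (intro sum.cong refl Bochner_Integration.integral_sum I)
      finally show ?thesis by (simp add: l2_inner_def)
    qed
    finally show ?thesis .
  qed
  then have "fibre_error l S \<psi> w v = Re (\<Sum>j\<in>S. complex_of_real ((l2_norm M (D j))\<^sup>2))"
    by (simp add: fibre_error_def c_def y_def[abs_def])
  then have "fibre_error l S \<psi> w v = (\<Sum>j\<in>S. (l2_norm M (D j))\<^sup>2)" by simp
  then have "ennreal (fibre_error l S \<psi> w v) = (\<Sum>j\<in>S. ennreal ((l2_norm M (D j))\<^sup>2))"
    by (simp only: sum_ennreal zero_le_power2)
  also have "\<dots> = (\<Sum>j\<in>S. \<integral>\<^sup>+x. ennreal ((cmod (D j x))\<^sup>2) \<partial>M)"
    by (intro sum.cong refl l2_norm_nn DL)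
  also have "\<dots> = (\<integral>\<^sup>+x. (\<Sum>j\<in>S. ennreal ((cmod (D j x))\<^sup>2)) \<partial>M)"
    using L2_measurable[OF DL] by (intro nn_integral_sum[symmetric]) simp
  also have "\<dots> = (\<integral>\<^sup>+x. (\<Sum>j\<in>S. ennreal ((cmod (fibre_residual l S \<psi> w v j x))\<^sup>2)) \<partial>M)"
    unfolding D_def c_def y_def
    by (intro nn_integral_cong sum.cong refl) (simp add: compression_coeff_sum[OF S])
  finally show ?thesis .
qed

text \<open>The integral \<open>E\<close> of the minimal fibre errors is attained by explicit
  approximants in one space of the class and is a lower bound for every space of the class.\<close>

theorem optimal_subspace_exists:
  fixes S :: "nat set"
  assumes S: "finite S" and \<psi>: "\<And>j. j \<in> S \<Longrightarrow> \<psi> j \<in> L2 M"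
  shows "\<exists>Vs \<in> length_class M \<sigma> J l. \<forall>V \<in> length_class M \<sigma> J l.
    (\<Sum>j\<in>S. (l2_dist M (\<psi> j) (l2_proj M Vs (\<psi> j)))\<^sup>2)
      \<le> (\<Sum>j\<in>S. (l2_dist M (\<psi> j) (l2_proj M V (\<psi> j)))\<^sup>2)"
proof -
  define K where "K = {v :: bool \<times> nat \<times> nat \<Rightarrow> complex. \<forall>p. cmod (v p) \<le> 1}"
  have K: "compact K" unfolding K_def by (rule compact_disc_functions)
  have K0: "K \<noteq> {}" by (auto simp: K_def intro!: exI[of _ "\<lambda>_. 0"])
  have fm: "(\<lambda>w. fibre_error l S \<psi> w v) \<in> borel_measurable P" for v
    by (rule measurable_fibre_error[OF \<psi>])
  from measurable_argmin[OF K K0 fm continuous_fibre_error] obtain u where um: "u \<in> borel_measurable P"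
    and u: "\<forall>w\<in>space P. u w \<in> K \<and> (\<forall>v\<in>K. fibre_error l S \<psi> w (u w) \<le> fibre_error l S \<psi> w v)"
    by (rule bexE)
  have uK: "u w \<in> K" if "w \<in> space P" for w
    using u that by blast
  have umin: "fibre_error l S \<psi> w (u w) \<le> fibre_error l S \<psi> w v" if "w \<in> space P" "v \<in> K" for w v
    using u that by blast
  have good: "AE w in P. \<forall>j\<in>S. (\<lambda>x. zak (\<psi> j) (w, x)) \<in> L2 M"
    by (rule AE_finite_allI[OF S]) (rule zak_fibre_L2[OF \<psi>])
  have ucm: "(\<lambda>w. u w p) \<in> borel_measurable P" for p
  proof -
    have "(\<lambda>v::bool \<times> nat \<times> nat \<Rightarrow> complex. v p) \<in> borel_measurable borel"
      by (rule borel_measurable_continuous_onI) (rule continuous_on_product_coordinates)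
    from measurable_compose[OF um this] show ?thesis .
  qed
  have uc1: "cmod (u w p) \<le> 1" if "w \<in> space P" for w p
    using uK[OF that] unfolding K_def by blast
  have invL2: "invariant_subspace M \<sigma> J (L2 M)"
    using closed_l2_subspace_L2 rep_L2 by (auto simp: invariant_subspace_def)
  \<comment> \<open>\<open>L2 M\<close> is itself an invariant space, so the multiplier theorem
    realises the measurable coefficient times \<psi> as the transform of an actual function.\<close>
  have g_ex: "\<exists>g\<in>L2 M. AE p in N. zak g p = cnj (u (fst p) (False, i, k)) * zak (\<psi> k) p" if "k \<in> S" for i k
    by (rule bounded_multiplier[OF invL2 borel_measurable_cnj[OF ucm] _ \<psi>[OF that], where B = 1])
      (simp only: complex_mod_cnj uc1)
  define g where "g i k = (SOME g. g \<in> L2 M \<and> (AE p in N. zak g p = cnj (u (fst p) (False, i, k)) * zak (\<psi> k) p))" for i k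
  have g_props: "g i k \<in> L2 M \<and> (AE p in N. zak (g i k) p = cnj (u (fst p) (False, i, k)) * zak (\<psi> k) p)" if "k \<in> S" for i k
    using someI_ex[OF g_ex[OF that, of i, unfolded Bex_def]] unfolding g_def .
  note gL = g_props[THEN conjunct1] and g = g_props[THEN conjunct2]
  define \<phi> where "\<phi> i x = (\<Sum>k\<in>S. g i k x)" for i x
  have \<phi>L: "\<phi> i \<in> L2 M" for i unfolding \<phi>_def[abs_def] by (intro L2_sum gL)
  have z\<phi>: "AE p in N. zak (\<phi> i) p = (\<Sum>k\<in>S. cnj (u (fst p) (False, i, k)) * zak (\<psi> k) p)" for i
  proof -
    have "AE p in N. \<forall>k\<in>S. zak (g i k) p = cnj (u (fst p) (False, i, k)) * zak (\<psi> k) p"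
      by (rule AE_finite_allI[OF S g])
    moreover have "AE p in N. zak (\<lambda>x. \<Sum>k\<in>S. g i k x) p = (\<Sum>k\<in>S. zak (g i k) p)"
      by (rule zak_sum[OF S gL])
    ultimately show ?thesis
      unfolding \<phi>_def[abs_def] by eventually_elim simp
  qed
  define A where "A = \<phi> ` {..<l}"
  have A: "finite A" "A \<subseteq> L2 M" "card A \<le> l"
    using \<phi>L card_image_le[of "{..<l}" \<phi>] by (auto simp: A_def)
  define Vs where "Vs = gen_space A"
  have Vs: "Vs \<in> length_class M \<sigma> J l" unfolding Vs_def by (rule length_class_generatedI[OF A])
  have invV: "invariant_subspace M \<sigma> J Vs" unfolding Vs_def by (rule invariant_generated_space[OF A(2)])
  then have clV: "closed_l2_subspace M Vs" by (simp add: invariant_subspace_def)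
  have \<phi>V: "\<phi> i \<in> Vs" if "i < l" for i
    unfolding Vs_def by (rule generated_space_superset[OF A(2)]) (use that in \<open>auto simp: A_def\<close>)
  \<comment> \<open>Here the multiplier theorem is applied inside \<open>Vs\<close>: the outer
    coefficients vary with \<open>w\<close>, yet the product stays in the generated space.\<close>
  have f_ex: "\<exists>f\<in>Vs. AE p in N. zak f p = u (fst p) (True, i, j) * zak (\<phi> i) p" if "i < l" for i j
    by (rule bounded_multiplier[OF invV ucm uc1 \<phi>V[OF that]])
  define f where "f i j = (SOME f. f \<in> Vs \<and> (AE p in N. zak f p = u (fst p) (True, i, j) * zak (\<phi> i) p))" for i j
  have f_props: "f i j \<in> Vs \<and> (AE p in N. zak (f i j) p = u (fst p) (True, i, j) * zak (\<phi> i) p)" if "i < l" for i j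
    using someI_ex[OF f_ex[OF that, of j, unfolded Bex_def]] unfolding f_def .
  note fV = f_props[THEN conjunct1] and f = f_props[THEN conjunct2]
  define q where "q j x = (\<Sum>i<l. f i j x)" for j x
  have qV: "q j \<in> Vs" for j
    unfolding q_def[abs_def] by (rule closed_l2_subspace_sum[OF clV]) (use fV in auto)
  have VsL: "Vs \<subseteq> L2 M" by (rule closed_l2_subspaceD(1)[OF clV])
  have zq: "AE p in N. \<forall>j\<in>S. zak (q j) p = (\<Sum>i<l. u (fst p) (True, i, j) * (\<Sum>k\<in>S. cnj (u (fst p) (False, i, k)) * zak (\<psi> k) p))"
  proof (rule AE_finite_allI[OF S])
    fix j
    have 1: "AE p in N. \<forall>i\<in>{..<l}. zak (f i j) p = u (fst p) (True, i, j) * zak (\<phi> i) p"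
      by (rule AE_finite_allI) (use f in auto)
    have 2: "AE p in N. \<forall>i\<in>{..<l}. zak (\<phi> i) p = (\<Sum>k\<in>S. cnj (u (fst p) (False, i, k)) * zak (\<psi> k) p)"
      by (rule AE_finite_allI) (use z\<phi> in auto)
    have 3: "AE p in N. zak (\<lambda>x. \<Sum>i\<in>{..<l}. f i j x) p = (\<Sum>i\<in>{..<l}. zak (f i j) p)"
      by (rule zak_sum) (use fV VsL in auto)
    show "AE p in N. zak (q j) p = (\<Sum>i<l. u (fst p) (True, i, j) * (\<Sum>k\<in>S. cnj (u (fst p) (False, i, k)) * zak (\<psi> k) p))"
      using 1 2 3 unfolding q_def[abs_def] by eventually_elim simp
  qed
  define I where "I w v = (\<integral>\<^sup>+x. (\<Sum>j\<in>S. ennreal ((cmod (fibre_residual l S \<psi> w v j x))\<^sup>2)) \<partial>M)" for w v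
  have fibre: "ennreal (fibre_error l S \<psi> w v) = I w v"
    if "\<forall>j\<in>S. (\<lambda>x. zak (\<psi> j) (w, x)) \<in> L2 M" for w v
    unfolding I_def by (rule fibre_error_nn[OF S]) (use that in blast)
  \<comment> \<open>The error of the approximants \<open>q j\<close>, not of the projections; the
    latter can only be smaller by \<open>l2_proj_le\<close>.\<close>
  define E where "E = (\<Sum>j\<in>S. (l2_dist M (\<psi> j) (q j))\<^sup>2)"
  have E_eq: "ennreal E = (\<integral>\<^sup>+w. ennreal (fibre_error l S \<psi> w (u w)) \<partial>P)"
  proof -
    have "ennreal E = (\<integral>\<^sup>+w. \<integral>\<^sup>+x. (\<Sum>j\<in>S. ennreal ((cmod (zak (\<psi> j) (w, x) - zak (q j) (w, x)))\<^sup>2)) \<partial>M \<partial>P)"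
      unfolding E_def by (rule zak_sum_norm[OF S \<psi>]) (use qV VsL in auto)
    also have "\<dots> = (\<integral>\<^sup>+w. ennreal (fibre_error l S \<psi> w (u w)) \<partial>P)"
    proof (rule nn_integral_cong_AE)
      show "AE w in P. (\<integral>\<^sup>+x. (\<Sum>j\<in>S. ennreal ((cmod (zak (\<psi> j) (w, x) - zak (q j) (w, x)))\<^sup>2)) \<partial>M)
          = ennreal (fibre_error l S \<psi> w (u w))"
        using N.AE_pair[OF zq] good
      proof eventually_elim
        case (elim w)
        show ?case
          unfolding fibre[OF elim(2)] I_def
          by (rule nn_integral_cong_AE) (use elim(1) in \<open>eventually_elim, simp\<close>)
      qed
    qed
    finally show ?thesis .
  qed
  \<comment> \<open>Competitors are taken from the algebraic span first, where fibre coefficients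
    exist; the closure is reached at the end by an approximation.\<close>
  have lower: "E \<le> (\<Sum>j\<in>S. (l2_dist M (\<psi> j) (f' j))\<^sup>2)"
    if \<phi>': "\<And>i. \<phi>' i \<in> L2 M" and A': "A' \<subseteq> \<phi>' ` {..<l}"
      and f': "\<And>j. j \<in> S \<Longrightarrow> f' j \<in> cspan_fun {rep a g | a g. g \<in> A'}" for \<phi>' A' f'
  proof -
    have SL: "{rep a g | a g. g \<in> A'} \<subseteq> L2 M" using A' \<phi>' by (auto intro: rep_L2)
    have f'L: "f' j \<in> L2 M" if "j \<in> S" for j using f'[OF that] cspan_fun_L2[OF SL] by auto
    have "\<forall>j\<in>S. \<exists>b. AE p in N. zak (f' j) p = (\<Sum>i<l. b i (fst p) * zak (\<phi>' i) p)"
      by (intro ballI zak_span[OF \<phi>' A' f'])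
    from bchoice[OF this] obtain b where b: "\<forall>j\<in>S. AE p in N. zak (f' j) p = (\<Sum>i<l. b j i (fst p) * zak (\<phi>' i) p)"
      by (rule exE)
    have b': "AE p in N. \<forall>j\<in>S. zak (f' j) p = (\<Sum>i<l. b j i (fst p) * zak (\<phi>' i) p)"
      by (rule AE_finite_allI[OF S b[rule_format]])
    have "(\<integral>\<^sup>+w. ennreal (fibre_error l S \<psi> w (u w)) \<partial>P)
        \<le> (\<integral>\<^sup>+w. \<integral>\<^sup>+x. (\<Sum>j\<in>S. ennreal ((cmod (zak (\<psi> j) (w, x) - zak (f' j) (w, x)))\<^sup>2)) \<partial>M \<partial>P)"
    proof (rule nn_integral_mono_AE)
      show "AE w in P. ennreal (fibre_error l S \<psi> w (u w))
          \<le> (\<integral>\<^sup>+x. (\<Sum>j\<in>S. ennreal ((cmod (zak (\<psi> j) (w, x) - zak (f' j) (w, x)))\<^sup>2)) \<partial>M)"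
        using N.AE_pair[OF b'] good AE_space
      proof eventually_elim
        case (elim w)
        \<comment> \<open>The compression depends only on the coefficients at this \<open>w\<close>,
          not on the vectors it is applied to, so one parameter \<open>v\<close> serves for almost
          every x of the fibre.\<close>
        obtain c a where ca: "\<And>i. i < l \<Longrightarrow> (\<Sum>k\<in>S. (cmod (c i k))\<^sup>2) \<le> 1" "\<And>i. i < l \<Longrightarrow> (\<Sum>k\<in>S. (cmod (a i k))\<^sup>2) \<le> 1"
          and cale: "\<And>y z. (\<Sum>j\<in>S. (cmod (y j - (\<Sum>i<l. c i j * fin_inner S y (a i))))\<^sup>2)
             \<le> (\<Sum>j\<in>S. (cmod (y j - (\<Sum>i<l. b j i w * z i)))\<^sup>2)"
          using low_rank_compression[OF S, of l "\<lambda>i j. b j i w"] by blast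
        define v where "v = (\<lambda>(f, i, k). if i < l \<and> k \<in> S then if f then c i k else a i k else 0)"
        have entry: "cmod (y k) \<le> 1" if "(\<Sum>k\<in>S. (cmod (y k))\<^sup>2) \<le> 1" "k \<in> S" for y :: "nat \<Rightarrow> complex" and k
          using order_trans[OF member_le_sum[OF that(2), of "\<lambda>k. (cmod (y k))\<^sup>2"] that(1)] S
          by (simp add: abs_square_le_1)
        \<comment> \<open>Every entry is bounded by the norm of its column, and all other
          coordinates are 0, so \<open>v\<close> competes in the minimisation defining
          \<open>u\<close>.\<close>
        have "v \<in> K" using entry[OF ca(1)] entry[OF ca(2)] by (auto simp: K_def v_def)
        then have "ennreal (fibre_error l S \<psi> w (u w)) \<le> ennreal (fibre_error l S \<psi> w v)"
          using umin[OF elim(3)] by (intro ennreal_leI) auto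
        also have "\<dots> \<le> (\<integral>\<^sup>+x. (\<Sum>j\<in>S. ennreal ((cmod (zak (\<psi> j) (w, x) - zak (f' j) (w, x)))\<^sup>2)) \<partial>M)"
          unfolding fibre[OF elim(2)] I_def
        proof (rule nn_integral_mono_AE)
          show "AE x in M. (\<Sum>j\<in>S. ennreal ((cmod (fibre_residual l S \<psi> w v j x))\<^sup>2))
            \<le> (\<Sum>j\<in>S. ennreal ((cmod (zak (\<psi> j) (w, x) - zak (f' j) (w, x)))\<^sup>2))"
            using elim(1)
          proof eventually_elim
            case e: (elim x)
            have "(\<Sum>j\<in>S. (cmod (fibre_residual l S \<psi> w v j x))\<^sup>2)
              = (\<Sum>j\<in>S. (cmod (zak (\<psi> j) (w, x) - (\<Sum>i<l. c i j * fin_inner S (\<lambda>k. zak (\<psi> k) (w, x)) (a i))))\<^sup>2)"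
              by (simp add: v_def fin_inner_def mult.commute)
            also have "\<dots> \<le> (\<Sum>j\<in>S. (cmod (zak (\<psi> j) (w, x) - (\<Sum>i<l. b j i w * zak (\<phi>' i) (w, x))))\<^sup>2)"
              by (rule cale)
            also have "\<dots> = (\<Sum>j\<in>S. (cmod (zak (\<psi> j) (w, x) - zak (f' j) (w, x)))\<^sup>2)"
              using e by simp
            finally show ?case
              by (simp only: sum_ennreal zero_le_power2 ennreal_leI)
          qed
        qed
        finally show ?case .
      qed
    qed
    also have "\<dots> = ennreal (\<Sum>j\<in>S. (l2_dist M (\<psi> j) (f' j))\<^sup>2)"
      by (rule zak_sum_norm[OF S \<psi> f'L, symmetric])
    finally show ?thesis unfolding E_eq[symmetric] by (simp add: sum_nonneg)
  qed
  have "(\<Sum>j\<in>S. (l2_dist M (\<psi> j) (l2_proj M Vs (\<psi> j)))\<^sup>2)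
      \<le> (\<Sum>j\<in>S. (l2_dist M (\<psi> j) (l2_proj M V (\<psi> j)))\<^sup>2)" if V: "V \<in> length_class M \<sigma> J l" for V
  proof -
    define a where "a j = l2_dist M (\<psi> j) (l2_proj M V (\<psi> j))" for j
    have cl: "closed_l2_subspace M V" using V by (simp add: length_class_def invariant_subspace_def)
    obtain \<phi>' A' where \<phi>': "\<And>i. \<phi>' i \<in> L2 M" and A': "A' \<subseteq> \<phi>' ` {..<l}" "A' \<subseteq> L2 M" "V = gen_space A'"
      using length_class_generators[OF V] by blast
    define T where "T = cspan_fun {rep a g | a g. g \<in> A'}"
    have TL: "T \<subseteq> L2 M" unfolding T_def using A'(2) by (intro cspan_fun_L2) (auto intro: rep_L2)
    have VT: "V = l2_closure M T" by (simp add: A'(3) generated_space_def T_def)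
    \<comment> \<open>The projection onto \<open>V\<close> is only a limit of span elements; each is
      approximated within \<open>1 / Suc n\<close>, and \<open>n\<close> then tends to
      infinity.\<close>
    have le: "E \<le> (\<Sum>j\<in>S. (a j + 1 / real (Suc n))\<^sup>2)" for n
    proof -
      have "\<exists>f'. f' \<in> T \<and> l2_dist M (\<psi> j) f' \<le> a j + 1 / real (Suc n)" if j: "j \<in> S" for j
      proof -
        have pV: "l2_proj M V (\<psi> j) \<in> V" by (rule l2_proj_mem[OF cl \<psi>[OF j]])
        have pL: "l2_proj M V (\<psi> j) \<in> L2 M" using pV closed_l2_subspaceD(1)[OF cl] by auto
        have "1 / real (Suc n) > 0" by simp
        then obtain h where h: "h \<in> T" "l2_dist M (l2_proj M V (\<psi> j)) h < 1 / real (Suc n)"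
          using pV unfolding VT l2_closure_def by blast
        have "l2_dist M (\<psi> j) h \<le> a j + l2_dist M (l2_proj M V (\<psi> j)) h"
          unfolding a_def using h TL by (intro l2_norm_triangle \<psi> j pL) auto
        then show ?thesis using h by (intro exI[of _ h]) auto
      qed
      then have "\<forall>j\<in>S. \<exists>f'. f' \<in> T \<and> l2_dist M (\<psi> j) f' \<le> a j + 1 / real (Suc n)" by blast
      from bchoice[OF this] obtain f' where f'P: "\<forall>j\<in>S. f' j \<in> T \<and> l2_dist M (\<psi> j) (f' j) \<le> a j + 1 / real (Suc n)"
        by (rule exE)
      have f'T: "f' j \<in> T" and f': "l2_dist M (\<psi> j) (f' j) \<le> a j + 1 / real (Suc n)" if "j \<in> S" for j
        using f'P that by auto
      have "E \<le> (\<Sum>j\<in>S. (l2_dist M (\<psi> j) (f' j))\<^sup>2)"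
        by (rule lower[OF \<phi>' A'(1)]) (use f'T in \<open>simp add: T_def\<close>)
      also have "\<dots> \<le> (\<Sum>j\<in>S. (a j + 1 / real (Suc n))\<^sup>2)"
        by (intro sum_mono power_mono f') auto
      finally show ?thesis .
    qed
    have "(\<lambda>n. \<Sum>j\<in>S. (a j + 1 / real (Suc n))\<^sup>2) \<longlonglongrightarrow> (\<Sum>j\<in>S. (a j + 0)\<^sup>2)"
      using LIMSEQ_inverse_real_of_nat by (intro tendsto_intros) (simp add: inverse_eq_divide)
    then have "E \<le> (\<Sum>j\<in>S. (a j + 0)\<^sup>2)" by (rule LIMSEQ_le_const) (use le in blast)
    moreover have "(\<Sum>j\<in>S. (l2_dist M (\<psi> j) (l2_proj M Vs (\<psi> j)))\<^sup>2) \<le> E"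
      unfolding E_def by (intro sum_mono power_mono l2_proj_le[OF clV \<psi> qV]) auto
    ultimately show ?thesis by (simp add: a_def)
  qed
  with Vs show ?thesis by blast
qed

end

text \<open>Removing from \<open>T\<close> its overlaps with all its other translates leaves a tile
  whose translates are disjoint: a common point of two translates pulls back to a point of
  \<open>C\<close> lying in a nontrivial translate of \<open>T\<close>.\<close>

lemma (in quasi_action) disjoint_tile:
  assumes "tiling_property M \<sigma>"
  shows "\<exists>C\<in>sets M. (\<forall>a b. a \<noteq> b \<longrightarrow> \<sigma> a ` C \<inter> \<sigma> b ` C = {}) \<and> (AE x in M. x \<in> (\<Union>a. \<sigma> a ` C))"
proof -
  obtain T where T [measurable]: "T \<in> sets M"
    and cover: "emeasure M (space M - (\<Union>a. \<sigma> a ` T)) = 0"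
    and overlap: "\<And>a b. a \<noteq> b \<Longrightarrow> emeasure M (\<sigma> a ` T \<inter> \<sigma> b ` T) = 0"
    using assms by (auto simp: tiling_property_def)
  have Tsp: "x \<in> T \<Longrightarrow> x \<in> space M" for x using sets.sets_into_space[OF T] by auto
  define C where "C = T - (\<Union>a\<in>-{0}. \<sigma> a ` T)"
  have "\<sigma> a ` C \<inter> \<sigma> b ` C = {}" if "a \<noteq> b" for a b
  proof (rule ccontr)
    assume "\<sigma> a ` C \<inter> \<sigma> b ` C \<noteq> {}"
    then obtain c c' where c: "c \<in> C" "c' \<in> C" "\<sigma> a c = \<sigma> b c'" by blast
    have sp: "c \<in> space M" "c' \<in> space M" using c Tsp by (auto simp: C_def)
    have "c = \<sigma> (- a) (\<sigma> a c)" using action_inverse(2)[OF sp(1)] by simp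
    also have "\<dots> = \<sigma> (- a + b) c'" unfolding c(3) using action_add[OF sp(2)] by simp
    finally have "c \<in> \<sigma> (- a + b) ` T" using c(2) by (auto simp: C_def)
    moreover have "- a + b \<noteq> 0" using that by (simp add: eq_neg_iff_add_eq_0[symmetric] add.commute)
    ultimately show False using c(1) by (auto simp: C_def)
  qed
  moreover have "AE x in M. x \<in> (\<Union>a. \<sigma> a ` C)"
  proof -
    have T0: "\<sigma> 0 ` T = T" using action_zero Tsp by (auto simp: image_iff)
    \<comment> \<open>The Jacobian formula shows that the action maps null sets to null sets, so the
      removed overlaps stay negligible after translation, and countability of the group permits
      discarding them all.\<close>
    have null: "AE x in M. x \<notin> \<sigma> a ` (T \<inter> \<sigma> d ` T)" if d: "d \<noteq> 0" for a d
    proof -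
      have "T \<inter> \<sigma> d ` T \<in> null_sets M" using overlap[of 0 d] d by (simp add: T0 null_sets_def)
      then have "AE x in M. x \<notin> T \<inter> \<sigma> d ` T" by (rule AE_not_in)
      then have "(\<integral>\<^sup>+x. ennreal (J a x) * indicator (T \<inter> \<sigma> d ` T) x \<partial>M) = (\<integral>\<^sup>+x. 0 \<partial>M)"
        by (intro nn_integral_cong_AE) (auto elim: eventually_mono)
      then have "emeasure M (\<sigma> a ` (T \<inter> \<sigma> d ` T)) = 0" by (simp add: emeasure_action_image)
      then have "\<sigma> a ` (T \<inter> \<sigma> d ` T) \<in> null_sets M" by (simp add: null_sets_def)
      then show ?thesis by (rule AE_not_in)
    qed
    have "AE x in M. \<forall>a d. d \<noteq> 0 \<longrightarrow> x \<notin> \<sigma> a ` (T \<inter> \<sigma> d ` T)"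
      unfolding AE_all_countable using null by auto
    moreover have "AE x in M. x \<notin> space M - (\<Union>a. \<sigma> a ` T)"
      using cover by (intro AE_not_in) (auto simp: null_sets_def)
    ultimately show ?thesis
      using AE_space
    proof eventually_elim
      case (elim x)
      then obtain a c where c: "c \<in> T" "x = \<sigma> a c" by auto
      have "c \<notin> \<sigma> d ` T" if "d \<noteq> 0" for d
        using elim(1)[rule_format, OF that, of a] c by auto
      then have "c \<in> C" using c(1) by (auto simp: C_def)
      then show ?case using c(2) by auto
    qed
  qed
  moreover have "C \<in> sets M" unfolding C_def by (intro sets.Diff T sets.countable_UN') auto
  ultimately show ?thesis by blast
qed

theorem theorem4p3:
  fixes M :: "'a measure"
    and \<sigma> :: "'g::{ab_group_add, countable} \<Rightarrow> 'a \<Rightarrow> 'a"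
    and J :: "'g \<Rightarrow> 'a \<Rightarrow> real"
    and \<psi> :: "nat \<Rightarrow> 'a \<Rightarrow> complex"
    and l m :: nat
  assumes "sigma_finite_measure M"
    and "quasi_invariant_action M \<sigma> J"
    and "tiling_property M \<sigma>"
    and "\<And>j. j \<in> {1..m} \<Longrightarrow> \<psi> j \<in> L2 M"
  shows "\<exists>Vs \<in> length_class M \<sigma> J l. \<forall>V \<in> length_class M \<sigma> J l.
           (\<Sum>j=1..m. (l2_norm M (\<lambda>x. \<psi> j x - l2_proj M Vs (\<psi> j) x))\<^sup>2)
             \<le> (\<Sum>j=1..m. (l2_norm M (\<lambda>x. \<psi> j x - l2_proj M V (\<psi> j) x))\<^sup>2)"
proof -
  interpret quasi_action M \<sigma> J
    using assms(1,2) by (simp add: quasi_action_def quasi_action_axioms_def)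
  obtain C where C: "C \<in> sets M" "\<And>a b. a \<noteq> b \<Longrightarrow> \<sigma> a ` C \<inter> \<sigma> b ` C = {}" "AE x in M. x \<in> (\<Union>a. \<sigma> a ` C)"
    using disjoint_tile[OF assms(3)] by blast
  obtain P :: "(nat \<Rightarrow> real) measure" and ch :: "'g \<Rightarrow> (nat \<Rightarrow> real) \<Rightarrow> complex"
    where ch: "haar_characters P ch"
    using exists_haar_characters[where 'g = 'g] by (elim exE)
  interpret P: prob_space P using ch by (simp add: haar_characters_def)
  interpret zak_action M \<sigma> J P C ch
    by unfold_locales (use C ch in \<open>simp_all add: haar_characters_def\<close>)
  show ?thesis by (rule optimal_subspace_exists) (use assms(4) in auto)
qed

end
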